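(* Let $G$ be a finite subgroup of $\mathrm{PSU}_2(\mathbb{C})$ acting on $\mathbb{P}^1=\mathbb{P}^1(\mathbb{C})$ by homographies and let $n\geq1$. Let $\omega$ be the holomorphic $1$-form on $\mathrm{Cf}_G(n,\mathbb{P}^1_* )$ with values in $\widehat{\mathrm{U}}\mathfrak{p}_n(G)(\mathbb{C})$ whose restriction to $U:=(\mathbb{P}^1\setminus\{\infty\})^n\cap\mathrm{Cf}_G(n,\mathbb{P}^1_* )$ is $$\omega_{|U}=\sum_{i\in[1,n]}\ \sum_{p\in\mathbb{P}^1\setminus\mathbb{P}^1_*}d\log(z_i-p)\,\widehat{\otimes}\,X_i(p)+\sum_{i\neq j\in[1,n]}\ \sum_{g\in G}d_{z_i}\log(z_i-g\cdot z_j)\,\widehat{\otimes}\,X_{ij}(g)$$ (with the convention $d\log(z-\infty)=0$). Then the formal connection $(\mathrm{Cf}_G(n,\mathbb{P}^1_* ),\widehat{\mathrm{U}}\mathfrak{p}_n(G)(\mathbb{C}),\omega)$ is flat; the form $\omega$ satisfies $$(d\,\widehat{\otimes}\,\mathrm{id})\,\omega=\omega\wedge\omega=0 .$$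
   Context: Notation: $[1,n]=\{1,\dots,n\}$; $\mathbb{P}^1_*$ is the set of points of $\mathbb{P}^1$ with trivial stabilizer in $G$; $\mathcal{O}(p)$ and $\mathrm{stab}(p)$ are the $G$-orbit and the stabilizer of $p$; $\mathrm{Cf}_G(n,\mathbb{P}^1_* )=\{(p_1,\dots,p_n)\in(\mathbb{P}^1_* )^n \mid p_i\neq g\cdot p_j \text{ for all } i\neq j,\ g\in G\}$; $z_1,\dots,z_n$ are the standard coordinates on $U$; $d_{z_i}\log(z_i-g\cdot z_j)=dz_i/(z_i-g\cdot z_j)$. The form $\omega$ on all of $\mathrm{Cf}_G(n,\mathbb{P}^1_* )$ with the given restriction exists and is unique. $\mathfrak{p}_n(G)(\mathbb{C})$ is the $\mathbb{C}$-Lie algebra with generators $X_{ij}(g)$ ($i\neq j\in[1,n]$, $g\in G$) and $X_i(q)$ ($i\in[1,n]$, $q\in\mathbb{P}^1\setminus\mathbb{P}^1_*$) and relations: (1) $X_{ij}(g)=X_{ji}(g^{-1})$ for $i\ne j$, $g\in G$; (2) $\sum_{q\in\mathbb{P}^1\setminus\mathbb{P}^1_*}X_i(q)+\sum_{m\neq i}\sum_{g\in G}X_{im}(g)=0$ for $i\in[1,n]$; (3) $[X_{ij}(g),X_{kl}(g')]=0$ for $i,j,k,l$ distinct, $g,g'\in G$; (4) $[X_{ij}(g),X_{kj}(g'g)+X_{ki}(g')]=0$ and $[X_i(p),X_{jk}(g')]=0$ for $i,j,k$ distinct, $p\in\mathbb{P}^1\setminus\mathbb{P}^1_*$, $g,g'\in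 G$; and, for $i\neq j$, $g\in G$, $p\in\mathbb{P}^1\setminus\mathbb{P}^1_*$, $q\in(\mathbb{P}^1\setminus\mathbb{P}^1_* )\setminus\mathcal{O}(p)$: (5) $[X_i(p),X_j(q)]=0$; (6) $[X_{ij}(g),X_j(p)+X_i(g\cdot p)+\sum_{h\in\mathrm{stab}(p)}X_{ij}(gh)]=0$; (7) $[X_j(p),X_i(g\cdot p)+\sum_{h\in\mathrm{stab}(p)}X_{ij}(gh)]=0$. It is graded with generators in degree $1$; $\widehat{\mathrm{U}}\mathfrak{p}_n(G)(\mathbb{C})$ is the completion of its enveloping algebra for the degree. For a complete graded algebra $A=\prod_{k\ge0}A_k$ ($A_0=\mathbb{C}$, finite-dimensional components) and a complex manifold $X$, $\Omega^\bullet(X)\widehat{\otimes}A$ is the completion of $\Omega^\bullet(X)\otimes_{\mathbb{C}}A$ (holomorphic forms) for the filtration $\Omega^\bullet(X)\otimes A_{\geq k}$, and $\wedge$ is its product. A formal connection is a triple $(X,A,\omega)$ with $\omega\in\Omega^1(X)\widehat{\otimes}A$ taking values in $A_{\geq1}$; it is flat if $(d\widehat{\otimes}\mathrm{id}_A)(\omega)-\omega\wedge\omega=0$. *)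

theory Defs
  imports
    "HOL-Analysis.Analysis"
    "HOL-Library.Poly_Mapping"
    "HOL-Algebra.Group_Action"
    "HOL-Algebra.QuotRing"
    "HOL-Algebra.Module"
begin

section \<open>The action of \<open>PSU\<^sub>2\<close> on the projective line\<close>

datatype CP1 = Fin complex | Infty

definition conj_transpose :: "complex^2^2 \<Rightarrow> complex^2^2" where
  "conj_transpose M = (\<chi> i j. cnj (M $ j $ i))"

definition SU2 :: "(complex^2^2) monoid" where
  "SU2 = \<lparr>carrier = {M. M ** conj_transpose M = mat 1 \<and> det M = 1}, mult = (**), one = mat 1\<rparr>"

type_synonym psu2 = "(complex^2^2) set"

definition PSU2 :: "psu2 monoid" where
  "PSU2 = SU2 Mod {mat 1, - mat 1}"

fun homography :: "complex^2^2 \<Rightarrow> CP1 \<Rightarrow> CP1" where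
  "homography M (Fin z) =
     (if M$2$1 * z + M$2$2 = 0 then Infty else Fin ((M$1$1 * z + M$1$2) / (M$2$1 * z + M$2$2)))"
| "homography M Infty = (if M$2$1 = 0 then Infty else Fin (M$1$1 / M$2$1))"

text \<open>All representatives of a class in \<^const>\<open>PSU2\<close> induce the same homography, so the image
  below is a singleton.\<close>

definition act :: "psu2 \<Rightarrow> CP1 \<Rightarrow> CP1" where
  "act g p = the_elem ((\<lambda>M. homography M p) ` g)"

abbreviation stab :: "psu2 set \<Rightarrow> CP1 \<Rightarrow> psu2 set" where
  "stab G p \<equiv> stabilizer (PSU2\<lparr>carrier := G\<rparr>) act p"

abbreviation orb :: "psu2 set \<Rightarrow> CP1 \<Rightarrow> CP1 set" where
  "orb G p \<equiv> orbit (PSU2\<lparr>carrier := G\<rparr>) act p"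

definition regular_points :: "psu2 set \<Rightarrow> CP1 set" where
  "regular_points G = {p. stab G p = {\<one>\<^bsub>PSU2\<^esub>}}"

definition special_points :: "psu2 set \<Rightarrow> CP1 set" where
  "special_points G = UNIV - regular_points G"

text \<open>Configurations are indexed by a finite type in the place of \<open>[1,n]\<close>.\<close>

definition Cf :: "psu2 set \<Rightarrow> ('n::finite \<Rightarrow> CP1) set" where
  "Cf G = {p. (\<forall>i. p i \<in> regular_points G) \<and>
              (\<forall>i j. i \<noteq> j \<longrightarrow> (\<forall>g\<in>G. p i \<noteq> act g (p j)))}"


section \<open>Graded complex algebras\<close>

text \<open>A graded complex algebra is recorded by its operations and its homogeneous components.
  The product need not be associative or unital: for a Lie algebra it is the bracket, and then
  the field \<^const>\<open>one\<close> carries no information.\<close>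

record 'b graded_algebra = "(complex, 'b) module" +
  homog :: "nat \<Rightarrow> 'b set"

definition quotient_algebra :: "'b graded_algebra \<Rightarrow> 'b set \<Rightarrow> 'b set graded_algebra" where
  "quotient_algebra A I =
     \<lparr>carrier = carrier (A Quot I), mult = mult (A Quot I), one = one (A Quot I),
      zero = zero (A Quot I), add = add (A Quot I),
      smult = (\<lambda>c B. \<Union>b\<in>B. I +>\<^bsub>A\<^esub> (c \<odot>\<^bsub>A\<^esub> b)),
      homog = (\<lambda>k. (\<lambda>x. I +>\<^bsub>A\<^esub> x) ` homog A k)\<rparr>"


section \<open>Lie algebras given by generators and relations\<close>

text \<open>The free Lie algebra on a set is the quotient of the free nonassociative algebra, spanned by
  the bracketed words, by the alternation and Jacobi identities.\<close>

datatype (letters: 'x) bword = Letter 'x | Br "'x bword" "'x bword"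

primrec bword_length :: "'x bword \<Rightarrow> nat" where
  "bword_length (Letter x) = 1"
| "bword_length (Br s t) = bword_length s + bword_length t"

type_synonym 'x magma_alg = "'x bword \<Rightarrow>\<^sub>0 complex"

definition free_bracket :: "'x magma_alg \<Rightarrow> 'x magma_alg \<Rightarrow> 'x magma_alg" where
  "free_bracket f g = (\<Sum>s\<in>Poly_Mapping.keys f. \<Sum>t\<in>Poly_Mapping.keys g.
     Poly_Mapping.single (Br s t) (Poly_Mapping.lookup f s * Poly_Mapping.lookup g t))"

definition free_magma_algebra :: "'x set \<Rightarrow> 'x magma_alg graded_algebra" where
  "free_magma_algebra X =
     \<lparr>carrier = {f. \<forall>t\<in>Poly_Mapping.keys f. letters t \<subseteq> X}, mult = free_bracket, one = undefined,
      zero = 0, add = (+), smult = (\<lambda>c. Poly_Mapping.map ((*) c)),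
      homog = (\<lambda>k. {f. \<forall>t\<in>Poly_Mapping.keys f. letters t \<subseteq> X \<and> bword_length t = k})\<rparr>"

text \<open>The two-sided ideal generated by a set. The constant \<^const>\<open>genideal\<close> does not apply
  here, since it presupposes an associative unital ring.\<close>

inductive_set bracket_ideal :: "'b graded_algebra \<Rightarrow> 'b set \<Rightarrow> 'b set"
  for A :: "'b graded_algebra" and R :: "'b set" where
  base: "r \<in> R \<Longrightarrow> r \<in> bracket_ideal A R"
| zero: "\<zero>\<^bsub>A\<^esub> \<in> bracket_ideal A R"
| add: "x \<in> bracket_ideal A R \<Longrightarrow> y \<in> bracket_ideal A R \<Longrightarrow> x \<oplus>\<^bsub>A\<^esub> y \<in> bracket_ideal A R"
| smult: "x \<in> bracket_ideal A R \<Longrightarrow> c \<odot>\<^bsub>A\<^esub> x \<in> bracket_ideal A R"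
| left: "a \<in> carrier A \<Longrightarrow> x \<in> bracket_ideal A R \<Longrightarrow> a \<otimes>\<^bsub>A\<^esub> x \<in> bracket_ideal A R"
| right: "x \<in> bracket_ideal A R \<Longrightarrow> a \<in> carrier A \<Longrightarrow> x \<otimes>\<^bsub>A\<^esub> a \<in> bracket_ideal A R"

definition lie_identities :: "'b graded_algebra \<Rightarrow> 'b set" where
  "lie_identities A =
     {x \<otimes>\<^bsub>A\<^esub> x | x. x \<in> carrier A} \<union>
     {x \<otimes>\<^bsub>A\<^esub> (y \<otimes>\<^bsub>A\<^esub> z) \<oplus>\<^bsub>A\<^esub> y \<otimes>\<^bsub>A\<^esub> (z \<otimes>\<^bsub>A\<^esub> x) \<oplus>\<^bsub>A\<^esub> z \<otimes>\<^bsub>A\<^esub> (x \<otimes>\<^bsub>A\<^esub> y) | x y z.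
        x \<in> carrier A \<and> y \<in> carrier A \<and> z \<in> carrier A}"

definition lie_presentation_ideal :: "'x set \<Rightarrow> 'x magma_alg set \<Rightarrow> 'x magma_alg set" where
  "lie_presentation_ideal X R =
     bracket_ideal (free_magma_algebra X) (lie_identities (free_magma_algebra X) \<union> R)"

definition presented_lie_algebra ::
    "'x set \<Rightarrow> 'x magma_alg set \<Rightarrow> 'x magma_alg set graded_algebra" where
  "presented_lie_algebra X R = quotient_algebra (free_magma_algebra X) (lie_presentation_ideal X R)"

definition presented_lie_generator :: "'x set \<Rightarrow> 'x magma_alg set \<Rightarrow> 'x \<Rightarrow> 'x magma_alg set" where
  "presented_lie_generator X R x =
     lie_presentation_ideal X R +>\<^bsub>free_magma_algebra X\<^esub> Poly_Mapping.single (Letter x) 1"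


section \<open>The enveloping algebra\<close>

text \<open>Words carry concatenation as addition, so that the product of
  \<^theory>\<open>HOL-Library.Poly_Mapping\<close> is that of the free associative algebra.\<close>

datatype 'a fword = FWord (word_list: "'a list")

instantiation fword :: (type) monoid_add
begin

definition zero_fword :: "'a fword" where
  "0 = FWord []"

definition plus_fword :: "'a fword \<Rightarrow> 'a fword \<Rightarrow> 'a fword" where
  "u + v = FWord (word_list u @ word_list v)"

instance
  by standard (simp_all add: zero_fword_def plus_fword_def)

end

type_synonym 'a free_assoc = "'a fword \<Rightarrow>\<^sub>0 complex"

text \<open>The free associative algebra on the underlying set of a graded vector space \<open>L\<close>; a word whose
  letters are homogeneous has the sum of their degrees as degree. The tensor algebra of \<open>L\<close> is its
  quotient by the linear relations in \<open>enveloping_relators\<close> below.\<close>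

definition free_assoc_algebra :: "'a graded_algebra \<Rightarrow> 'a free_assoc graded_algebra" where
  "free_assoc_algebra L =
     \<lparr>carrier = {f. \<forall>w\<in>Poly_Mapping.keys f. set (word_list w) \<subseteq> carrier L}, mult = (*), one = 1,
      zero = 0, add = (+), smult = (\<lambda>c. Poly_Mapping.map ((*) c)),
      homog = (\<lambda>k. {f. \<forall>w\<in>Poly_Mapping.keys f. set (word_list w) \<subseteq> carrier L \<and>
                 (\<exists>ds. list_all2 (\<lambda>x d. x \<in> homog L d) (word_list w) ds \<and> sum_list ds = k)})\<rparr>"

definition letter :: "'a \<Rightarrow> 'a free_assoc" where
  "letter x = Poly_Mapping.single (FWord [x]) 1"

definition enveloping_relators :: "'a graded_algebra \<Rightarrow> 'a free_assoc set" where
  "enveloping_relators L =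
     {letter (x \<oplus>\<^bsub>L\<^esub> y) - (letter x + letter y) | x y. x \<in> carrier L \<and> y \<in> carrier L} \<union>
     {letter (c \<odot>\<^bsub>L\<^esub> x) - Poly_Mapping.map ((*) c) (letter x) | c x. x \<in> carrier L} \<union>
     {letter (x \<otimes>\<^bsub>L\<^esub> y) - (letter x * letter y - letter y * letter x) | x y.
        x \<in> carrier L \<and> y \<in> carrier L}"

definition enveloping_ideal :: "'a graded_algebra \<Rightarrow> 'a free_assoc set" where
  "enveloping_ideal L = Idl\<^bsub>free_assoc_algebra L\<^esub> (enveloping_relators L)"

definition enveloping_algebra :: "'a graded_algebra \<Rightarrow> 'a free_assoc set graded_algebra" where
  "enveloping_algebra L = quotient_algebra (free_assoc_algebra L) (enveloping_ideal L)"

definition enveloping_map :: "'a graded_algebra \<Rightarrow> 'a \<Rightarrow> 'a free_assoc set" where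
  "enveloping_map L x = enveloping_ideal L +>\<^bsub>free_assoc_algebra L\<^esub> letter x"


section \<open>The Lie algebra \<open>\<pp>\<^sub>n(G)\<close>\<close>

datatype 'n pgen = Xij 'n 'n psu2 | Xi 'n CP1

definition pn_generators :: "psu2 set \<Rightarrow> 'n::finite pgen set" where
  "pn_generators G =
     {Xij i j g | i j g. i \<noteq> j \<and> g \<in> G} \<union> {Xi i q | i q. q \<in> special_points G}"

definition X2 :: "'n \<Rightarrow> 'n \<Rightarrow> psu2 \<Rightarrow> 'n pgen magma_alg" where
  "X2 i j g = Poly_Mapping.single (Letter (Xij i j g)) 1"

definition X1 :: "'n \<Rightarrow> CP1 \<Rightarrow> 'n pgen magma_alg" where
  "X1 i q = Poly_Mapping.single (Letter (Xi i q)) 1"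

definition pn_relators :: "psu2 set \<Rightarrow> 'n::finite pgen magma_alg set" where
  "pn_relators G =
     {X2 i j g - X2 j i (inv\<^bsub>PSU2\<^esub> g) | i j g. i \<noteq> j \<and> g \<in> G} \<union>
     {(\<Sum>q\<in>special_points G. X1 i q) + (\<Sum>m\<in>UNIV - {i}. \<Sum>g\<in>G. X2 i m g) | i. True} \<union>
     {free_bracket (X2 i j g) (X2 k l g') | i j k l g g'.
        distinct [i, j, k, l] \<and> g \<in> G \<and> g' \<in> G} \<union>
     {free_bracket (X2 i j g) (X2 k j (g' \<otimes>\<^bsub>PSU2\<^esub> g) + X2 k i g') | i j k g g'.
        distinct [i, j, k] \<and> g \<in> G \<and> g' \<in> G} \<union>
     {free_bracket (X1 i p) (X2 j k g') | i j k p g'.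
        distinct [i, j, k] \<and> p \<in> special_points G \<and> g' \<in> G} \<union>
     {free_bracket (X1 i p) (X1 j q) | i j p q.
        i \<noteq> j \<and> p \<in> special_points G \<and> q \<in> special_points G - orb G p} \<union>
     {free_bracket (X2 i j g)
        (X1 j p + X1 i (act g p) + (\<Sum>h\<in>stab G p. X2 i j (g \<otimes>\<^bsub>PSU2\<^esub> h))) | i j g p.
        i \<noteq> j \<and> g \<in> G \<and> p \<in> special_points G} \<union>
     {free_bracket (X1 j p)
        (X1 i (act g p) + (\<Sum>h\<in>stab G p. X2 i j (g \<otimes>\<^bsub>PSU2\<^esub> h))) | i j g p.
        i \<noteq> j \<and> g \<in> G \<and> p \<in> special_points G}"

definition pn :: "psu2 set \<Rightarrow> 'n::finite pgen magma_alg set graded_algebra" where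
  "pn G = presented_lie_algebra (pn_generators G) (pn_relators G)"

type_synonym 'n upn = "'n pgen magma_alg set free_assoc set"

definition Upn :: "psu2 set \<Rightarrow> 'n::finite upn graded_algebra" where
  "Upn G = enveloping_algebra (pn G)"

text \<open>The image of a generator in the enveloping algebra.\<close>

definition Ugen :: "psu2 set \<Rightarrow> 'n::finite pgen \<Rightarrow> 'n upn" where
  "Ugen G x = enveloping_map (pn G) (presented_lie_generator (pn_generators G) (pn_relators G) x)"


section \<open>Holomorphic forms on open subsets of \<open>(P\<^sup>1)\<^sup>n\<close>\<close>

text \<open>The standard atlas of \<open>(P\<^sup>1)\<^sup>n\<close> has one chart for each set \<open>S\<close> of indices: its coordinates
  are \<open>1/z\<^sub>i\<close> for \<open>i \<in> S\<close> and \<open>z\<^sub>i\<close> for \<open>i \<notin> S\<close>. Here is the inverse of this chart; it is defined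
  on all of \<open>\<complex>\<^sup>n\<close>.\<close>

definition chart_inv :: "'n set \<Rightarrow> complex^'n \<Rightarrow> 'n \<Rightarrow> CP1" where
  "chart_inv S w = (\<lambda>i. if i \<in> S then (if w $ i = 0 then Infty else Fin (1 / (w $ i)))
                        else Fin (w $ i))"

definition chart_dom :: "('n::finite \<Rightarrow> CP1) set \<Rightarrow> 'n set \<Rightarrow> (complex^'n) set" where
  "chart_dom X S = {w. chart_inv S w \<in> X}"

definition open_submanifold :: "('n::finite \<Rightarrow> CP1) set \<Rightarrow> bool" where
  "open_submanifold X \<longleftrightarrow> (\<forall>S. open (chart_dom X S))"

definition holomorphic_several :: "(complex^'n \<Rightarrow> complex) \<Rightarrow> (complex^'n) set \<Rightarrow> bool" where
  "holomorphic_several f D \<longleftrightarrow>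
     (\<forall>w\<in>D. \<exists>a::complex^'n. (f has_derivative (\<lambda>v. \<Sum>i\<in>UNIV. a $ i * v $ i)) (at w))"

definition partial_deriv :: "'n \<Rightarrow> (complex^'n \<Rightarrow> complex) \<Rightarrow> complex^'n \<Rightarrow> complex" where
  "partial_deriv i f w = deriv (\<lambda>t. f (\<chi> j. if j = i then t else w $ j)) (w $ i)"

text \<open>A 1-form is the family of its local expressions \<open>\<Sum>\<^sub>i \<alpha>(S,w,i) dw\<^sub>i\<close> in the charts \<open>S\<close>; they
  transform into each other by pullback along the changes of charts, which are \<open>w\<^sub>i \<mapsto> 1/w\<^sub>i\<close> for
  those \<open>i\<close> lying in exactly one of \<open>S\<close> and \<open>T\<close>. A 2-form
  \<open>\<Sum>\<^bsub>i<j\<^esub> \<beta>(S,w,i,j) dw\<^sub>i \<and> dw\<^sub>j\<close> is likewise given by the alternating matrices of its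
  coefficients. Coefficients are \<open>0\<close> outside of the part of the chart in \<open>X\<close>, so that equality of
  forms is equality of functions.\<close>

type_synonym 'n idx1 = "'n set \<times> (complex^'n) \<times> 'n"
type_synonym 'n idx2 = "'n set \<times> (complex^'n) \<times> 'n \<times> 'n"

definition Omega1 :: "('n::finite \<Rightarrow> CP1) set \<Rightarrow> ('n idx1 \<Rightarrow> complex) set" where
  "Omega1 X = {\<alpha>.
     (\<forall>S i. holomorphic_several (\<lambda>w. \<alpha> (S, w, i)) (chart_dom X S)) \<and>
     (\<forall>S T. \<forall>w\<in>chart_dom X S. \<forall>w'. chart_inv S w = chart_inv T w' \<longrightarrow>
        (\<forall>i. \<alpha> (S, w, i) = \<alpha> (T, w', i) * (if i \<in> S \<longleftrightarrow> i \<in> T then 1 else - 1 / (w $ i)\<^sup>2))) \<and>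
     (\<forall>S i. \<forall>w. w \<notin> chart_dom X S \<longrightarrow> \<alpha> (S, w, i) = 0)}"

definition ext_d :: "('n::finite \<Rightarrow> CP1) set \<Rightarrow> ('n idx1 \<Rightarrow> complex) \<Rightarrow> ('n idx2 \<Rightarrow> complex)" where
  "ext_d X \<alpha> = (\<lambda>(S, w, i, j).
     if w \<in> chart_dom X S
     then partial_deriv i (\<lambda>u. \<alpha> (S, u, j)) w - partial_deriv j (\<lambda>u. \<alpha> (S, u, i)) w
     else 0)"


section \<open>Forms with values in a complete graded algebra\<close>

text \<open>Scalar forms and homogeneous elements: \<open>\<Sum>\<^bsub>s<m\<^esub> \<alpha>\<^sub>s \<otimes> a\<^sub>s\<close>. As scalar forms are functions, their
  tensor product with a vector space embeds into the vector space-valued functions, and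
  we identify it with its image.\<close>

definition tensor_sum ::
    "'b graded_algebra \<Rightarrow> nat \<Rightarrow> (nat \<Rightarrow> 'c \<Rightarrow> complex) \<Rightarrow> (nat \<Rightarrow> 'b) \<Rightarrow> 'c \<Rightarrow> 'b" where
  "tensor_sum A m \<alpha> a = (\<lambda>x. \<Oplus>\<^bsub>A\<^esub>s\<in>{..<m}. \<alpha> s x \<odot>\<^bsub>A\<^esub> a s)"

definition tensor_space :: "('c \<Rightarrow> complex) set \<Rightarrow> 'b graded_algebra \<Rightarrow> nat \<Rightarrow> ('c \<Rightarrow> 'b) set" where
  "tensor_space \<Omega> A k = {tensor_sum A m \<alpha> a | m \<alpha> a. \<forall>s<m. \<alpha> s \<in> \<Omega> \<and> a s \<in> homog A k}"

text \<open>The map \<open>D \<otimes> id\<close> for a linear map \<open>D\<close> on \<open>\<Omega>\<close>.\<close>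

definition tensor_map ::
    "('c \<Rightarrow> complex) set \<Rightarrow> 'b graded_algebra \<Rightarrow> nat \<Rightarrow> (('c \<Rightarrow> complex) \<Rightarrow> ('e \<Rightarrow> complex)) \<Rightarrow>
     ('c \<Rightarrow> 'b) \<Rightarrow> ('e \<Rightarrow> 'b)" where
  "tensor_map \<Omega> A k D \<eta> = (THE \<zeta>. \<exists>m \<alpha> a. (\<forall>s<m. \<alpha> s \<in> \<Omega> \<and> a s \<in> homog A k) \<and>
     \<eta> = tensor_sum A m \<alpha> a \<and> \<zeta> = tensor_sum A m (\<lambda>s. D (\<alpha> s)) a)"

text \<open>In the remainder, a graded algebra \<open>A\<close> stands for its degree completion \<open>\<Prod>\<^sub>k A\<^sub>k\<close>. The
  completion of \<open>\<Omega> \<otimes> \<Prod>\<^sub>k A\<^sub>k\<close> for the filtration by the \<open>\<Omega> \<otimes> A\<^bsub>\<ge>k\<^esub>\<close> is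
  \<open>\<Prod>\<^sub>k \<Omega> \<otimes> A\<^sub>k\<close>, so a form is the sequence of its homogeneous components.\<close>

definition completed_forms :: "('c \<Rightarrow> complex) set \<Rightarrow> 'b graded_algebra \<Rightarrow> (nat \<Rightarrow> 'c \<Rightarrow> 'b) set" where
  "completed_forms \<Omega> A = {\<omega>. \<forall>k. \<omega> k \<in> tensor_space \<Omega> A k}"

definition d_completed ::
    "('n::finite \<Rightarrow> CP1) set \<Rightarrow> 'b graded_algebra \<Rightarrow> (nat \<Rightarrow> 'n idx1 \<Rightarrow> 'b) \<Rightarrow> (nat \<Rightarrow> 'n idx2 \<Rightarrow> 'b)" where
  "d_completed X A \<omega> = (\<lambda>k. tensor_map (Omega1 X) A k (ext_d X) (\<omega> k))"

definition wedge ::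
    "'b graded_algebra \<Rightarrow> (nat \<Rightarrow> 'n idx1 \<Rightarrow> 'b) \<Rightarrow> (nat \<Rightarrow> 'n idx1 \<Rightarrow> 'b) \<Rightarrow> (nat \<Rightarrow> 'n idx2 \<Rightarrow> 'b)" where
  "wedge A \<omega> \<eta> = (\<lambda>k (S, w, i, j). \<Oplus>\<^bsub>A\<^esub>l\<in>{..k}.
     \<omega> l (S, w, i) \<otimes>\<^bsub>A\<^esub> \<eta> (k - l) (S, w, j) \<ominus>\<^bsub>A\<^esub> \<omega> l (S, w, j) \<otimes>\<^bsub>A\<^esub> \<eta> (k - l) (S, w, i))"

definition zero_form :: "'b graded_algebra \<Rightarrow> nat \<Rightarrow> 'c \<Rightarrow> 'b" where
  "zero_form A = (\<lambda>k x. \<zero>\<^bsub>A\<^esub>)"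

definition diff_form :: "'b graded_algebra \<Rightarrow> (nat \<Rightarrow> 'c \<Rightarrow> 'b) \<Rightarrow> (nat \<Rightarrow> 'c \<Rightarrow> 'b) \<Rightarrow> (nat \<Rightarrow> 'c \<Rightarrow> 'b)" where
  "diff_form A \<omega> \<eta> = (\<lambda>k x. \<omega> k x \<ominus>\<^bsub>A\<^esub> \<eta> k x)"

definition formal_connection ::
    "('n::finite \<Rightarrow> CP1) set \<Rightarrow> 'b graded_algebra \<Rightarrow> (nat \<Rightarrow> 'n idx1 \<Rightarrow> 'b) \<Rightarrow> bool" where
  "formal_connection X A \<omega> \<longleftrightarrow>
     open_submanifold X \<and> \<omega> \<in> completed_forms (Omega1 X) A \<and> (\<forall>x. \<omega> 0 x = \<zero>\<^bsub>A\<^esub>)"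

definition flat ::
    "('n::finite \<Rightarrow> CP1) set \<Rightarrow> 'b graded_algebra \<Rightarrow> (nat \<Rightarrow> 'n idx1 \<Rightarrow> 'b) \<Rightarrow> bool" where
  "flat X A \<omega> \<longleftrightarrow> diff_form A (d_completed X A \<omega>) (wedge A \<omega> \<omega>) = zero_form A"


section \<open>The restriction of the connection form to the affine chart\<close>

text \<open>The coefficient of \<open>d log(z - p)\<close>, with \<open>d log(z - \<infinity>) = 0\<close>.\<close>

fun dlog :: "complex \<Rightarrow> CP1 \<Rightarrow> complex" where
  "dlog z (Fin a) = 1 / (z - a)"
| "dlog z Infty = 0"

text \<open>The coefficient of \<open>dz\<^sub>i\<close> at the point \<open>z\<close>; it is homogeneous of degree 1.\<close>

definition affine_coeff :: "psu2 set \<Rightarrow> complex^'n \<Rightarrow> 'n::finite \<Rightarrow> 'n upn" where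
  "affine_coeff G z i =
     (\<Oplus>\<^bsub>Upn G\<^esub>p\<in>special_points G. dlog (z $ i) p \<odot>\<^bsub>Upn G\<^esub> Ugen G (Xi i p)) \<oplus>\<^bsub>Upn G\<^esub>
     (\<Oplus>\<^bsub>Upn G\<^esub>j\<in>UNIV - {i}. \<Oplus>\<^bsub>Upn G\<^esub>g\<in>G.
        dlog (z $ i) (act g (Fin (z $ j))) \<odot>\<^bsub>Upn G\<^esub> Ugen G (Xij i j g))"

end

theory Submission
  imports Defs "HOL-Complex_Analysis.Cauchy_Integral_Formula"
begin

text \<open>
  The connection form has degree one, so everything reduces to the vanishing of \<open>d\<omega>\<close> and of the
  commutators of the coefficients of \<open>\<omega>\<close>. Linear functionals separate the points of the enveloping
  algebra, which turns both into identities between scalar holomorphic functions; by continuity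
  these need only be checked at points with finite nonzero coordinates. There \<open>d\<omega> = 0\<close> because the
  coefficients of \<open>X\<^sub>i\<^sub>j(g)\<close> and \<open>X\<^sub>j\<^sub>i(g\<inverse>)\<close> add up to a logarithmic differential.

  For the commutator of the coefficients of \<open>dz\<^sub>i\<close> and \<open>dz\<^sub>j\<close>, the Arnold relation among three points
  holds up to a defect \<open>\<kappa>(g) = c / (z\<^sub>i (c z\<^sub>j + d) - (a z\<^sub>j + b))\<close>, where \<open>a, b, c, d\<close> are the entries
  of \<open>g\<close>; it comes from the pole at infinity and does not depend on the third point. Relation (2)
  therefore trades the third points for the special points and for \<open>z\<^sub>i, z\<^sub>j\<close> themselves.
  A second use of the Arnold relation, now with a special point as third point, together with
  (5)-(7) leaves a combination of the \<open>[X\<^sub>i\<^sub>j(g), X\<^sub>i\<^sub>j(h)]\<close>. Its coefficients are symmetric in \<open>g\<close> and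
  \<open>h\<close>: the sum of \<open>1 / (z\<^sub>i - p)\<close> over the fixed points \<open>p\<close> of \<open>h g\<inverse>\<close> is the logarithmic derivative of
  the quadratic polynomial with these roots.
\<close>

section \<open>Homogeneous coordinates and homographies\<close>

text \<open>Elements of the enveloping algebra are cosets and awkward to compare, so no computation
  takes place there. Once a linear functional \<open>\<phi>\<close> is fixed, only its values
  \<open>b x y\<close> on brackets of two generators enter, and each defining relation becomes a
  linear equation between these numbers. Fixed points appear for the following reason. Relation (6)
  trades [X_ij(g), X_i(g p)] for brackets of X_ij(g) with X_j(p) and with the X_ij(g h), h in
  stab(p). As g h and g agree at p, a pair (g, g') collects one term for every special p with g p =
  g' p, and g p then runs through the fixed points of g' g^-1. Unitarity matters here: a parabolic
  element would have one double fixed point, counted once by the sum but twice by the logarithmic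
  derivative. The formula for the form covers finite points only. Passing to infinity takes
  continuity of the coefficients and, for d, of their partial derivatives; the latter is not part of
  \<open>holomorphic_several\<close> and comes from Cauchy's theory.\<close>

definition proj :: "complex \<Rightarrow> complex \<Rightarrow> CP1" where
  "proj x y = (if y = 0 then Infty else Fin (x / y))"

fun hx :: "CP1 \<Rightarrow> complex" where
  "hx (Fin z) = z"
| "hx Infty = 1"

fun hy :: "CP1 \<Rightarrow> complex" where
  "hy (Fin z) = 1"
| "hy Infty = 0"

lemma proj_hx_hy [simp]: "proj (hx p) (hy p) = p"
  by (cases p) (auto simp: proj_def)

lemma hx_hy_nonzero: "hx p \<noteq> 0 \<or> hy p \<noteq> 0"
  by (cases p) auto

lemma proj_eq_iff:
  assumes "x \<noteq> 0 \<or> y \<noteq> 0" "x' \<noteq> 0 \<or> y' \<noteq> 0"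
  shows "proj x y = proj x' y' \<longleftrightarrow> x * y' = x' * y"
  using assms by (auto simp: proj_def field_simps)

lemma proj_scale: "k \<noteq> 0 \<Longrightarrow> proj (k * x) (k * y) = proj x y"
  by (auto simp: proj_def)

lemma eq_proj_iff:
  assumes "x \<noteq> 0 \<or> y \<noteq> 0"
  shows "p = proj x y \<longleftrightarrow> hx p * y = x * hy p"
  using proj_eq_iff[OF hx_hy_nonzero assms, of p] by simp

text \<open>In homogeneous coordinates the convention at \<open>Infty\<close> is no exception: y = 0
  kills the numerator. The formulas below can thus treat finite points and the point at infinity
  alike.\<close>

lemma dlog_proj: "dlog u (proj x y) = y / (u * y - x)"
  by (auto simp: proj_def field_simps)

lemma homography_eq_proj:
  "homography M p = proj (M$1$1 * hx p + M$1$2 * hy p) (M$2$1 * hx p + M$2$2 * hy p)"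
  by (cases p) (auto simp: proj_def)

lemma det2: "det (M::complex^2^2) = M$1$1 * M$2$2 - M$1$2 * M$2$1"
  by (simp add: det_2)

lemma matrix2_nonzero:
  assumes "a * d - b * c = (1::complex)" "x \<noteq> 0 \<or> y \<noteq> 0"
  shows "a * x + b * y \<noteq> 0 \<or> c * x + d * y \<noteq> 0"
proof (rule ccontr)
  assume "\<not> ?thesis"
  then have 1: "a * x + b * y = 0" and 2: "c * x + d * y = 0" by auto
  \<comment> \<open>Multiply by the adjugate matrix: by Cramer's rule the image vector determines x
    and y.\<close>
  have "x = (a * d - b * c) * x" "y = (a * d - b * c) * y" using assms(1) by auto
  moreover have "(a * d - b * c) * x = d * (a * x + b * y) - b * (c * x + d * y)"
    "(a * d - b * c) * y = a * (c * x + d * y) - c * (a * x + b * y)"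
    by (simp_all add: algebra_simps)
  ultimately show False using 1 2 assms(2) by auto
qed

lemma homography_proj:
  assumes "x \<noteq> 0 \<or> y \<noteq> 0"
  shows "homography M (proj x y) = proj (M$1$1 * x + M$1$2 * y) (M$2$1 * x + M$2$2 * y)"
proof (cases "y = 0")
  case True
  then have x: "x \<noteq> 0" using assms by auto
  have "proj (M$1$1 * x) (M$2$1 * x) = proj (M$1$1) (M$2$1)"
    using proj_scale[OF x, of "M$1$1" "M$2$1"] by (simp add: mult.commute)
  then show ?thesis using True by (simp add: homography_eq_proj proj_def)
next
  case False
  have "proj (M$1$1 * x + M$1$2 * y) (M$2$1 * x + M$2$2 * y) =
      proj (y * (M$1$1 * (x/y) + M$1$2)) (y * (M$2$1 * (x/y) + M$2$2))"
    using False by (simp add: distrib_left mult.commute[of y])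
  also have "\<dots> = proj (M$1$1 * (x/y) + M$1$2) (M$2$1 * (x/y) + M$2$2)"
    by (rule proj_scale[OF False])
  also have "\<dots> = homography M (proj x y)" using False by (simp add: homography_eq_proj proj_def)
  finally show ?thesis ..
qed

text \<open>The determinant of K keeps the intermediate vector away from (0, 0), where
  \<open>proj\<close> takes a meaningless value.\<close>

lemma homography_mult:
  assumes "det K = 1"
  shows "homography (M ** K) p = homography M (homography K p)"
proof -
  have "K$1$1 * hx p + K$1$2 * hy p \<noteq> 0 \<or> K$2$1 * hx p + K$2$2 * hy p \<noteq> 0"
    using assms by (intro matrix2_nonzero[OF _ hx_hy_nonzero]) (simp add: det2)
  then have "homography M (homography K p) =
      proj (M$1$1 * (K$1$1 * hx p + K$1$2 * hy p) + M$1$2 * (K$2$1 * hx p + K$2$2 * hy p))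
           (M$2$1 * (K$1$1 * hx p + K$1$2 * hy p) + M$2$2 * (K$2$1 * hx p + K$2$2 * hy p))"
    by (simp add: homography_eq_proj[of K] homography_proj)
  also have "\<dots> = homography (M ** K) p"
    unfolding homography_eq_proj[of "M ** K"] by (simp add: matrix_matrix_mult_def sum_2 algebra_simps)
  finally show ?thesis ..
qed

lemma homography_uminus: "homography (- M) p = homography M p"
  using proj_scale[of "-1" "M$1$1 * hx p + M$1$2 * hy p" "M$2$1 * hx p + M$2$2 * hy p"]
  by (simp add: homography_eq_proj algebra_simps)

lemma homography_one [simp]: "homography (mat 1) p = p"
  by (simp add: homography_eq_proj mat_def)

section \<open>\<open>PSU\<^sub>2\<close> as a group of homographies\<close>

definition cls :: "complex^2^2 \<Rightarrow> psu2" where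
  "cls M = {M, - M}"

lemma act_cls: "act (cls M) p = homography M p"
  by (simp add: act_def cls_def homography_uminus)

text \<open>The inverse of a unitary matrix is its conjugate transpose, and for determinant 1 it is
  also the adjugate; the entries of the two are compared. Concretely, d and c are multiplied by the
  norm 1 of the first row and simplified with the orthogonality of the rows.\<close>

lemma SU2_entries:
  assumes "M \<in> carrier SU2"
  shows "M$2$2 = cnj (M$1$1)" "M$2$1 = - cnj (M$1$2)" "M$1$1 * M$2$2 - M$1$2 * M$2$1 = 1"
proof -
  define a b c d where abcd: "a = M$1$1" "b = M$1$2" "c = M$2$1" "d = M$2$2"
  have MM: "M ** conj_transpose M = mat 1" and "det M = 1"
    using assms by (auto simp: SU2_def)
  then have D: "a * d - b * c = 1" by (simp add: det2 abcd)
  have "(M ** conj_transpose M)$i$j = (mat 1 :: complex^2^2)$i$j" for i j using MM by simp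
  from this[of 1 1] this[of 1 2] this[of 2 1]
  have e: "a * cnj a + b * cnj b = 1" "a * cnj c + b * cnj d = 0" "c * cnj a + d * cnj b = 0"
    by (simp_all add: matrix_matrix_mult_def sum_2 conj_transpose_def mat_def abcd)
  have "d = d * (a * cnj a + b * cnj b)" using e by simp
  also have "\<dots> = cnj a * (a * d - b * c) + b * (c * cnj a + d * cnj b)" by (simp add: algebra_simps)
  finally show "M$2$2 = cnj (M$1$1)" using e D by (simp add: abcd)
  have "c = c * (a * cnj a + b * cnj b)" using e by simp
  also have "\<dots> = - cnj b * (a * d - b * c) + c * (a * cnj a + b * cnj b) + cnj b * (a * d - b * c)" by simp
  also have "\<dots> = - cnj b * (a * d - b * c) + a * (c * cnj a + d * cnj b)" by (simp add: algebra_simps)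
  finally show "M$2$1 = - cnj (M$1$2)" using e D by (simp add: abcd)
  show "M$1$1 * M$2$2 - M$1$2 * M$2$1 = 1" using D by (simp add: abcd)
qed

lemma SU2_iff: "M \<in> carrier SU2 \<longleftrightarrow>
  M$2$2 = cnj (M$1$1) \<and> M$2$1 = - cnj (M$1$2) \<and> M$1$1 * M$2$2 - M$1$2 * M$2$1 = 1"
  (is "_ \<longleftrightarrow> ?R")
proof
  assume R: ?R
  define a b c d where abcd: "a = M$1$1" "b = M$1$2" "c = M$2$1" "d = M$2$2"
  have d: "d = cnj a" and c: "c = - cnj b" and D: "a * d - b * c = 1" using R unfolding abcd by blast+
  have 1: "a * cnj a + b * cnj b = 1" using D unfolding c d by simp
  have 2: "a * cnj c + b * cnj d = 0" "c * cnj a + d * cnj b = 0" unfolding c d by simp_all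
  have 3: "c * cnj c + d * cnj d = 1" using 1 unfolding c d by (simp add: add.commute mult.commute)
  show "M \<in> carrier SU2"
    using 1 2 3 D by (simp add: SU2_def vec_eq_iff forall_2 matrix_matrix_mult_def sum_2
      conj_transpose_def mat_def det2 abcd[symmetric])
qed (use SU2_entries[of M] in blast)

lemma SU2_det: "M \<in> carrier SU2 \<Longrightarrow> det M = 1"
  by (simp add: SU2_def)

lemma SU2_mult:
  assumes M: "M \<in> carrier SU2" and K: "K \<in> carrier SU2"
  shows "M ** K \<in> carrier SU2"
proof -
  have "det (M ** K) = 1" using SU2_det[OF M] SU2_det[OF K] by (simp add: det_mul)
  moreover have "(M ** K)$2$2 = cnj ((M ** K)$1$1) \<and> (M ** K)$2$1 = - cnj ((M ** K)$1$2)"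
    using SU2_entries(1,2)[OF M] SU2_entries(1,2)[OF K] by (simp add: matrix_matrix_mult_def sum_2)
  ultimately show ?thesis unfolding SU2_iff det2 by blast
qed

lemma SU2_one: "mat 1 \<in> carrier SU2"
  unfolding SU2_iff by (simp add: mat_def)

text \<open>The adjugate serves as the inverse on \<open>SU2\<close>: its entries are linear in
  those of the matrix, so identities about inverses remain polynomial.\<close>

definition adj2 :: "complex^2^2 \<Rightarrow> complex^2^2" where
  "adj2 M = (\<chi> i j. if i = 1 then (if j = 1 then M$2$2 else - M$1$2)
                    else (if j = 1 then - M$2$1 else M$1$1))"

lemma adj2_simps [simp]:
  "adj2 M $1$1 = M$2$2" "adj2 M $1$2 = - M$1$2" "adj2 M $2$1 = - M$2$1" "adj2 M $2$2 = M$1$1"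
  by (simp_all add: adj2_def)

lemma SU2_adj2:
  assumes "M \<in> carrier SU2"
  shows "adj2 M \<in> carrier SU2"
proof -
  have "adj2 M$1$1 * adj2 M$2$2 - adj2 M$1$2 * adj2 M$2$1 = M$1$1 * M$2$2 - M$1$2 * M$2$1"
    unfolding adj2_simps by (simp add: mult.commute[of "M$2$2"])
  then show ?thesis using SU2_entries[OF assms] unfolding SU2_iff
    by (metis adj2_simps complex_cnj_cnj complex_cnj_minus)
qed

lemma adj2_mult:
  assumes "M \<in> carrier SU2"
  shows "adj2 M ** M = mat 1" "M ** adj2 M = mat 1"
proof -
  define a b c d where abcd: "a = M$1$1" "b = M$1$2" "c = M$2$1" "d = M$2$2"
  have D: "a * d - b * c = 1" using SU2_entries(3)[OF assms] by (simp add: abcd)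
  then have "d * a - b * c = 1" "a * d - c * b = 1" "d * a - c * b = 1"
    unfolding mult.commute[of d a] mult.commute[of c b] by assumption+
  moreover have "c * d = d * c" "b * d = d * b" "a * b = b * a" "a * c = c * a"
    by (rule mult.commute)+
  ultimately show "adj2 M ** M = mat 1" "M ** adj2 M = mat 1" using D
    by (auto simp add: vec_eq_iff forall_2 matrix_matrix_mult_def sum_2 mat_def abcd[symmetric])
qed

lemma matrix_uminus_mult: "(- M) ** K = - (M ** K)" "M ** (- K) = - (M ** K)" for M K :: "complex^2^2"
  by (simp_all add: vec_eq_iff matrix_matrix_mult_def sum_negf)

lemma PSU2_one: "\<one>\<^bsub>PSU2\<^esub> = cls (mat 1)"
  by (simp add: PSU2_def FactGroup_def cls_def)

lemma PSU2_carrier: "carrier PSU2 = cls ` carrier SU2"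
proof -
  have "{mat 1, - mat 1} #>\<^bsub>SU2\<^esub> M = cls M" for M
    by (auto simp: r_coset_def SU2_def cls_def matrix_uminus_mult)
  then show ?thesis by (auto simp: PSU2_def FactGroup_def RCOSETS_def)
qed

lemma PSU2_mult: "cls M \<otimes>\<^bsub>PSU2\<^esub> cls K = cls (M ** K)"
  by (auto simp: PSU2_def FactGroup_def set_mult_def SU2_def cls_def matrix_uminus_mult)

lemma group_PSU2: "group PSU2"
proof (rule groupI)
  fix x assume "x \<in> carrier PSU2"
  then obtain M where M: "M \<in> carrier SU2" "x = cls M" by (auto simp: PSU2_carrier)
  then show "\<exists>y\<in>carrier PSU2. y \<otimes>\<^bsub>PSU2\<^esub> x = \<one>\<^bsub>PSU2\<^esub>"
    by (intro bexI[of _ "cls (adj2 M)"])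
       (simp_all add: PSU2_carrier PSU2_mult PSU2_one adj2_mult SU2_adj2)
next
  show "\<one>\<^bsub>PSU2\<^esub> \<in> carrier PSU2" using SU2_one by (simp add: PSU2_carrier PSU2_one)
next
  fix x y assume "x \<in> carrier PSU2" "y \<in> carrier PSU2"
  then show "x \<otimes>\<^bsub>PSU2\<^esub> y \<in> carrier PSU2" by (auto simp: PSU2_carrier PSU2_mult intro!: imageI SU2_mult)
qed (auto simp: PSU2_carrier PSU2_mult PSU2_one matrix_mul_assoc)

lemma PSU2_inv: "M \<in> carrier SU2 \<Longrightarrow> inv\<^bsub>PSU2\<^esub> (cls M) = cls (adj2 M)"
  by (rule group.inv_equality[OF group_PSU2])
     (auto simp: PSU2_carrier PSU2_mult PSU2_one adj2_mult SU2_adj2)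

lemma act_mult:
  assumes "g \<in> carrier PSU2" "h \<in> carrier PSU2"
  shows "act (g \<otimes>\<^bsub>PSU2\<^esub> h) p = act g (act h p)"
  using assms by (auto simp: PSU2_carrier PSU2_mult act_cls homography_mult SU2_det)

lemma act_one [simp]: "act \<one>\<^bsub>PSU2\<^esub> p = p"
  by (simp add: PSU2_one act_cls)

text \<open>The sign of the representative is arbitrary. The quantities used later, such as the
  homography, the defect \<open>\<kappa>\<close> and the square of \<open>mdenom\<close>, do not
  depend on it.\<close>

definition rep :: "psu2 \<Rightarrow> complex^2^2" where
  "rep g = (SOME M. M \<in> carrier SU2 \<and> g = cls M)"

lemma rep: "g \<in> carrier PSU2 \<Longrightarrow> rep g \<in> carrier SU2" "g \<in> carrier PSU2 \<Longrightarrow> cls (rep g) = g"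
  using someI_ex[of "\<lambda>M. M \<in> carrier SU2 \<and> g = cls M"] unfolding rep_def PSU2_carrier by auto

lemma act_rep: "g \<in> carrier PSU2 \<Longrightarrow> act g p = homography (rep g) p"
  using act_cls[of "rep g"] rep(2) by simp

lemma cls_eqD: "cls M = cls K \<Longrightarrow> M = K \<or> M = - K"
  by (auto simp: cls_def doubleton_eq_iff)

text \<open>Up to the factor c v + d this is u - M v, but it stays meaningful at the pole of M.
  Exchanging u and v and passing to the adjugate only changes the sign, which is why the logarithmic
  coefficients in u and in v share this denominator.\<close>

definition mdenom :: "complex^2^2 \<Rightarrow> complex \<Rightarrow> complex \<Rightarrow> complex" where
  "mdenom M u v = u * (M$2$1 * v + M$2$2) - (M$1$1 * v + M$1$2)"

lemma mdenom_nonzero: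
  assumes "M \<in> carrier SU2" "Fin u \<noteq> homography M (Fin v)"
  shows "mdenom M u v \<noteq> 0"
proof -
  have nz: "M$1$1 * v + M$1$2 * 1 \<noteq> 0 \<or> M$2$1 * v + M$2$2 * 1 \<noteq> 0"
    using SU2_entries(3)[OF assms(1)] by (intro matrix2_nonzero) auto
  show ?thesis using assms(2) eq_proj_iff[of "M$1$1 * v + M$1$2" "M$2$1 * v + M$2$2" "Fin u"] nz
    by (auto simp: homography_eq_proj mdenom_def)
qed

lemma dlog_homography: "dlog u (homography M (Fin v)) = (M$2$1 * v + M$2$2) / mdenom M u v"
  by (simp add: homography_eq_proj dlog_proj mdenom_def)

lemma dlog_homography_adj2: "dlog v (homography (adj2 M) (Fin u)) = (M$2$1 * u - M$1$1) / mdenom M u v"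
proof -
  have "dlog v (homography (adj2 M) (Fin u)) = (M$1$1 - M$2$1 * u) / - mdenom M u v"
    by (simp add: homography_eq_proj dlog_proj mdenom_def algebra_simps)
  then show ?thesis by (simp add: divide_simps)
qed

section \<open>Two identities between logarithmic forms\<close>

text \<open>The Arnold relation would have right-hand side \<open>0\<close>; the defect comes from the dropped
  pole at infinity. What matters below is that it does not depend on \<open>p\<close>.\<close>

lemma dlog_arnold:
  assumes M: "M \<in> carrier SU2"
    and "Fin u \<noteq> homography M p" "Fin v \<noteq> p" "Fin u \<noteq> homography M (Fin v)"
  shows "- dlog u (homography M p) * dlog v p +
     dlog u (homography M p) * dlog v (homography (adj2 M) (Fin u)) +
     dlog u (homography M (Fin v)) * dlog v p = M$2$1 / mdenom M u v"
proof -
  define a b c d where abcd: "a = M$1$1" "b = M$1$2" "c = M$2$1" "d = M$2$2"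
  define x y where xy: "x = hx p" "y = hy p"
  have D: "a * d - b * c = 1" using SU2_entries(3)[OF M] by (simp add: abcd)
  have nz: "x \<noteq> 0 \<or> y \<noteq> 0" using hx_hy_nonzero by (simp add: xy)
  have p: "p = proj x y" by (simp add: xy)
  have mp: "homography M p = proj (a * x + b * y) (c * x + d * y)"
    by (simp add: homography_eq_proj abcd xy)
  have n1: "u * (c * x + d * y) - (a * x + b * y) \<noteq> 0"
    using assms(2) eq_proj_iff[OF matrix2_nonzero[OF D nz], of "Fin u"] by (simp add: mp)
  have n2: "v * y - x \<noteq> 0" using assms(3) eq_proj_iff[OF nz, of "Fin v"] by (simp add: p)
  define N where "N = mdenom M u v"
  have N: "N \<noteq> 0" using mdenom_nonzero[OF M assms(4)] by (simp add: N_def)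
  have Ne: "N = u * (c * v + d) - (a * v + b)" by (simp add: N_def mdenom_def abcd)
  define R where "R = u * (c * x + d * y) - (a * x + b * y)"
  define T where "T = v * y - x"
  have R: "R \<noteq> 0" and T: "T \<noteq> 0" using n1 n2 by (auto simp: R_def T_def)
  have "- ((c * x + d * y) / R) * (y / T) + ((c * x + d * y) / R) * ((c * u - a) / N)
       + ((c * v + d) / N) * (y / T) = c / N"
  proof -
    \<comment> \<open>R is linear in x and y, with y N - (c u - a) T = R. The first two terms thus
      combine to - (c x + d y) R, and (c v + d) y - (c x + d y) = c T.\<close>
    have key: "- (c * x + d * y) * y * N + (c * x + d * y) * (c * u - a) * T + (c * v + d) * y * R
        = c * R * T"
      unfolding R_def T_def Ne by (simp add: algebra_simps)
    have frac: "- (p / R) * (y / T) + p / R * (q / N) + r / N * (y / T) = (- p * y * N + p * q * T + r * y * R) / (N * R * T)"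
      for p q r
      using N R T by (simp add: add_divide_distrib diff_divide_distrib)
    have "- ((c * x + d * y) / R) * (y / T) + ((c * x + d * y) / R) * ((c * u - a) / N)
       + ((c * v + d) / N) * (y / T)
      = (- (c * x + d * y) * y * N + (c * x + d * y) * (c * u - a) * T + (c * v + d) * y * R) / (N * R * T)"
      by (rule frac)
    also have "\<dots> = c * R * T / (N * R * T)" by (simp only: key)
    also have "\<dots> = c / N" using R T by simp
    finally show ?thesis .
  qed
  then show ?thesis
    unfolding dlog_homography_adj2 unfolding dlog_homography mp unfolding p dlog_proj
    by (simp add: abcd R_def T_def N_def)
qed

text \<open>This is \<open>mdenom M u u\<close>. Its degree drops below 2 when c = 0, which is
  exactly when \<open>Infty\<close> is a fixed point, in accordance with
  \<open>dlog u Infty = 0\<close>.\<close>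

definition fixpoly :: "complex^2^2 \<Rightarrow> complex \<Rightarrow> complex" where
  "fixpoly M u = M$2$1 * u^2 + (M$2$2 - M$1$1) * u - M$1$2"

lemma homography_fixed_iff:
  assumes "M \<in> carrier SU2"
  shows "homography M (Fin u) = Fin u \<longleftrightarrow> fixpoly M u = 0"
proof -
  have nz: "M$1$1 * u + M$1$2 * 1 \<noteq> 0 \<or> M$2$1 * u + M$2$2 * 1 \<noteq> 0"
    using SU2_entries(3)[OF assms(1)] by (intro matrix2_nonzero) auto
  have "Fin u = homography M (Fin u) \<longleftrightarrow> u * (M$2$1 * u + M$2$2) = M$1$1 * u + M$1$2"
    using eq_proj_iff[OF nz, of "Fin u"] by (simp add: homography_eq_proj)
  also have "\<dots> \<longleftrightarrow> fixpoly M u = 0" by (auto simp: fixpoly_def power2_eq_square algebra_simps)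
  finally show ?thesis by auto
qed

lemma complex_quadratic_roots:
  fixes c e b :: complex
  assumes "c \<noteq> 0" "e^2 + 4 * b * c \<noteq> 0"
  obtains p q where "p \<noteq> q" "\<And>u. c * u^2 + e * u - b = c * (u - p) * (u - q)" "e = - c * (p + q)"
proof -
  define s where "s = csqrt (e^2 + 4 * b * c)"
  have s: "s^2 = e^2 + 4 * b * c" "s \<noteq> 0" using assms by (auto simp: s_def)
  define p q where pq: "p = (- e + s) / (2 * c)" "q = (- e - s) / (2 * c)"
  have 1: "2 * c * p = - e + s" "2 * c * q = - e - s" using assms by (auto simp: pq)
  have "p \<noteq> q" using 1 s(2) by auto
  moreover have "2 * e = - (2 * c * p + 2 * c * q)" unfolding 1 by simp
  then have "2 * e = 2 * (- c * (p + q))" by (simp add: algebra_simps)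
  then have e: "e = - c * (p + q)" by (simp only: mult_cancel_left) auto
  moreover have "4 * c * (c * u^2 + e * u - b) = 4 * c * (c * (u - p) * (u - q))" for u
  proof -
    have "4 * c * (c * (u - p) * (u - q)) = (2 * c * u - 2 * c * p) * (2 * c * u - 2 * c * q)"
      by (simp add: algebra_simps)
    also have "\<dots> = (2 * c * u + e) ^ 2 - s ^ 2" unfolding 1 by (simp add: algebra_simps power2_eq_square)
    also have "\<dots> = 4 * c * (c * u^2 + e * u - b)"
      unfolding s(1) by (simp add: algebra_simps power2_eq_square)
    finally show ?thesis ..
  qed
  then have "c * u^2 + e * u - b = c * (u - p) * (u - q)" for u using assms by auto
  ultimately show ?thesis using that by blast
qed

text \<open>A nontrivial element of \<open>PSU\<^sub>2\<close> has two distinct fixed points, so the sum over them is the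
  logarithmic derivative of the polynomial whose roots they are.\<close>

lemma SU2_fixed_points:
  assumes M: "M \<in> carrier SU2" and "M \<noteq> mat 1" "M \<noteq> - mat 1"
  shows "finite {p. homography M p = p}"
    and "fixpoly M u \<noteq> 0 \<Longrightarrow>
      (\<Sum>p\<in>{p. homography M p = p}. dlog u p) = (2 * M$2$1 * u + M$2$2 - M$1$1) / fixpoly M u"
proof -
  define a b c d where abcd: "a = M$1$1" "b = M$1$2" "c = M$2$1" "d = M$2$2"
  have D: "a * d - b * c = 1" "d = cnj a" "c = - cnj b" using SU2_entries[OF M] by (auto simp: abcd)
  have f: "fixpoly M u = c * u^2 + (d - a) * u - b" for u by (simp add: fixpoly_def abcd)
  have fi: "Fin z \<in> {p. homography M p = p} \<longleftrightarrow> c * z^2 + (d - a) * z - b = 0" for z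
    using homography_fixed_iff[OF M] by (simp add: f)
  have fI: "Infty \<in> {p. homography M p = p} \<longleftrightarrow> c = 0" by (auto simp: abcd)
  have "finite {p. homography M p = p} \<and> (fixpoly M u \<noteq> 0 \<longrightarrow>
      (\<Sum>p\<in>{p. homography M p = p}. dlog u p) = (2 * c * u + d - a) / fixpoly M u)"
  proof (cases "c = 0")
    case True
    \<comment> \<open>By unitarity the matrix is diagonal; the fixed points are 0 and
      \<open>Infty\<close>, and the latter contributes nothing to the sum.\<close>
    then have b: "b = 0" using D by auto
    have da: "d \<noteq> a"
    proof
      assume "d = a"
      then have "a * a = 1" using D b by simp
      then have "a = 1 \<or> a = - 1" by (metis square_eq_1_iff)
      then have "M = mat 1 \<or> M = - mat 1"
        using b True \<open>d = a\<close> by (auto simp: vec_eq_iff forall_2 mat_def abcd)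
      then show False using assms by auto
    qed
    have "p \<in> {p. homography M p = p} \<longleftrightarrow> p \<in> {Infty, Fin 0}" for p
      using True b da fi fI by (cases p) auto
    then have "{p. homography M p = p} = {Infty, Fin 0}" by blast
    then show ?thesis using True b da by (auto simp: f)
  next
    case False
    have b: "b \<noteq> 0" using False D by auto
    have "cmod a ^ 2 + cmod b ^ 2 = 1"
    proof -
      have "a * cnj a + b * cnj b = 1" using D by simp
      then have "complex_of_real (cmod a ^ 2 + cmod b ^ 2) = of_real 1"
        by (simp only: of_real_add complex_norm_square of_real_1)
      then show ?thesis by (simp only: of_real_eq_iff)
    qed
    then have "cmod a ^ 2 < 1" using b by (smt (verit) zero_less_norm_iff zero_less_power)
    then have ra: "(Re a)^2 < 1" using power_mono[OF abs_Re_le_cmod[of a], of 2] by simp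
    \<comment> \<open>The discriminant is the squared trace minus four times the determinant. The
      trace is 2 Re a, and |a| < 1 because b is nonzero, so the two roots are distinct.\<close>
    have "(d - a)^2 + 4 * b * c = (a + d)^2 - 4 * (a * d - b * c)"
      by (simp add: algebra_simps power2_eq_square)
    also have "\<dots> = (a + d)^2 - 4" using D(1) by simp
    also have "a + d = of_real (2 * Re a)" using D(2) by (simp add: complex_add_cnj)
    also have "(complex_of_real (2 * Re a))^2 - 4 = of_real (4 * (Re a)^2 - 4)"
      by (simp add: power_mult_distrib)
    finally have "(d - a)^2 + 4 * b * c = of_real (4 * (Re a)^2 - 4)" .
    moreover have "4 * (Re a)^2 - 4 \<noteq> 0" using ra by simp
    ultimately have disc: "(d - a)^2 + 4 * b * c \<noteq> 0" by (metis of_real_eq_0_iff)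
    obtain p q where pq: "p \<noteq> q" "\<And>u. c * u^2 + (d - a) * u - b = c * (u - p) * (u - q)"
      "d - a = - c * (p + q)" using complex_quadratic_roots[OF False disc] by metis
    have "x \<in> {p. homography M p = p} \<longleftrightarrow> x \<in> {Fin p, Fin q}" for x
      using False fi fI pq(2) by (cases x) auto
    then have E: "{p. homography M p = p} = {Fin p, Fin q}" by blast
    have "1 / (u - p) + 1 / (u - q) = (2 * c * u + d - a) / fixpoly M u" if "fixpoly M u \<noteq> 0"
    proof -
      have n: "u - p \<noteq> 0" "u - q \<noteq> 0" using that by (auto simp: f pq(2))
      have "2 * c * u + d - a = c * ((u - p) + (u - q))" using pq(3) by (simp add: algebra_simps)
      then have "(2 * c * u + d - a) / fixpoly M u = (c * ((u - p) + (u - q))) / (c * (u - p) * (u - q))"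
        unfolding f pq(2) by simp
      also have "\<dots> = 1 / (u - p) + 1 / (u - q)" using n False by (simp add: divide_simps)
      finally show ?thesis ..
    qed
    then show ?thesis using E pq(1) by auto
  qed
  then show "finite {p. homography M p = p}"
    and "fixpoly M u \<noteq> 0 \<Longrightarrow>
      (\<Sum>p\<in>{p. homography M p = p}. dlog u p) = (2 * M$2$1 * u + M$2$2 - M$1$1) / fixpoly M u"
    by (auto simp: abcd)
qed

text \<open>M and K represent two group elements g and h. The points M^-1 u and K^-1 u coincide
  exactly when u is fixed by L = K M^-1, so the difference of the first two coefficients has
  \<open>fixpoly L u\<close> as numerator, up to sign. The sum over the fixed points replaces this
  numerator by its derivative in u, which cancels the other four terms. The identity expresses a
  symmetry of coefficients in g and h.\<close>

lemma dlog_fixed_points_identity: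
  assumes M: "M \<in> carrier SU2" and K: "K \<in> carrier SU2"
    and n: "Fin u \<noteq> homography M (Fin v)" "Fin u \<noteq> homography K (Fin v)"
    and ne: "M \<noteq> K" "M \<noteq> - K"
    and u: "homography (K ** adj2 M) (Fin u) \<noteq> Fin u"
  shows "(dlog v (homography (adj2 M) (Fin u)) - dlog v (homography (adj2 K) (Fin u))) *
      (\<Sum>p\<in>{p. homography (K ** adj2 M) p = p}. dlog u p) +
      dlog u (homography M (Fin v)) * dlog v (homography (adj2 K) (Fin u)) -
      dlog u (homography K (Fin v)) * dlog v (homography (adj2 M) (Fin u)) -
      M$2$1 / mdenom M u v + K$2$1 / mdenom K u v = 0"
proof -
  define a b c d where abcd: "a = M$1$1" "b = M$1$2" "c = M$2$1" "d = M$2$2"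
  define a' b' c' d' where abcd': "a' = K$1$1" "b' = K$1$2" "c' = K$2$1" "d' = K$2$2"
  define L where "L = K ** adj2 M"
  have L: "L \<in> carrier SU2" unfolding L_def by (intro SU2_mult SU2_adj2 M K)
  have LM: "L ** M = K"
    unfolding L_def using M by (simp add: matrix_mul_assoc[symmetric] adj2_mult)
  have L1: "L \<noteq> mat 1" "L \<noteq> - mat 1" using LM ne by (auto simp: matrix_uminus_mult)
  define f where "f = fixpoly L u"
  have f: "f \<noteq> 0" using u homography_fixed_iff[OF L] by (simp add: L_def f_def)
  have Le: "L$1$1 = a' * d - b' * c" "L$1$2 = - a' * b + b' * a"
    "L$2$1 = c' * d - d' * c" "L$2$2 = - c' * b + d' * a"
    by (simp_all add: L_def matrix_matrix_mult_def sum_2 abcd abcd')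
  have S: "(\<Sum>p\<in>{p. homography L p = p}. dlog u p) = (2 * L$2$1 * u + L$2$2 - L$1$1) / f"
    unfolding f_def by (rule SU2_fixed_points(2)[OF L L1]) (use f in \<open>simp add: f_def\<close>)
  define N where "N = mdenom M u v"
  define N' where "N' = mdenom K u v"
  have N: "N \<noteq> 0" "N' \<noteq> 0" using mdenom_nonzero[OF M n(1)] mdenom_nonzero[OF K n(2)]
    by (auto simp: N_def N'_def)
  have Ne: "N = u * (c * v + d) - (a * v + b)" "N' = u * (c' * v + d') - (a' * v + b')"
    by (simp_all add: N_def N'_def mdenom_def abcd abcd')
  have fe: "f = (c' * d - d' * c) * u^2 + (- c' * b + d' * a - (a' * d - b' * c)) * u - (- a' * b + b' * a)"
    by (simp add: f_def fixpoly_def Le)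
  define e where "e = 2 * L$2$1 * u + L$2$2 - L$1$1"
  have e: "e = 2 * (c' * d - d' * c) * u + (- c' * b + d' * a) - (a' * d - b' * c)"
    by (simp add: e_def Le)
  have f1: "(c * u - a) * N' - (c' * u - a') * N = - f"
    unfolding Ne fe by (simp add: algebra_simps power2_eq_square)
  have 1: "(c * u - a) / N - (c' * u - a') / N' = - f / (N * N')"
    unfolding diff_frac_eq[OF N] f1 ..
  \<comment> \<open>Up to sign this is the derivative of \<open>f1\<close> in u: e is the derivative
    of f, and c v + d that of N.\<close>
  have e1: "(c * v + d) * (c' * u - a') - (c' * v + d') * (c * u - a) - c * N' + c' * N = e"
    unfolding Ne e by (simp add: algebra_simps power2_eq_square)
  have frac: "p / N * (q / N') - r / N' * (s / N) - k / N + k' / N' = (p * q - r * s - k * N' + k' * N) / (N * N')"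
    for p q r s k k'
    using N by (simp add: add_divide_distrib diff_divide_distrib mult.commute)
  have 2: "(c * v + d) / N * ((c' * u - a') / N') - (c' * v + d') / N' * ((c * u - a) / N)
     - c / N + c' / N' = e / (N * N')"
    unfolding frac e1 ..
  have "((c * u - a) / N - (c' * u - a') / N') * (e / f) + (c * v + d) / N * ((c' * u - a') / N')
      - (c' * v + d') / N' * ((c * u - a) / N) - c / N + c' / N' = - f / (N * N') * (e / f) + e / (N * N')"
    unfolding 1 2[symmetric] by simp
  also have "\<dots> = 0" using f by simp
  finally show ?thesis
    unfolding dlog_homography_adj2 unfolding dlog_homography L_def[symmetric] S e_def abcd abcd' N_def N'_def .
qed

section \<open>Finite groups of homographies\<close>

lemma cls_uminus: "cls (- M) = cls M"
  by (auto simp: cls_def)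

locale finite_psu2 =
  fixes G :: "psu2 set"
  assumes subgroup_G: "subgroup G PSU2" and finite_G: "finite G"
begin

lemma G_carrier: "g \<in> G \<Longrightarrow> g \<in> carrier PSU2"
  using subgroup.mem_carrier[OF subgroup_G] .

lemma G_mult [simp]: "g \<in> G \<Longrightarrow> h \<in> G \<Longrightarrow> g \<otimes>\<^bsub>PSU2\<^esub> h \<in> G"
  using subgroup.m_closed[OF subgroup_G] .

lemma G_inv [simp]: "g \<in> G \<Longrightarrow> inv\<^bsub>PSU2\<^esub> g \<in> G"
  using subgroup.m_inv_closed[OF subgroup_G] .

lemma G_one [simp]: "\<one>\<^bsub>PSU2\<^esub> \<in> G"
  using subgroup.one_closed[OF subgroup_G] .

lemma G_inv_inv [simp]: "g \<in> G \<Longrightarrow> inv\<^bsub>PSU2\<^esub> (inv\<^bsub>PSU2\<^esub> g) = g"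
  by (simp add: group.inv_inv group_PSU2 G_carrier)

lemma G_cancel [simp]:
  assumes "g \<in> G" "h \<in> G"
  shows "inv\<^bsub>PSU2\<^esub> g \<otimes>\<^bsub>PSU2\<^esub> (g \<otimes>\<^bsub>PSU2\<^esub> h) = h" "g \<otimes>\<^bsub>PSU2\<^esub> (inv\<^bsub>PSU2\<^esub> g \<otimes>\<^bsub>PSU2\<^esub> h) = h"
    "h \<otimes>\<^bsub>PSU2\<^esub> g \<otimes>\<^bsub>PSU2\<^esub> inv\<^bsub>PSU2\<^esub> g = h" "h \<otimes>\<^bsub>PSU2\<^esub> inv\<^bsub>PSU2\<^esub> g \<otimes>\<^bsub>PSU2\<^esub> g = h"
  using assms group.inv_solve_left[OF group_PSU2] group.inv_solve_right[OF group_PSU2]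
    group.is_monoid[OF group_PSU2]
  by (simp_all add: G_carrier group.inv_closed[OF group_PSU2] monoid.m_assoc[symmetric] group.l_inv[OF group_PSU2]
     group.r_inv[OF group_PSU2] monoid.l_one)
     (simp_all add: G_carrier group.inv_closed[OF group_PSU2] monoid.m_assoc group.l_inv[OF group_PSU2]
     group.r_inv[OF group_PSU2] monoid.r_one)

lemma act_G_mult: "g \<in> G \<Longrightarrow> h \<in> G \<Longrightarrow> act (g \<otimes>\<^bsub>PSU2\<^esub> h) p = act g (act h p)"
  by (simp add: act_mult G_carrier)

lemma act_inv_act [simp]: "g \<in> G \<Longrightarrow> act (inv\<^bsub>PSU2\<^esub> g) (act g p) = p"
  using act_G_mult[of "inv\<^bsub>PSU2\<^esub> g" g p] by (simp add: G_carrier group.l_inv[OF group_PSU2])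

lemma act_act_inv [simp]: "g \<in> G \<Longrightarrow> act g (act (inv\<^bsub>PSU2\<^esub> g) p) = p"
  using act_G_mult[of g "inv\<^bsub>PSU2\<^esub> g" p] by (simp add: G_carrier group.r_inv[OF group_PSU2])

lemma stab_eq: "stab G p = {g \<in> G. act g p = p}"
  by (simp add: stabilizer_def)

lemma orb_eq: "orb G p = {act g p | g. g \<in> G}"
  by (simp add: orbit_def)

lemma special_iff: "p \<in> special_points G \<longleftrightarrow> (\<exists>g\<in>G. g \<noteq> \<one>\<^bsub>PSU2\<^esub> \<and> act g p = p)"
  by (auto simp: special_points_def regular_points_def stab_eq)

lemma act_special: "g \<in> G \<Longrightarrow> p \<in> special_points G \<Longrightarrow> act g p \<in> special_points G"
proof -
  assume g: "g \<in> G" and "p \<in> special_points G"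
  then obtain h where h: "h \<in> G" "h \<noteq> \<one>\<^bsub>PSU2\<^esub>" "act h p = p" by (auto simp: special_iff)
  define k where "k = g \<otimes>\<^bsub>PSU2\<^esub> h \<otimes>\<^bsub>PSU2\<^esub> inv\<^bsub>PSU2\<^esub> g"
  have k: "k \<in> G" using g h by (simp add: k_def)
  have "k \<otimes>\<^bsub>PSU2\<^esub> g = g \<otimes>\<^bsub>PSU2\<^esub> h" using g h by (simp add: k_def)
  then have "k \<noteq> \<one>\<^bsub>PSU2\<^esub>" using g h
    by (metis G_cancel(1) G_carrier G_one group.is_monoid group_PSU2 monoid.l_one monoid.r_one)
  moreover have "act k (act g p) = act g p" using g h k by (simp add: k_def act_G_mult)
  ultimately show ?thesis using k by (auto simp: special_iff)
qed

text \<open>Special points are the fixed points of the finitely many nontrivial elements of G, each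
  of which fixes finitely many points. Without finiteness the sums over special points would be 0 by
  convention.\<close>

lemma finite_special: "finite (special_points G)"
proof -
  have "finite {p. act g p = p}" if g: "g \<in> G" "g \<noteq> \<one>\<^bsub>PSU2\<^esub>" for g
  proof -
    have gc: "g \<in> carrier PSU2" using g G_carrier by auto
    have "rep g \<noteq> mat 1" "rep g \<noteq> - mat 1"
      using rep(2)[OF gc] g(2) cls_uminus PSU2_one by metis+
    then show ?thesis using SU2_fixed_points(1)[OF rep(1)[OF gc]] by (simp add: act_rep[OF gc])
  qed
  then have "finite (\<Union>g\<in>G - {\<one>\<^bsub>PSU2\<^esub>}. {p. act g p = p})" using finite_G by auto
  then show ?thesis by (rule rev_finite_subset) (auto simp: special_iff)
qed

section \<open>Reindexing sums over the group, its stabilizers and the special points\<close>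

lemma sum_inv: "(\<Sum>g\<in>G. f (inv\<^bsub>PSU2\<^esub> g)) = (\<Sum>g\<in>G. f g)"
  by (rule sum.reindex_bij_witness[where i="m_inv PSU2" and j="m_inv PSU2"]) auto

lemma sum_mult_left: "h \<in> G \<Longrightarrow> (\<Sum>g\<in>G. f (h \<otimes>\<^bsub>PSU2\<^esub> g)) = (\<Sum>g\<in>G. f g)"
  by (rule sum.reindex_bij_witness[where i="\<lambda>g. inv\<^bsub>PSU2\<^esub> h \<otimes>\<^bsub>PSU2\<^esub> g" and j="\<lambda>g. h \<otimes>\<^bsub>PSU2\<^esub> g"]) auto

lemma sum_mult_right: "h \<in> G \<Longrightarrow> (\<Sum>g\<in>G. f (g \<otimes>\<^bsub>PSU2\<^esub> h)) = (\<Sum>g\<in>G. f g)"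
  by (rule sum.reindex_bij_witness[where i="\<lambda>g. g \<otimes>\<^bsub>PSU2\<^esub> inv\<^bsub>PSU2\<^esub> h" and j="\<lambda>g. g \<otimes>\<^bsub>PSU2\<^esub> h"]) auto

lemma sum_special: "h \<in> G \<Longrightarrow> (\<Sum>p\<in>special_points G. f (act h p)) = (\<Sum>p\<in>special_points G. f p)"
  by (rule sum.reindex_bij_witness[where i="act (inv\<^bsub>PSU2\<^esub> h)" and j="act h"]) (auto simp: act_special)

text \<open>The coset h stab(p) consists of the elements that send p where h does. In this form the
  sum can be interchanged with a sum over p.\<close>

lemma sum_stab:
  assumes "h \<in> G"
  shows "(\<Sum>g\<in>stab G p. f (h \<otimes>\<^bsub>PSU2\<^esub> g)) = (\<Sum>g\<in>{g\<in>G. act g p = act h p}. f g)"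
  by (rule sum.reindex_bij_witness[where i="\<lambda>g. inv\<^bsub>PSU2\<^esub> h \<otimes>\<^bsub>PSU2\<^esub> g" and j="\<lambda>g. h \<otimes>\<^bsub>PSU2\<^esub> g"])
     (use assms in \<open>auto simp: stab_eq act_G_mult\<close>)

lemma Xij_generator [simp]: "i \<noteq> j \<Longrightarrow> g \<in> G \<Longrightarrow> Xij i j g \<in> pn_generators G"
  by (auto simp: pn_generators_def)

lemma Xi_generator [simp]: "p \<in> special_points G \<Longrightarrow> Xi i p \<in> pn_generators G"
  by (auto simp: pn_generators_def)

lemma Cf_iff: "p \<in> Cf G \<longleftrightarrow> (\<forall>i. p i \<notin> special_points G) \<and> (\<forall>i j. i \<noteq> j \<longrightarrow> (\<forall>g\<in>G. p i \<noteq> act g (p j)))"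
  by (auto simp: Cf_def special_points_def)

lemma act_rep_inv: "g \<in> G \<Longrightarrow> act (inv\<^bsub>PSU2\<^esub> g) p = homography (adj2 (rep g)) p"
  using PSU2_inv[OF rep(1)[OF G_carrier], of g] rep(2)[OF G_carrier, of g] by (simp add: act_cls)

lemma dlog_arnold_G:
  assumes "g \<in> G" "Fin u \<noteq> act g p" "Fin v \<noteq> p" "Fin u \<noteq> act g (Fin v)"
  shows "- dlog u (act g p) * dlog v p + dlog u (act g p) * dlog v (act (inv\<^bsub>PSU2\<^esub> g) (Fin u)) +
     dlog u (act g (Fin v)) * dlog v p = rep g $2$1 / mdenom (rep g) u v"
  using dlog_arnold[OF rep(1)[OF G_carrier[OF assms(1)]], of u p v] assms
  by (simp add: act_rep[OF G_carrier[OF assms(1)]] act_rep_inv)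

lemma dlog_fixed_points_identity_G:
  assumes g: "g \<in> G" and h: "h \<in> G" and "g \<noteq> h" and u: "Fin u \<notin> special_points G"
    and "Fin u \<noteq> act g (Fin v)" "Fin u \<noteq> act h (Fin v)"
  shows "(dlog v (act (inv\<^bsub>PSU2\<^esub> g) (Fin u)) - dlog v (act (inv\<^bsub>PSU2\<^esub> h) (Fin u))) *
      (\<Sum>q\<in>{q\<in>special_points G. act h q = act g q}. dlog u (act g q)) +
      dlog u (act g (Fin v)) * dlog v (act (inv\<^bsub>PSU2\<^esub> h) (Fin u)) -
      dlog u (act h (Fin v)) * dlog v (act (inv\<^bsub>PSU2\<^esub> g) (Fin u)) -
      rep g $2$1 / mdenom (rep g) u v + rep h $2$1 / mdenom (rep h) u v = 0"
proof -
  have gc: "g \<in> carrier PSU2" and hc: "h \<in> carrier PSU2" using g h G_carrier by auto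
  define k where "k = h \<otimes>\<^bsub>PSU2\<^esub> inv\<^bsub>PSU2\<^esub> g"
  have k: "k \<in> G" using g h by (simp add: k_def)
  have kg: "k \<otimes>\<^bsub>PSU2\<^esub> g = h" using g h by (simp add: k_def)
  then have k1: "k \<noteq> \<one>\<^bsub>PSU2\<^esub>" using \<open>g \<noteq> h\<close> gc
    by (metis group.is_monoid group_PSU2 monoid.l_one)
  have ka: "act k p = homography (rep h ** adj2 (rep g)) p" for p
  proof -
    have "k = cls (rep h) \<otimes>\<^bsub>PSU2\<^esub> cls (adj2 (rep g))"
      unfolding k_def using PSU2_inv[OF rep(1)[OF gc]] rep(2)[OF gc] rep(2)[OF hc] by simp
    then show ?thesis by (simp add: PSU2_mult act_cls)
  qed
  have ksp: "act k p = p \<Longrightarrow> p \<in> special_points G" for p using k k1 by (auto simp: special_iff)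
  have ne: "rep g \<noteq> rep h" "rep g \<noteq> - rep h"
    using \<open>g \<noteq> h\<close> rep(2)[OF gc] rep(2)[OF hc] cls_uminus by metis+
  \<comment> \<open>Substitute p = g q: then h q = g q says that p is fixed by k = h g^-1.
    Conversely such p are special because k is not the identity.\<close>
  have S: "(\<Sum>q\<in>{q\<in>special_points G. act h q = act g q}. dlog u (act g q)) =
     (\<Sum>p\<in>{p. homography (rep h ** adj2 (rep g)) p = p}. dlog u p)"
    unfolding ka[symmetric]
  proof (rule sum.reindex_bij_witness[where i="act (inv\<^bsub>PSU2\<^esub> g)" and j="act g"])
    fix q assume "q \<in> {q \<in> special_points G. act h q = act g q}"
    then show "act g q \<in> {p. act k p = p}"
      using act_G_mult[OF k g, of q] by (simp add: kg)
  next
    fix p assume "p \<in> {p. act k p = p}"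
    then have p: "act k p = p" by simp
    have "act h (act (inv\<^bsub>PSU2\<^esub> g) p) = act k p" using g h by (simp add: k_def act_G_mult)
    then show "act (inv\<^bsub>PSU2\<^esub> g) p \<in> {q \<in> special_points G. act h q = act g q}"
      using p ksp[OF p] g by (simp add: act_special)
  qed (use g in auto)
  show ?thesis
    unfolding S unfolding act_rep_inv[OF g] act_rep_inv[OF h] act_rep[OF gc] act_rep[OF hc]
    using assms(5,6)[unfolded act_rep[OF gc] act_rep[OF hc]] ksp[of "Fin u", unfolded ka] u
    by (intro dlog_fixed_points_identity rep(1) gc hc ne) blast+
qed

end

section \<open>Flatness in terms of a pairing of the generators\<close>

text \<open>In the intended model \<open>b x y\<close> is a linear functional applied to the
  commutator of the generators x and y. The linear relations (1) and (2) enter after bracketing with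
  an arbitrary generator, the quadratic ones (3)-(7) directly.\<close>

locale pn_pairing = finite_psu2 G for G :: "psu2 set" +
  fixes b :: "'n::finite pgen \<Rightarrow> 'n pgen \<Rightarrow> complex"
  assumes alternating: "b x y = - b y x"
    and rel_inv: "\<lbrakk>i \<noteq> j; g \<in> G; y \<in> pn_generators G\<rbrakk> \<Longrightarrow> b (Xij i j g) y = b (Xij j i (inv\<^bsub>PSU2\<^esub> g)) y"
    and rel_sum: "y \<in> pn_generators G \<Longrightarrow>
      (\<Sum>q\<in>special_points G. b (Xi i q) y) + (\<Sum>m\<in>UNIV - {i}. \<Sum>g\<in>G. b (Xij i m g) y) = 0"
    and rel_disjoint: "\<lbrakk>distinct [i, j, k, l]; g \<in> G; h \<in> G\<rbrakk> \<Longrightarrow> b (Xij i j g) (Xij k l h) = 0"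
    and rel_triple: "\<lbrakk>distinct [i, j, k]; g \<in> G; h \<in> G\<rbrakk> \<Longrightarrow>
      b (Xij i j g) (Xij k j (h \<otimes>\<^bsub>PSU2\<^esub> g)) + b (Xij i j g) (Xij k i h) = 0"
    and rel_Xi_Xij: "\<lbrakk>distinct [i, j, k]; p \<in> special_points G; g \<in> G\<rbrakk> \<Longrightarrow> b (Xi i p) (Xij j k g) = 0"
    and rel_Xi_Xi: "\<lbrakk>i \<noteq> j; p \<in> special_points G; q \<in> special_points G; q \<notin> orb G p\<rbrakk> \<Longrightarrow> b (Xi i p) (Xi j q) = 0"
    and rel_Xij_stab: "\<lbrakk>i \<noteq> j; g \<in> G; p \<in> special_points G\<rbrakk> \<Longrightarrow>
      b (Xij i j g) (Xi j p) + b (Xij i j g) (Xi i (act g p)) +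
      (\<Sum>h\<in>stab G p. b (Xij i j g) (Xij i j (g \<otimes>\<^bsub>PSU2\<^esub> h))) = 0"
    and rel_Xi_stab: "\<lbrakk>i \<noteq> j; g \<in> G; p \<in> special_points G\<rbrakk> \<Longrightarrow>
      b (Xi j p) (Xi i (act g p)) + (\<Sum>h\<in>stab G p. b (Xi j p) (Xij i j (g \<otimes>\<^bsub>PSU2\<^esub> h))) = 0"
begin

lemma rel_inv2: "\<lbrakk>i \<noteq> j; g \<in> G; y \<in> pn_generators G\<rbrakk> \<Longrightarrow> b y (Xij i j g) = b y (Xij j i (inv\<^bsub>PSU2\<^esub> g))"
  using rel_inv[of i j g y] alternating[of y] by simp

text \<open>Relation (4), read for different orderings of the three indices, makes all brackets
  between X_ij(g), X_jk(h) and X_ik(g h) agree up to sign, so that one of them can serve as common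
  unknown.\<close>

lemma triple_cyclic:
  assumes d: "distinct [i, j, k]" and g: "g \<in> G" "h \<in> G"
  shows "b (Xij i k (g \<otimes>\<^bsub>PSU2\<^esub> h)) (Xij j k h) = - b (Xij i j g) (Xij j k h)"
    and "b (Xij i k (g \<otimes>\<^bsub>PSU2\<^esub> h)) (Xij i j g) = b (Xij i j g) (Xij j k h)"
proof -
  have gc: "inv\<^bsub>PSU2\<^esub> (g \<otimes>\<^bsub>PSU2\<^esub> h) = inv\<^bsub>PSU2\<^esub> h \<otimes>\<^bsub>PSU2\<^esub> inv\<^bsub>PSU2\<^esub> g"
    using g by (simp add: group.inv_mult_group[OF group_PSU2] G_carrier)
  have "b (Xij j k h) (Xij i k (g \<otimes>\<^bsub>PSU2\<^esub> h)) + b (Xij j k h) (Xij i j g) = 0"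
    using d g by (intro rel_triple) auto
  then have 1: "b (Xij j k h) (Xij i k (g \<otimes>\<^bsub>PSU2\<^esub> h)) = b (Xij i j g) (Xij j k h)"
    using alternating[of "Xij i j g" "Xij j k h"] by (metis eq_neg_iff_add_eq_0)
  then show "b (Xij i k (g \<otimes>\<^bsub>PSU2\<^esub> h)) (Xij j k h) = - b (Xij i j g) (Xij j k h)"
    using alternating[of "Xij i k (g \<otimes>\<^bsub>PSU2\<^esub> h)" "Xij j k h"] by simp
  \<comment> \<open>The group elements are chosen such that relation (1) turns X_kj and X_ki into
    X_jk(h) and X_ik(g h).\<close>
  have "b (Xij i j g) (Xij k j (inv\<^bsub>PSU2\<^esub> h \<otimes>\<^bsub>PSU2\<^esub> inv\<^bsub>PSU2\<^esub> g \<otimes>\<^bsub>PSU2\<^esub> g)) +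
      b (Xij i j g) (Xij k i (inv\<^bsub>PSU2\<^esub> h \<otimes>\<^bsub>PSU2\<^esub> inv\<^bsub>PSU2\<^esub> g)) = 0"
    using d g by (intro rel_triple) auto
  then have "b (Xij i j g) (Xij j k h) + b (Xij i j g) (Xij i k (g \<otimes>\<^bsub>PSU2\<^esub> h)) = 0"
    using d g rel_inv2[of j k h "Xij i j g"] rel_inv2[of i k "g \<otimes>\<^bsub>PSU2\<^esub> h" "Xij i j g"]
    by (simp add: gc)
  then show "b (Xij i k (g \<otimes>\<^bsub>PSU2\<^esub> h)) (Xij i j g) = b (Xij i j g) (Xij j k h)"
    using alternating[of "Xij i k (g \<otimes>\<^bsub>PSU2\<^esub> h)" "Xij i j g"] by (metis eq_neg_iff_add_eq_0)
qed

text \<open>In the model this is the bracket of the coefficient of dz_i with the generator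
  y.\<close>

definition lin :: "complex^'n \<Rightarrow> 'n \<Rightarrow> 'n pgen \<Rightarrow> complex" where
  "lin z i y = (\<Sum>p\<in>special_points G. dlog (z $ i) p * b (Xi i p) y) +
     (\<Sum>m\<in>UNIV - {i}. \<Sum>g\<in>G. dlog (z $ i) (act g (Fin (z $ m))) * b (Xij i m g) y)"

text \<open>The left side is the bracket of the coefficients of dz_i and dz_j, expanded in both
  arguments. The relations reduce every term to [X_ij(\<alpha>), X_j(q)],
  [X_ij(\<alpha>), X_ij(\<beta>)] and, for third indices k, [X_ij(\<alpha>), X_jk(\<beta>)].\<close>

theorem pairing_vanishes:
  assumes z: "(\<lambda>k. Fin (z $ k)) \<in> Cf G" and ij: "i \<noteq> j"
  shows "(\<Sum>q\<in>special_points G. dlog (z $ j) q * lin z i (Xi j q)) +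
     (\<Sum>m\<in>UNIV - {j}. \<Sum>g\<in>G. dlog (z $ j) (act g (Fin (z $ m))) * lin z i (Xij j m g)) = 0"
proof -
  define u where "u = z $ i"
  define v where "v = z $ j"
  define S where "S = special_points G"
  define I where "I = UNIV - {i, j}"
  \<comment> \<open>P \<alpha> and Q \<alpha> are the factors of X_ij(\<alpha>) in the coefficients
    of dz_i and dz_j; in the latter it occurs as X_ji(\<alpha>^-1), by relation (1).\<close>
  define P where "P = (\<lambda>g. dlog u (act g (Fin v)))"
  define Q where "Q = (\<lambda>g. dlog v (act (inv\<^bsub>PSU2\<^esub> g) (Fin u)))"
  define \<kappa> where "\<kappa> = (\<lambda>g. rep g $2$1 / mdenom (rep g) u v)"
  define X where "X = (\<lambda>g. Xij i j g :: 'n pgen)"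
  define Y where "Y = (\<lambda>q. Xi j q :: 'n pgen)"
  \<comment> \<open>A, C and E split \<open>lin z i\<close> into the contributions of the special
    points, of z_j and of the third points.\<close>
  define A where "A = (\<lambda>y. \<Sum>p\<in>S. dlog u p * b (Xi i p) y)"
  define C where "C = (\<lambda>y. \<Sum>g\<in>G. P g * b (X g) y)"
  define E where "E = (\<lambda>y. \<Sum>m\<in>I. \<Sum>g\<in>G. dlog u (act g (Fin (z $ m))) * b (Xij i m g) y)"
  have finS: "finite S" using finite_special by (simp add: S_def)
  have spl: "UNIV - {i} = insert j I" "UNIV - {j} = insert i I" "i \<notin> I" "j \<notin> I"
    using ij by (auto simp: I_def)
  have lin: "lin z i y = A y + C y + E y" for y
    unfolding lin_def spl(1) by (simp add: spl(3,4) A_def C_def E_def u_def v_def P_def X_def S_def)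
  have Id: "distinct [i, j, k]" if "k \<in> I" for k using that ij by (auto simp: I_def)
  have Xgen: "X g \<in> pn_generators G" if "g \<in> G" for g using that ij by (simp add: X_def)
  have z1: "Fin (z $ k) \<notin> S" for k using z by (simp add: Cf_iff S_def)
  have z2: "Fin (z $ k) \<noteq> act g (Fin (z $ l))" if "k \<noteq> l" "g \<in> G" for k l g
    using z that unfolding Cf_iff by (elim conjE allE[of _ k] allE[of _ l]) simp
  have uz: "Fin u \<notin> S" "Fin v \<notin> S" unfolding u_def v_def by (rule z1)+
  have uv: "Fin u \<noteq> act g (Fin v)" if "g \<in> G" for g
    unfolding u_def v_def by (rule z2[OF ij that])
  have uzk: "Fin u \<noteq> act g (Fin (z $ k))" "Fin v \<noteq> act g (Fin (z $ k))" if "k \<in> I" "g \<in> G" for g k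
    using that z2[of i k g] z2[of j k g] unfolding u_def v_def I_def by blast+
  have arnold: "- dlog u (act g p) * dlog v p + dlog u (act g p) * Q g + P g * dlog v p = \<kappa> g"
    if "g \<in> G" "Fin u \<noteq> act g p" "Fin v \<noteq> p" for g p
    using dlog_arnold_G[OF that uv[OF that(1)]] by (simp add: P_def Q_def \<kappa>_def)

  have EY: "E (Y q) = 0" if "q \<in> S" for q
    unfolding E_def
  proof (intro sum.neutral ballI)
    fix m g assume "m \<in> I" "g \<in> G"
    then have "b (Xi j q) (Xij i m g) = 0"
      using that Id[of m] by (intro rel_Xi_Xij) (auto simp: S_def)
    then show "dlog u (act g (Fin (z $ m))) * b (Xij i m g) (Y q) = 0"
      using alternating[of "Xij i m g" "Y q"] by (simp add: Y_def)
  qed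
  have AX: "A (Xij j k g) = 0" if "k \<in> I" "g \<in> G" for k g
    unfolding A_def using that Id[of k] by (intro sum.neutral ballI) (simp add: S_def rel_Xi_Xij)
  have EX: "E (Xij j k g) = - (\<Sum>\<alpha>\<in>G. dlog u (act \<alpha> (act g (Fin (z $ k)))) * b (X \<alpha>) (Xij j k g))"
    if k: "k \<in> I" and g: "g \<in> G" for k g
  proof -
    \<comment> \<open>By relation (3) only m = k survives; the substitution h = \<alpha> g then
      brings the bracket into the form of \<open>triple_cyclic\<close>.\<close>
    have "(\<Sum>h\<in>G. dlog u (act h (Fin (z $ m))) * b (Xij i m h) (Xij j k g)) = 0" if "m \<in> I - {k}" for m
    proof -
      have "distinct [i, m, j, k]" using that Id[of k] Id[of m] k by auto
      then show ?thesis using g by (intro sum.neutral ballI) (simp add: rel_disjoint del: distinct.simps)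
    qed
    then have "E (Xij j k g) = (\<Sum>h\<in>G. dlog u (act h (Fin (z $ k))) * b (Xij i k h) (Xij j k g))"
      unfolding E_def using k by (subst sum.remove[of I k]) auto
    also have "\<dots> = (\<Sum>\<alpha>\<in>G. dlog u (act (\<alpha> \<otimes>\<^bsub>PSU2\<^esub> g) (Fin (z $ k))) * b (Xij i k (\<alpha> \<otimes>\<^bsub>PSU2\<^esub> g)) (Xij j k g))"
      by (rule sum_mult_right[OF g, symmetric])
    also have "\<dots> = (\<Sum>\<alpha>\<in>G. - (dlog u (act \<alpha> (act g (Fin (z $ k)))) * b (X \<alpha>) (Xij j k g)))"
      using g by (intro sum.cong) (simp_all add: triple_cyclic(1)[OF Id[OF k]] act_G_mult X_def)
    finally show ?thesis by (simp add: sum_negf)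
  qed
  have EXij: "E (X \<alpha>) = (\<Sum>k\<in>I. \<Sum>\<beta>\<in>G. dlog u (act \<alpha> (act \<beta> (Fin (z $ k)))) * b (X \<alpha>) (Xij j k \<beta>))"
    if \<alpha>: "\<alpha> \<in> G" for \<alpha>
    unfolding E_def
  proof (rule sum.cong[OF refl])
    fix k assume k: "k \<in> I"
    have "(\<Sum>g\<in>G. dlog u (act g (Fin (z $ k))) * b (Xij i k g) (X \<alpha>)) =
        (\<Sum>\<beta>\<in>G. dlog u (act (\<alpha> \<otimes>\<^bsub>PSU2\<^esub> \<beta>) (Fin (z $ k))) * b (Xij i k (\<alpha> \<otimes>\<^bsub>PSU2\<^esub> \<beta>)) (X \<alpha>))"
      by (rule sum_mult_left[OF \<alpha>, symmetric])
    also have "\<dots> = (\<Sum>\<beta>\<in>G. dlog u (act \<alpha> (act \<beta> (Fin (z $ k)))) * b (X \<alpha>) (Xij j k \<beta>))"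
      using \<alpha> by (intro sum.cong) (simp_all add: triple_cyclic(2)[OF Id[OF k]] act_G_mult X_def)
    finally show "(\<Sum>g\<in>G. dlog u (act g (Fin (z $ k))) * b (Xij i k g) (X \<alpha>)) = \<dots>" .
  qed
  have linX: "lin z i (Xij j i (inv\<^bsub>PSU2\<^esub> g)) = lin z i (X g)" if "g \<in> G" for g
  proof -
    have "b x (Xij j i (inv\<^bsub>PSU2\<^esub> g)) = b x (X g)" if "x \<in> pn_generators G" for x
      using rel_inv2[of i j g x] that ij \<open>g \<in> G\<close> by (simp add: X_def)
    then show ?thesis unfolding lin_def by (intro arg_cong2[of _ _ _ _ "(+)"] sum.cong) auto
  qed

  \<comment> \<open>As \<open>E (Y q)\<close> and \<open>A (Xij j k \<beta>)\<close> vanish, the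
    terms separate into those with indices i and j alone and those with a third index.\<close>
  have split: "(\<Sum>q\<in>special_points G. dlog (z $ j) q * lin z i (Xi j q)) +
     (\<Sum>m\<in>UNIV - {j}. \<Sum>g\<in>G. dlog (z $ j) (act g (Fin (z $ m))) * lin z i (Xij j m g)) =
     (\<Sum>q\<in>S. dlog v q * (A (Y q) + C (Y q))) + (\<Sum>\<alpha>\<in>G. Q \<alpha> * (A (X \<alpha>) + C (X \<alpha>))) +
     ((\<Sum>\<alpha>\<in>G. Q \<alpha> * E (X \<alpha>)) +
      (\<Sum>k\<in>I. \<Sum>\<beta>\<in>G. dlog v (act \<beta> (Fin (z $ k))) * (C (Xij j k \<beta>) + E (Xij j k \<beta>))))"
  proof -
    have 1: "(\<Sum>q\<in>special_points G. dlog (z $ j) q * lin z i (Xi j q)) = (\<Sum>q\<in>S. dlog v q * (A (Y q) + C (Y q)))"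
      unfolding S_def[symmetric] v_def[symmetric] lin Y_def[symmetric] by (intro sum.cong) (auto simp: EY)
    have "(\<Sum>g\<in>G. dlog v (act g (Fin u)) * lin z i (Xij j i g)) =
       (\<Sum>g\<in>G. dlog v (act (inv\<^bsub>PSU2\<^esub> g) (Fin u)) * lin z i (Xij j i (inv\<^bsub>PSU2\<^esub> g)))"
      by (rule sum_inv[symmetric])
    also have "\<dots> = (\<Sum>\<alpha>\<in>G. Q \<alpha> * (A (X \<alpha>) + C (X \<alpha>))) + (\<Sum>\<alpha>\<in>G. Q \<alpha> * E (X \<alpha>))"
      unfolding sum.distrib[symmetric] by (intro sum.cong[OF refl], subst linX) (simp_all add: lin Q_def algebra_simps)
    finally have 2: "(\<Sum>g\<in>G. dlog v (act g (Fin u)) * lin z i (Xij j i g)) = \<dots>" .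
    have 3: "(\<Sum>k\<in>I. \<Sum>\<beta>\<in>G. dlog v (act \<beta> (Fin (z $ k))) * lin z i (Xij j k \<beta>)) =
      (\<Sum>k\<in>I. \<Sum>\<beta>\<in>G. dlog v (act \<beta> (Fin (z $ k))) * (C (Xij j k \<beta>) + E (Xij j k \<beta>)))"
      by (intro sum.cong) (auto simp: lin AX)
    show ?thesis
      unfolding 1 spl(2) using spl 2 3 by (simp add: u_def v_def algebra_simps)
  qed

  text \<open>The terms involving a third point: the Arnold identity turns the coefficient of
    \<open>[X\<^sub>i\<^sub>j(\<alpha>), X\<^sub>j\<^sub>k(\<beta>)]\<close> into \<open>\<kappa> \<alpha>\<close>, so that relation (2) removes the third points.\<close>

  have third: "(\<Sum>\<alpha>\<in>G. Q \<alpha> * E (X \<alpha>)) +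
      (\<Sum>k\<in>I. \<Sum>\<beta>\<in>G. dlog v (act \<beta> (Fin (z $ k))) * (C (Xij j k \<beta>) + E (Xij j k \<beta>))) =
      - (\<Sum>\<alpha>\<in>G. \<kappa> \<alpha> * ((\<Sum>q\<in>S. b (X \<alpha>) (Y q)) + (\<Sum>\<beta>\<in>G. b (X \<alpha>) (X \<beta>))))"
  proof -
    have 1: "(\<Sum>\<alpha>\<in>G. Q \<alpha> * E (X \<alpha>)) =
       (\<Sum>\<alpha>\<in>G. \<Sum>k\<in>I. \<Sum>\<beta>\<in>G. Q \<alpha> * (dlog u (act \<alpha> (act \<beta> (Fin (z $ k)))) * b (X \<alpha>) (Xij j k \<beta>)))"
      by (intro sum.cong) (simp_all add: EXij sum_distrib_left)
    have "(\<Sum>k\<in>I. \<Sum>\<beta>\<in>G. dlog v (act \<beta> (Fin (z $ k))) * (C (Xij j k \<beta>) + E (Xij j k \<beta>))) =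
       (\<Sum>k\<in>I. \<Sum>\<beta>\<in>G. \<Sum>\<alpha>\<in>G. dlog v (act \<beta> (Fin (z $ k))) *
          (P \<alpha> * b (X \<alpha>) (Xij j k \<beta>) - dlog u (act \<alpha> (act \<beta> (Fin (z $ k)))) * b (X \<alpha>) (Xij j k \<beta>)))"
      by (intro sum.cong) (simp_all add: C_def EX sum_distrib_left sum_subtractf right_diff_distrib)
    also have "\<dots> = (\<Sum>k\<in>I. \<Sum>\<alpha>\<in>G. \<Sum>\<beta>\<in>G. dlog v (act \<beta> (Fin (z $ k))) *
          (P \<alpha> * b (X \<alpha>) (Xij j k \<beta>) - dlog u (act \<alpha> (act \<beta> (Fin (z $ k)))) * b (X \<alpha>) (Xij j k \<beta>)))"
      by (intro sum.cong[OF refl] sum.swap)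
    also have "\<dots> = (\<Sum>\<alpha>\<in>G. \<Sum>k\<in>I. \<Sum>\<beta>\<in>G. dlog v (act \<beta> (Fin (z $ k))) *
          (P \<alpha> * b (X \<alpha>) (Xij j k \<beta>) - dlog u (act \<alpha> (act \<beta> (Fin (z $ k)))) * b (X \<alpha>) (Xij j k \<beta>)))"
      by (rule sum.swap)
    finally have 2: "(\<Sum>k\<in>I. \<Sum>\<beta>\<in>G. dlog v (act \<beta> (Fin (z $ k))) * (C (Xij j k \<beta>) + E (Xij j k \<beta>))) = \<dots>" .
    have "(\<Sum>\<alpha>\<in>G. Q \<alpha> * E (X \<alpha>)) +
      (\<Sum>k\<in>I. \<Sum>\<beta>\<in>G. dlog v (act \<beta> (Fin (z $ k))) * (C (Xij j k \<beta>) + E (Xij j k \<beta>))) =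
      (\<Sum>\<alpha>\<in>G. \<Sum>k\<in>I. \<Sum>\<beta>\<in>G. \<kappa> \<alpha> * b (X \<alpha>) (Xij j k \<beta>))"
      unfolding 1 2 sum.distrib[symmetric]
    proof (intro sum.cong[OF refl])
      fix \<alpha> k \<beta> assume \<alpha>: "\<alpha> \<in> G" and k: "k \<in> I" and \<beta>: "\<beta> \<in> G"
      \<comment> \<open>The third point enters the coefficient through its translate by \<beta>
        only, so the Arnold relation is applied at this translate.\<close>
      define p where "p = act \<beta> (Fin (z $ k))"
      have "Fin u \<noteq> act \<alpha> p" using uzk(1)[OF k, of "\<alpha> \<otimes>\<^bsub>PSU2\<^esub> \<beta>"] \<alpha> \<beta> by (simp add: p_def act_G_mult)
      moreover have "Fin v \<noteq> p" using uzk(2)[OF k \<beta>] by (simp add: p_def)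
      ultimately have \<kappa>\<alpha>: "\<kappa> \<alpha> = - dlog u (act \<alpha> p) * dlog v p + dlog u (act \<alpha> p) * Q \<alpha> + P \<alpha> * dlog v p"
        using arnold[OF \<alpha>] by simp
      show "Q \<alpha> * (dlog u (act \<alpha> (act \<beta> (Fin (z $ k)))) * b (X \<alpha>) (Xij j k \<beta>)) + dlog v (act \<beta> (Fin (z $ k))) *
          (P \<alpha> * b (X \<alpha>) (Xij j k \<beta>) - dlog u (act \<alpha> (act \<beta> (Fin (z $ k)))) * b (X \<alpha>) (Xij j k \<beta>)) =
          \<kappa> \<alpha> * b (X \<alpha>) (Xij j k \<beta>)"
        unfolding p_def[symmetric] \<kappa>\<alpha> by (simp add: algebra_simps)
    qed
    also have "\<dots> = (\<Sum>\<alpha>\<in>G. - (\<kappa> \<alpha> * ((\<Sum>q\<in>S. b (X \<alpha>) (Y q)) + (\<Sum>\<beta>\<in>G. b (X \<alpha>) (X \<beta>)))))"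
    proof (rule sum.cong[OF refl])
      fix \<alpha> assume \<alpha>: "\<alpha> \<in> G"
      \<comment> \<open>Relation (2) for the index j is paired with X_ij(\<alpha>). As the
        coefficient \<kappa> \<alpha> is constant in k and \<beta>, the whole sum over third points
        can be replaced by minus the sums over the special points and over the X_ji.\<close>
      have "(\<Sum>\<beta>\<in>G. b (Xij j i \<beta>) (X \<alpha>)) = (\<Sum>\<beta>\<in>G. b (Xij j i (inv\<^bsub>PSU2\<^esub> \<beta>)) (X \<alpha>))"
        by (rule sum_inv[symmetric])
      also have "\<dots> = (\<Sum>\<beta>\<in>G. b (X \<beta>) (X \<alpha>))"
        by (intro sum.cong) (auto simp: X_def rel_inv[OF ij _ Xgen[OF \<alpha>, unfolded X_def]])
      finally have "(\<Sum>q\<in>S. b (Y q) (X \<alpha>)) + ((\<Sum>\<beta>\<in>G. b (X \<beta>) (X \<alpha>)) + (\<Sum>k\<in>I. \<Sum>\<beta>\<in>G. b (Xij j k \<beta>) (X \<alpha>))) = 0"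
        using rel_sum[OF Xgen[OF \<alpha>], of j] unfolding spl(2) by (simp add: spl S_def Y_def)
      moreover have "(\<Sum>k\<in>I. \<Sum>\<beta>\<in>G. b (X \<alpha>) (Xij j k \<beta>)) = - (\<Sum>k\<in>I. \<Sum>\<beta>\<in>G. b (Xij j k \<beta>) (X \<alpha>))"
        unfolding sum_negf[symmetric] by (intro sum.cong[OF refl]) (rule alternating)
      moreover have "(\<Sum>q\<in>S. b (X \<alpha>) (Y q)) = - (\<Sum>q\<in>S. b (Y q) (X \<alpha>))"
        unfolding sum_negf[symmetric] by (intro sum.cong[OF refl]) (rule alternating)
      moreover have "(\<Sum>\<beta>\<in>G. b (X \<alpha>) (X \<beta>)) = - (\<Sum>\<beta>\<in>G. b (X \<beta>) (X \<alpha>))"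
        unfolding sum_negf[symmetric] by (intro sum.cong[OF refl]) (rule alternating)
      ultimately have "(\<Sum>q\<in>S. b (X \<alpha>) (Y q)) + ((\<Sum>\<beta>\<in>G. b (X \<alpha>) (X \<beta>)) + (\<Sum>k\<in>I. \<Sum>\<beta>\<in>G. b (X \<alpha>) (Xij j k \<beta>))) = 0"
        by (simp only: minus_add_distrib[symmetric]) simp
      then have "(\<Sum>k\<in>I. \<Sum>\<beta>\<in>G. b (X \<alpha>) (Xij j k \<beta>)) = - ((\<Sum>q\<in>S. b (X \<alpha>) (Y q)) + (\<Sum>\<beta>\<in>G. b (X \<alpha>) (X \<beta>)))"
        by (simp add: eq_neg_iff_add_eq_0 algebra_simps)
      then show "(\<Sum>k\<in>I. \<Sum>\<beta>\<in>G. \<kappa> \<alpha> * b (X \<alpha>) (Xij j k \<beta>)) =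
          - (\<kappa> \<alpha> * ((\<Sum>q\<in>S. b (X \<alpha>) (Y q)) + (\<Sum>\<beta>\<in>G. b (X \<alpha>) (X \<beta>))))"
        by (simp add: sum_distrib_left[symmetric] right_diff_distrib distrib_left)
    qed
    finally show ?thesis by (simp add: sum_negf)
  qed

  have AY: "A (Y q) = - (\<Sum>\<alpha>\<in>G. dlog u (act \<alpha> q) * b (X \<alpha>) (Y q))" if q: "q \<in> S" for q
  proof -
    \<comment> \<open>Relation (7) if p lies in the orbit of q. Otherwise relation (5) gives 0,
      which agrees with the empty sum.\<close>
    have "b (Xi i p) (Y q) = (\<Sum>\<alpha>\<in>{\<alpha>\<in>G. act \<alpha> q = p}. b (Y q) (X \<alpha>))" if p: "p \<in> S" for p
    proof (cases "p \<in> orb G q")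
      case True
      then obtain g where g: "g \<in> G" "p = act g q" by (auto simp: orb_eq)
      have "b (Y q) (Xi i p) + (\<Sum>\<alpha>\<in>{\<alpha>\<in>G. act \<alpha> q = p}. b (Y q) (X \<alpha>)) = 0"
        using rel_Xi_stab[OF ij g(1) q[unfolded S_def]]
        unfolding sum_stab[OF g(1), of "\<lambda>g. b (Xi j q) (Xij i j g)"] g(2)[symmetric] X_def Y_def .
      then show ?thesis unfolding alternating[of "Xi i p" "Y q"] add_eq_0_iff by (rule sym)
    next
      case False
      then have "b (Y q) (Xi i p) = 0" using ij p q unfolding Y_def by (intro rel_Xi_Xi) (auto simp: S_def)
      moreover have e: "{\<alpha>\<in>G. act \<alpha> q = p} = {}" using False by (auto simp: orb_eq)
      ultimately show ?thesis unfolding e using alternating[of "Xi i p" "Y q"] by simp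
    qed
    note Y = this
    have "A (Y q) = (\<Sum>p\<in>S. \<Sum>\<alpha>\<in>{\<alpha>\<in>G. act \<alpha> q = p}. dlog u (act \<alpha> q) * b (Y q) (X \<alpha>))"
      unfolding A_def by (intro sum.cong[OF refl]) (simp add: Y sum_distrib_left)
    \<comment> \<open>Each \<alpha> lies in exactly one of the inner index sets, namely that of p =
      \<alpha> q.\<close>
    also have "\<dots> = (\<Sum>\<alpha>\<in>G. dlog u (act \<alpha> q) * b (Y q) (X \<alpha>))"
      using q by (intro sum.group finite_G finS) (auto simp: S_def act_special)
    also have "\<dots> = (\<Sum>\<alpha>\<in>G. - (dlog u (act \<alpha> q) * b (X \<alpha>) (Y q)))"
      by (intro sum.cong[OF refl]) (subst alternating[of "Y q"], simp)
    finally show ?thesis by (simp add: sum_negf)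
  qed
  have AXij: "A (X \<alpha>) = (\<Sum>q\<in>S. dlog u (act \<alpha> q) * b (X \<alpha>) (Y q)) +
      (\<Sum>\<beta>\<in>G. (\<Sum>q\<in>{q\<in>S. act \<beta> q = act \<alpha> q}. dlog u (act \<alpha> q)) * b (X \<alpha>) (X \<beta>))"
    if \<alpha>: "\<alpha> \<in> G" for \<alpha>
  proof -
    \<comment> \<open>Write the special points as \<alpha> q, to which relation (6) applies.\<close>
    have "A (X \<alpha>) = (\<Sum>q\<in>S. dlog u (act \<alpha> q) * b (Xi i (act \<alpha> q)) (X \<alpha>))"
      unfolding A_def S_def by (rule sum_special[OF \<alpha>, symmetric])
    also have "\<dots> = (\<Sum>q\<in>S. dlog u (act \<alpha> q) * b (X \<alpha>) (Y q) +
        (\<Sum>\<beta>\<in>{\<beta>\<in>G. act \<beta> q = act \<alpha> q}. dlog u (act \<alpha> q) * b (X \<alpha>) (X \<beta>)))"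
    proof (rule sum.cong[OF refl])
      fix q assume q: "q \<in> S"
      have "b (X \<alpha>) (Y q) + b (X \<alpha>) (Xi i (act \<alpha> q)) + (\<Sum>\<beta>\<in>{\<beta>\<in>G. act \<beta> q = act \<alpha> q}. b (X \<alpha>) (X \<beta>)) = 0"
        using rel_Xij_stab[OF ij \<alpha> q[unfolded S_def]]
        unfolding sum_stab[OF \<alpha>, of "\<lambda>g. b (Xij i j \<alpha>) (Xij i j g)"] X_def Y_def .
      then have "b (Xi i (act \<alpha> q)) (X \<alpha>) = b (X \<alpha>) (Y q) + (\<Sum>\<beta>\<in>{\<beta>\<in>G. act \<beta> q = act \<alpha> q}. b (X \<alpha>) (X \<beta>))"
        unfolding alternating[of "X \<alpha>" "Xi i (act \<alpha> q)"] by (simp add: algebra_simps)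
      then show "dlog u (act \<alpha> q) * b (Xi i (act \<alpha> q)) (X \<alpha>) = dlog u (act \<alpha> q) * b (X \<alpha>) (Y q) +
        (\<Sum>\<beta>\<in>{\<beta>\<in>G. act \<beta> q = act \<alpha> q}. dlog u (act \<alpha> q) * b (X \<alpha>) (X \<beta>))"
        by (simp add: distrib_left sum_distrib_left)
    qed
    \<comment> \<open>Interchanging q and \<beta> attaches to each pair \<alpha>, \<beta> the points
      q where they agree, as in \<open>dlog_fixed_points_identity_G\<close>.\<close>
    also have "\<dots> = (\<Sum>q\<in>S. dlog u (act \<alpha> q) * b (X \<alpha>) (Y q)) +
        (\<Sum>\<beta>\<in>G. \<Sum>q\<in>{q\<in>S. act \<beta> q = act \<alpha> q}. dlog u (act \<alpha> q) * b (X \<alpha>) (X \<beta>))"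
      unfolding sum.distrib using sum.swap_restrict[OF finS finite_G, of "\<lambda>q \<beta>. dlog u (act \<alpha> q) * b (X \<alpha>) (X \<beta>)" "\<lambda>q \<beta>. act \<beta> q = act \<alpha> q"]
      by simp
    finally show ?thesis by (simp add: sum_distrib_right)
  qed

  \<comment> \<open>The total coefficient of [X_ij(\<alpha>), X_ij(\<beta>)]: the first summand
    comes from \<open>AXij\<close>, the second from C and the last from the third points. As the
    bracket alternates, symmetry of c is enough for the double sum to vanish; c itself need not be
    zero.\<close>
  define c where "c = (\<lambda>\<alpha> \<beta>. Q \<alpha> * (\<Sum>q\<in>{q\<in>S. act \<beta> q = act \<alpha> q}. dlog u (act \<alpha> q)) + P \<alpha> * Q \<beta> - \<kappa> \<alpha>)"
  have c_sym: "c \<alpha> \<beta> = c \<beta> \<alpha>" if "\<alpha> \<in> G" "\<beta> \<in> G" for \<alpha> \<beta>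
  proof (cases "\<alpha> = \<beta>")
    case False
    have "(\<Sum>q\<in>{q\<in>S. act \<alpha> q = act \<beta> q}. dlog u (act \<beta> q)) = (\<Sum>q\<in>{q\<in>S. act \<beta> q = act \<alpha> q}. dlog u (act \<alpha> q))"
      by (intro sum.cong) auto
    then show ?thesis
      using dlog_fixed_points_identity_G[OF that False _ uv[OF that(1)] uv[OF that(2)]] uz
      unfolding c_def P_def[symmetric] Q_def[symmetric] \<kappa>_def[symmetric] S_def[symmetric]
      by (simp add: algebra_simps P_def Q_def \<kappa>_def S_def)
  qed simp
  have XX: "(\<Sum>\<alpha>\<in>G. \<Sum>\<beta>\<in>G. c \<alpha> \<beta> * b (X \<alpha>) (X \<beta>)) = 0" (is "?s = 0")
  proof -
    have "?s = (\<Sum>\<beta>\<in>G. \<Sum>\<alpha>\<in>G. c \<alpha> \<beta> * b (X \<alpha>) (X \<beta>))" by (rule sum.swap)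
    also have "\<dots> = (\<Sum>\<beta>\<in>G. \<Sum>\<alpha>\<in>G. - (c \<beta> \<alpha> * b (X \<beta>) (X \<alpha>)))"
    proof (intro sum.cong[OF refl])
      fix \<beta> \<alpha> assume "\<beta> \<in> G" "\<alpha> \<in> G"
      then show "c \<alpha> \<beta> * b (X \<alpha>) (X \<beta>) = - (c \<beta> \<alpha> * b (X \<beta>) (X \<alpha>))"
        using c_sym[of \<alpha> \<beta>] alternating[of "X \<alpha>" "X \<beta>"] by simp
    qed
    also have "\<dots> = - ?s" by (simp add: sum_negf)
    finally show ?thesis by simp
  qed

  have 1: "(\<Sum>q\<in>S. dlog v q * (A (Y q) + C (Y q))) =
      (\<Sum>\<alpha>\<in>G. \<Sum>q\<in>S. dlog v q * (P \<alpha> - dlog u (act \<alpha> q)) * b (X \<alpha>) (Y q))"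
  proof -
    have "(\<Sum>q\<in>S. dlog v q * (A (Y q) + C (Y q))) =
      (\<Sum>q\<in>S. \<Sum>\<alpha>\<in>G. dlog v q * (P \<alpha> - dlog u (act \<alpha> q)) * b (X \<alpha>) (Y q))"
      by (intro sum.cong) (simp_all add: AY C_def sum_distrib_left sum_subtractf[symmetric] algebra_simps)
    then show ?thesis by (simp add: sum.swap[of _ S])
  qed
  have 2: "(\<Sum>\<alpha>\<in>G. Q \<alpha> * (A (X \<alpha>) + C (X \<alpha>))) =
      (\<Sum>\<alpha>\<in>G. \<Sum>q\<in>S. Q \<alpha> * dlog u (act \<alpha> q) * b (X \<alpha>) (Y q)) +
      (\<Sum>\<alpha>\<in>G. \<Sum>\<beta>\<in>G. (c \<alpha> \<beta> + \<kappa> \<alpha>) * b (X \<alpha>) (X \<beta>))"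
  proof -
    have "(\<Sum>\<alpha>\<in>G. Q \<alpha> * C (X \<alpha>)) = (\<Sum>\<beta>\<in>G. \<Sum>\<alpha>\<in>G. P \<alpha> * Q \<beta> * b (X \<alpha>) (X \<beta>))"
      by (simp add: C_def sum_distrib_left mult_ac)
    also have "\<dots> = (\<Sum>\<alpha>\<in>G. \<Sum>\<beta>\<in>G. P \<alpha> * Q \<beta> * b (X \<alpha>) (X \<beta>))" by (rule sum.swap)
    finally have QC: "(\<Sum>\<alpha>\<in>G. Q \<alpha> * C (X \<alpha>)) = \<dots>" .
    have "(\<Sum>\<alpha>\<in>G. Q \<alpha> * A (X \<alpha>)) = (\<Sum>\<alpha>\<in>G. \<Sum>q\<in>S. Q \<alpha> * dlog u (act \<alpha> q) * b (X \<alpha>) (Y q)) +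
       (\<Sum>\<alpha>\<in>G. \<Sum>\<beta>\<in>G. Q \<alpha> * (\<Sum>q\<in>{q\<in>S. act \<beta> q = act \<alpha> q}. dlog u (act \<alpha> q)) * b (X \<alpha>) (X \<beta>))"
      unfolding sum.distrib[symmetric]
      by (intro sum.cong[OF refl])
         (simp only: AXij distrib_left sum_distrib_left[where A=G] sum_distrib_left[where A=S] mult.assoc)
    then show ?thesis
      unfolding c_def by (simp add: distrib_left distrib_right sum.distrib QC)
  qed
  have 3: "(\<Sum>\<alpha>\<in>G. \<kappa> \<alpha> * ((\<Sum>q\<in>S. b (X \<alpha>) (Y q)) + (\<Sum>\<beta>\<in>G. b (X \<alpha>) (X \<beta>)))) =
      (\<Sum>\<alpha>\<in>G. \<Sum>q\<in>S. \<kappa> \<alpha> * b (X \<alpha>) (Y q)) + (\<Sum>\<alpha>\<in>G. \<Sum>\<beta>\<in>G. \<kappa> \<alpha> * b (X \<alpha>) (X \<beta>))"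
    by (simp add: distrib_left sum.distrib sum_distrib_left)
  \<comment> \<open>The coefficient of [X_ij(\<alpha>), X_j(q)] is the left side of the Arnold
    relation at q, hence equals the \<kappa> \<alpha> that \<open>third\<close> subtracts.\<close>
  have 4: "(\<Sum>\<alpha>\<in>G. \<Sum>q\<in>S. dlog v q * (P \<alpha> - dlog u (act \<alpha> q)) * b (X \<alpha>) (Y q)) +
      (\<Sum>\<alpha>\<in>G. \<Sum>q\<in>S. Q \<alpha> * dlog u (act \<alpha> q) * b (X \<alpha>) (Y q)) =
      (\<Sum>\<alpha>\<in>G. \<Sum>q\<in>S. \<kappa> \<alpha> * b (X \<alpha>) (Y q))"
    unfolding sum.distrib[symmetric]
  proof (intro sum.cong[OF refl])
    fix \<alpha> q assume \<alpha>: "\<alpha> \<in> G" and q: "q \<in> S"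
    have "Fin u \<noteq> act \<alpha> q" "Fin v \<noteq> q" using uz q act_special[OF \<alpha>, of q] by (auto simp: S_def)
    then have \<kappa>\<alpha>: "\<kappa> \<alpha> = dlog v q * (P \<alpha> - dlog u (act \<alpha> q)) + Q \<alpha> * dlog u (act \<alpha> q)"
      using arnold[OF \<alpha>, of q] by (simp add: algebra_simps)
    show "dlog v q * (P \<alpha> - dlog u (act \<alpha> q)) * b (X \<alpha>) (Y q) + Q \<alpha> * dlog u (act \<alpha> q) * b (X \<alpha>) (Y q) =
        \<kappa> \<alpha> * b (X \<alpha>) (Y q)"
      unfolding \<kappa>\<alpha> by (simp add: algebra_simps)
  qed
  have 5: "(\<Sum>\<alpha>\<in>G. \<Sum>\<beta>\<in>G. (c \<alpha> \<beta> + \<kappa> \<alpha>) * b (X \<alpha>) (X \<beta>)) =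
      (\<Sum>\<alpha>\<in>G. \<Sum>\<beta>\<in>G. c \<alpha> \<beta> * b (X \<alpha>) (X \<beta>)) + (\<Sum>\<alpha>\<in>G. \<Sum>\<beta>\<in>G. \<kappa> \<alpha> * b (X \<alpha>) (X \<beta>))"
    by (simp add: distrib_right sum.distrib)
  show ?thesis
    unfolding split third 1 2 3 5 XX 4[symmetric] by simp
qed

end

section \<open>Quotient algebras\<close>

text \<open>One frame for two quotients: the presented Lie algebra and its enveloping algebra. The
  product is only biadditive, because the bracket algebra is not associative and thus no
  \<open>ring\<close>. Zero and addition agree with those of the type, so two cosets are compared
  through x - y.\<close>

locale typed_algebra =
  fixes A :: "'b::ab_group_add graded_algebra" and I :: "'b set"
  assumes add_eq: "x \<oplus>\<^bsub>A\<^esub> y = x + y" and zero_eq: "\<zero>\<^bsub>A\<^esub> = 0"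
    and zero_carrier: "0 \<in> carrier A"
    and add_carrier: "x \<in> carrier A \<Longrightarrow> y \<in> carrier A \<Longrightarrow> x + y \<in> carrier A"
    and mult_carrier: "x \<in> carrier A \<Longrightarrow> y \<in> carrier A \<Longrightarrow> x \<otimes>\<^bsub>A\<^esub> y \<in> carrier A"
    and smult_carrier: "x \<in> carrier A \<Longrightarrow> c \<odot>\<^bsub>A\<^esub> x \<in> carrier A"
    and smult_minus: "(- 1) \<odot>\<^bsub>A\<^esub> x = - x"
    and smult_add: "c \<odot>\<^bsub>A\<^esub> (x + y) = c \<odot>\<^bsub>A\<^esub> x + c \<odot>\<^bsub>A\<^esub> y"
    and mult_add_left: "\<lbrakk>x \<in> carrier A; y \<in> carrier A; z \<in> carrier A\<rbrakk> \<Longrightarrow> (x + y) \<otimes>\<^bsub>A\<^esub> z = x \<otimes>\<^bsub>A\<^esub> z + y \<otimes>\<^bsub>A\<^esub> z"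
    and mult_add_right: "\<lbrakk>x \<in> carrier A; y \<in> carrier A; z \<in> carrier A\<rbrakk> \<Longrightarrow> z \<otimes>\<^bsub>A\<^esub> (x + y) = z \<otimes>\<^bsub>A\<^esub> x + z \<otimes>\<^bsub>A\<^esub> y"
    and I_carrier: "I \<subseteq> carrier A"
    and I_zero: "0 \<in> I"
    and I_add: "x \<in> I \<Longrightarrow> y \<in> I \<Longrightarrow> x + y \<in> I"
    and I_smult: "x \<in> I \<Longrightarrow> c \<odot>\<^bsub>A\<^esub> x \<in> I"
    and I_left: "a \<in> carrier A \<Longrightarrow> x \<in> I \<Longrightarrow> a \<otimes>\<^bsub>A\<^esub> x \<in> I"
    and I_right: "x \<in> I \<Longrightarrow> a \<in> carrier A \<Longrightarrow> x \<otimes>\<^bsub>A\<^esub> a \<in> I"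
begin

abbreviation Q where "Q \<equiv> quotient_algebra A I"

definition coset :: "'b \<Rightarrow> 'b set" where
  "coset x = I +>\<^bsub>A\<^esub> x"

lemma I_minus: "x \<in> I \<Longrightarrow> - x \<in> I"
  using I_smult[of x "- 1"] by (simp add: smult_minus)

lemma minus_carrier: "x \<in> carrier A \<Longrightarrow> - x \<in> carrier A"
  using smult_carrier[of x "- 1"] by (simp add: smult_minus)

lemma mem_coset: "y \<in> coset x \<longleftrightarrow> y - x \<in> I"
proof
  assume "y - x \<in> I"
  then show "y \<in> coset x"
    unfolding coset_def a_r_coset_def' add_eq by (intro UN_I[of "y - x"]) auto
qed (auto simp: coset_def a_r_coset_def' add_eq)

lemma coset_eq_iff: "coset x = coset y \<longleftrightarrow> x - y \<in> I"
proof
  assume "coset x = coset y"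
  then show "x - y \<in> I" using mem_coset[of x x] mem_coset[of x y] I_zero by simp
next
  assume *: "x - y \<in> I"
  have "a - x \<in> I \<longleftrightarrow> a - y \<in> I" for a
    using I_add[of "a - x" "x - y"] I_add[of "a - y" "- (x - y)"] * I_minus[OF *] by auto
  then show "coset x = coset y" by (auto simp: mem_coset)
qed

lemma coset_self: "x \<in> coset x"
  by (simp add: mem_coset I_zero)

lemma carrier_Q: "carrier Q = coset ` carrier A"
  by (auto simp: quotient_algebra_def FactRing_def A_RCOSETS_def' coset_def)

lemma homog_Q: "homog Q k = coset ` homog A k"
  by (auto simp: quotient_algebra_def coset_def)

lemma zero_Q: "\<zero>\<^bsub>Q\<^esub> = coset 0"
  using mem_coset[of _ 0] by (auto simp: quotient_algebra_def FactRing_def)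

lemma add_Q: "coset x \<oplus>\<^bsub>Q\<^esub> coset y = coset (x + y)"
proof -
  have "a \<in> coset x <+>\<^bsub>A\<^esub> coset y \<longleftrightarrow> a \<in> coset (x + y)" for a
  proof
    assume "a \<in> coset x <+>\<^bsub>A\<^esub> coset y"
    then obtain h k where "h - x \<in> I" "k - y \<in> I" "a = h + k"
      by (auto simp: set_add_def' add_eq mem_coset)
    then show "a \<in> coset (x + y)" using I_add[of "h - x" "k - y"] by (simp add: mem_coset algebra_simps)
  next
    assume "a \<in> coset (x + y)"
    then have "a - y \<in> coset x" by (simp add: mem_coset algebra_simps)
    moreover have "a = (a - y) + y" by simp
    ultimately show "a \<in> coset x <+>\<^bsub>A\<^esub> coset y"
      using coset_self[of y] unfolding set_add_def' add_eq by blast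
  qed
  then show ?thesis by (auto simp: quotient_algebra_def FactRing_def)
qed

lemma mult_Q:
  assumes "x \<in> carrier A" "y \<in> carrier A"
  shows "coset x \<otimes>\<^bsub>Q\<^esub> coset y = coset (x \<otimes>\<^bsub>A\<^esub> y)"
proof -
  \<comment> \<open>The quotient product is defined as a union over representatives; all of its
    members coincide.\<close>
  have "coset (a \<otimes>\<^bsub>A\<^esub> b) = coset (x \<otimes>\<^bsub>A\<^esub> y)" if "a \<in> coset x" "b \<in> coset y" for a b
  proof -
    define h k where hk: "h = a - x" "k = b - y"
    have h: "h \<in> I" "h \<in> carrier A" and k: "k \<in> I" "k \<in> carrier A"
      using that I_carrier by (auto simp: mem_coset hk)
    have "a \<otimes>\<^bsub>A\<^esub> b = (h + x) \<otimes>\<^bsub>A\<^esub> (k + y)" by (simp add: hk)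
    also have "\<dots> = h \<otimes>\<^bsub>A\<^esub> (k + y) + (x \<otimes>\<^bsub>A\<^esub> k + x \<otimes>\<^bsub>A\<^esub> y)"
      using assms h k by (simp add: mult_add_left mult_add_right add_carrier)
    finally have "a \<otimes>\<^bsub>A\<^esub> b - x \<otimes>\<^bsub>A\<^esub> y = h \<otimes>\<^bsub>A\<^esub> (k + y) + x \<otimes>\<^bsub>A\<^esub> k" by simp
    moreover have "\<dots> \<in> I" using assms h k by (intro I_add I_right I_left add_carrier)
    ultimately show ?thesis by (simp add: coset_eq_iff)
  qed
  then have "(\<Union>a\<in>coset x. \<Union>b\<in>coset y. coset (a \<otimes>\<^bsub>A\<^esub> b)) = coset (x \<otimes>\<^bsub>A\<^esub> y)"
    using coset_self[of x] coset_self[of y] by blast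
  then show ?thesis by (simp add: quotient_algebra_def FactRing_def rcoset_mult_def coset_def)
qed

lemma smult_Q: "c \<odot>\<^bsub>Q\<^esub> coset x = coset (c \<odot>\<^bsub>A\<^esub> x)"
proof -
  have "coset (c \<odot>\<^bsub>A\<^esub> a) = coset (c \<odot>\<^bsub>A\<^esub> x)" if "a \<in> coset x" for a
  proof -
    have "c \<odot>\<^bsub>A\<^esub> a = c \<odot>\<^bsub>A\<^esub> (a - x) + c \<odot>\<^bsub>A\<^esub> x" unfolding smult_add[symmetric] by simp
    then show ?thesis using I_smult[of "a - x" c] that by (simp add: coset_eq_iff mem_coset)
  qed
  then have "(\<Union>a\<in>coset x. coset (c \<odot>\<^bsub>A\<^esub> a)) = coset (c \<odot>\<^bsub>A\<^esub> x)" using coset_self[of x] by blast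
  then show ?thesis by (simp add: quotient_algebra_def coset_def)
qed

lemma abelian_group_Q: "abelian_group Q"
proof (rule abelian_groupI)
  fix x assume "x \<in> carrier Q"
  then obtain a where a: "a \<in> carrier A" "x = coset a" by (auto simp: carrier_Q)
  then have "coset (- a) \<in> carrier Q" "coset (- a) \<oplus>\<^bsub>Q\<^esub> x = \<zero>\<^bsub>Q\<^esub>"
    by (auto simp: carrier_Q minus_carrier add_Q zero_Q)
  then show "\<exists>y\<in>carrier Q. y \<oplus>\<^bsub>Q\<^esub> x = \<zero>\<^bsub>Q\<^esub>" by blast
qed (auto simp: carrier_Q add_Q zero_Q zero_carrier add_carrier add_ac)

lemma minus_Q:
  assumes "x \<in> carrier A" "y \<in> carrier A"
  shows "coset x \<ominus>\<^bsub>Q\<^esub> coset y = coset (x - y)"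
proof -
  interpret abelian_group Q by (rule abelian_group_Q)
  have "\<ominus>\<^bsub>Q\<^esub> coset y = coset (- y)"
    by (rule minus_equality) (use assms in \<open>auto simp: carrier_Q minus_carrier add_Q zero_Q\<close>)
  then show ?thesis by (simp add: a_minus_def add_Q)
qed

end

section \<open>Scalars and the bracket of the free nonassociative algebra\<close>

lemma lookup_scale [simp]: "Poly_Mapping.lookup (Poly_Mapping.map ((*) c) f) k = c * Poly_Mapping.lookup f k"
  for f :: "'x \<Rightarrow>\<^sub>0 complex"
  by (simp add: Poly_Mapping.map.rep_eq when_def)

lemma keys_scale: "Poly_Mapping.keys (Poly_Mapping.map ((*) c) f) \<subseteq> Poly_Mapping.keys f"
  for f :: "'x \<Rightarrow>\<^sub>0 complex"
  by (auto simp: in_keys_iff)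

lemma scale_minus: "Poly_Mapping.map ((*) (- 1)) f = - f" for f :: "'x \<Rightarrow>\<^sub>0 complex"
  by (rule poly_mapping_eqI) simp

lemma scale_add: "Poly_Mapping.map ((*) c) (f + g) = Poly_Mapping.map ((*) c) f + Poly_Mapping.map ((*) c) g"
  for f :: "'x \<Rightarrow>\<^sub>0 complex"
  by (rule poly_mapping_eqI) (simp add: lookup_add distrib_left)

text \<open>Cancellation can make the support of f + g smaller than the union of the two supports.
  For additivity all sums have to range over a common finite set.\<close>

lemma free_bracket_superset:
  assumes "finite S" "finite T" "Poly_Mapping.keys f \<subseteq> S" "Poly_Mapping.keys g \<subseteq> T"
  shows "free_bracket f g = (\<Sum>s\<in>S. \<Sum>t\<in>T.
     Poly_Mapping.single (Br s t) (Poly_Mapping.lookup f s * Poly_Mapping.lookup g t))"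
proof -
  have "(\<Sum>t\<in>Poly_Mapping.keys g. Poly_Mapping.single (Br s t) (Poly_Mapping.lookup f s * Poly_Mapping.lookup g t)) =
      (\<Sum>t\<in>T. Poly_Mapping.single (Br s t) (Poly_Mapping.lookup f s * Poly_Mapping.lookup g t))" for s
    by (rule sum.mono_neutral_left) (use assms in \<open>auto simp: in_keys_iff\<close>)
  then show ?thesis
    unfolding free_bracket_def using assms
    by (simp, intro sum.mono_neutral_left) (auto simp: in_keys_iff)
qed

lemma free_bracket_add_left: "free_bracket (f + f') g = free_bracket f g + free_bracket f' g"
proof -
  define S where "S = Poly_Mapping.keys f \<union> Poly_Mapping.keys f'"
  have S: "finite S" "Poly_Mapping.keys f \<subseteq> S" "Poly_Mapping.keys f' \<subseteq> S" "Poly_Mapping.keys (f + f') \<subseteq> S"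
    using keys_add[of f f'] by (auto simp: S_def)
  show ?thesis
    unfolding free_bracket_superset[OF S(1) finite_keys S(2) subset_refl]
      free_bracket_superset[OF S(1) finite_keys S(3) subset_refl]
      free_bracket_superset[OF S(1) finite_keys S(4) subset_refl]
    by (simp add: lookup_add distrib_right single_add sum.distrib)
qed

lemma free_bracket_add_right: "free_bracket f (g + g') = free_bracket f g + free_bracket f g'"
proof -
  define S where "S = Poly_Mapping.keys g \<union> Poly_Mapping.keys g'"
  have S: "finite S" "Poly_Mapping.keys g \<subseteq> S" "Poly_Mapping.keys g' \<subseteq> S" "Poly_Mapping.keys (g + g') \<subseteq> S"
    using keys_add[of g g'] by (auto simp: S_def)
  show ?thesis
    unfolding free_bracket_superset[OF finite_keys S(1) subset_refl S(2)]
      free_bracket_superset[OF finite_keys S(1) subset_refl S(3)]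
      free_bracket_superset[OF finite_keys S(1) subset_refl S(4)]
    by (simp add: lookup_add distrib_left single_add sum.distrib)
qed

lemma free_magma_simps [simp]:
  "mult (free_magma_algebra X) = free_bracket" "zero (free_magma_algebra X) = 0"
  "add (free_magma_algebra X) = (+)" "smult (free_magma_algebra X) = (\<lambda>c. Poly_Mapping.map ((*) c))"
  by (simp_all add: free_magma_algebra_def)

lemma free_magma_carrier:
  "f \<in> carrier (free_magma_algebra X) \<longleftrightarrow> (\<forall>t\<in>Poly_Mapping.keys f. letters t \<subseteq> X)"
  by (simp add: free_magma_algebra_def)

lemma free_magma_zero: "0 \<in> carrier (free_magma_algebra X)"
  by (simp add: free_magma_carrier)

lemma free_magma_add:
  "f \<in> carrier (free_magma_algebra X) \<Longrightarrow> g \<in> carrier (free_magma_algebra X) \<Longrightarrow> f + g \<in> carrier (free_magma_algebra X)"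
  using keys_add[of f g] by (auto simp: free_magma_carrier)

lemma free_magma_sum:
  "(\<And>x. x \<in> S \<Longrightarrow> f x \<in> carrier (free_magma_algebra X)) \<Longrightarrow> sum f S \<in> carrier (free_magma_algebra X)"
  by (induction S rule: infinite_finite_induct) (simp_all add: free_magma_zero free_magma_add)

lemma free_magma_smult:
  "f \<in> carrier (free_magma_algebra X) \<Longrightarrow> Poly_Mapping.map ((*) c) f \<in> carrier (free_magma_algebra X)"
  using keys_scale[of c f] by (auto simp: free_magma_carrier)

lemma free_magma_diff:
  "f \<in> carrier (free_magma_algebra X) \<Longrightarrow> g \<in> carrier (free_magma_algebra X) \<Longrightarrow> f - g \<in> carrier (free_magma_algebra X)"
  using free_magma_add[of f X "- g"] free_magma_smult[of g X "- 1"] by (simp add: scale_minus)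

lemma free_magma_single: "letters t \<subseteq> X \<Longrightarrow> Poly_Mapping.single t c \<in> carrier (free_magma_algebra X)"
  by (auto simp: free_magma_carrier split: if_splits)

lemma free_magma_bracket:
  assumes "f \<in> carrier (free_magma_algebra X)" "g \<in> carrier (free_magma_algebra X)"
  shows "free_bracket f g \<in> carrier (free_magma_algebra X)"
  unfolding free_bracket_def using assms
  by (intro free_magma_sum free_magma_single) (auto simp: free_magma_carrier)

lemma bracket_ideal_subset_carrier:
  assumes "R \<subseteq> carrier (free_magma_algebra X)"
  shows "bracket_ideal (free_magma_algebra X) R \<subseteq> carrier (free_magma_algebra X)"
proof
  fix x assume "x \<in> bracket_ideal (free_magma_algebra X) R"
  then show "x \<in> carrier (free_magma_algebra X)"
  proof induction
    case (base r)
    then show ?case using assms by blast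
  next
    case (smult x c)
    then show ?case by (simp add: free_magma_smult)
  qed (simp_all add: free_magma_zero free_magma_add free_magma_bracket)
qed

lemma lie_identities_subset_carrier:
  "lie_identities (free_magma_algebra X) \<subseteq> carrier (free_magma_algebra X)"
  by (auto simp: lie_identities_def intro!: free_magma_bracket free_magma_add)

lemma typed_algebra_free_magma:
  assumes "R \<subseteq> carrier (free_magma_algebra X)"
  shows "typed_algebra (free_magma_algebra X) (lie_presentation_ideal X R)"
proof
  show "lie_presentation_ideal X R \<subseteq> carrier (free_magma_algebra X)"
    unfolding lie_presentation_ideal_def
    using assms lie_identities_subset_carrier by (intro bracket_ideal_subset_carrier) auto
next
  show "0 \<in> lie_presentation_ideal X R"
    using bracket_ideal.zero[of "free_magma_algebra X"] by (simp add: lie_presentation_ideal_def)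
next
  fix x y assume "x \<in> lie_presentation_ideal X R" "y \<in> lie_presentation_ideal X R"
  then show "x + y \<in> lie_presentation_ideal X R"
    using bracket_ideal.add[of x "free_magma_algebra X" _ y] by (simp add: lie_presentation_ideal_def)
next
  fix x c assume "x \<in> lie_presentation_ideal X R"
  then show "c \<odot>\<^bsub>free_magma_algebra X\<^esub> x \<in> lie_presentation_ideal X R"
    unfolding lie_presentation_ideal_def by (rule bracket_ideal.smult)
next
  fix x a assume x: "x \<in> lie_presentation_ideal X R" and a: "a \<in> carrier (free_magma_algebra X)"
  show "x \<otimes>\<^bsub>free_magma_algebra X\<^esub> a \<in> lie_presentation_ideal X R"
    using bracket_ideal.right[OF x[unfolded lie_presentation_ideal_def] a] by (simp add: lie_presentation_ideal_def)
  show "a \<otimes>\<^bsub>free_magma_algebra X\<^esub> x \<in> lie_presentation_ideal X R"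
    using bracket_ideal.left[OF a x[unfolded lie_presentation_ideal_def]] by (simp add: lie_presentation_ideal_def)
qed (simp_all add: free_magma_zero free_magma_add free_magma_bracket free_magma_smult scale_minus
      scale_add free_bracket_add_left free_bracket_add_right)

section \<open>The enveloping algebra\<close>

lemma free_assoc_simps [simp]:
  "mult (free_assoc_algebra L) = (*)" "zero (free_assoc_algebra L) = 0" "one (free_assoc_algebra L) = 1"
  "add (free_assoc_algebra L) = (+)" "smult (free_assoc_algebra L) = (\<lambda>c. Poly_Mapping.map ((*) c))"
  by (simp_all add: free_assoc_algebra_def)

lemma free_assoc_carrier:
  "f \<in> carrier (free_assoc_algebra L) \<longleftrightarrow> (\<forall>w\<in>Poly_Mapping.keys f. set (word_list w) \<subseteq> carrier L)"
  by (simp add: free_assoc_algebra_def)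

lemma free_assoc_zero: "0 \<in> carrier (free_assoc_algebra L)"
  by (simp add: free_assoc_carrier)

lemma free_assoc_add:
  "f \<in> carrier (free_assoc_algebra L) \<Longrightarrow> g \<in> carrier (free_assoc_algebra L) \<Longrightarrow> f + g \<in> carrier (free_assoc_algebra L)"
  using keys_add[of f g] by (auto simp: free_assoc_carrier)

lemma free_assoc_smult:
  "f \<in> carrier (free_assoc_algebra L) \<Longrightarrow> Poly_Mapping.map ((*) c) f \<in> carrier (free_assoc_algebra L)"
  using keys_scale[of c f] by (auto simp: free_assoc_carrier)

lemma free_assoc_diff:
  "f \<in> carrier (free_assoc_algebra L) \<Longrightarrow> g \<in> carrier (free_assoc_algebra L) \<Longrightarrow> f - g \<in> carrier (free_assoc_algebra L)"
  using free_assoc_add[of f L "- g"] free_assoc_smult[of g L "- 1"] by (simp add: scale_minus)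

lemma free_assoc_mult:
  "f \<in> carrier (free_assoc_algebra L) \<Longrightarrow> g \<in> carrier (free_assoc_algebra L) \<Longrightarrow> f * g \<in> carrier (free_assoc_algebra L)"
  using keys_mult[of f g] by (fastforce simp: free_assoc_carrier plus_fword_def)

lemma free_assoc_constant: "Poly_Mapping.single 0 c \<in> carrier (free_assoc_algebra L)"
  by (auto simp: free_assoc_carrier zero_fword_def)

lemma letter_carrier: "x \<in> carrier L \<Longrightarrow> letter x \<in> carrier (free_assoc_algebra L)"
  by (auto simp: free_assoc_carrier letter_def)

text \<open>Scalars are multiples of the empty word. This makes an ideal in the ring sense, as given
  by \<open>Idl\<close>, closed under scalars as well.\<close>

lemma scale_eq_mult: "Poly_Mapping.map ((*) c) f = Poly_Mapping.single 0 c * f" for f :: "'a free_assoc"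
proof -
  have "f = (\<Sum>w\<in>Poly_Mapping.keys f. Poly_Mapping.single w (Poly_Mapping.lookup f w))"
    by (rule poly_mapping_eqI) (simp add: lookup_sum lookup_single when_def sum.delta in_keys_iff)
  then have "Poly_Mapping.single 0 c * f =
      (\<Sum>w\<in>Poly_Mapping.keys f. Poly_Mapping.single w (c * Poly_Mapping.lookup f w))"
    by (metis (no_types, lifting) add_0 mult_single sum.cong sum_distrib_left)
  also have "\<dots> = Poly_Mapping.map ((*) c) f"
    by (rule poly_mapping_eqI) (simp add: lookup_sum lookup_single when_def sum.delta in_keys_iff)
  finally show ?thesis ..
qed

lemma ring_free_assoc: "ring (free_assoc_algebra L)"
proof (rule ringI)
  show "abelian_group (free_assoc_algebra L)"
  proof (rule abelian_groupI)
    fix x assume "x \<in> carrier (free_assoc_algebra L)"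
    then have "- x \<in> carrier (free_assoc_algebra L)" using free_assoc_smult[of x L "- 1"] by (simp add: scale_minus)
    then show "\<exists>y\<in>carrier (free_assoc_algebra L). y \<oplus>\<^bsub>free_assoc_algebra L\<^esub> x = \<zero>\<^bsub>free_assoc_algebra L\<^esub>"
      by (intro bexI[of _ "- x"]) auto
  qed (simp_all add: free_assoc_zero free_assoc_add add_ac)
  show "monoid (free_assoc_algebra L)"
    using free_assoc_constant[of 1 L]
    by (intro monoidI) (simp_all add: free_assoc_mult mult.assoc single_one)
qed (simp_all add: algebra_simps)

text \<open>These closure properties place the relators in the carrier, so that the set they
  generate is an ideal and contains them.\<close>

definition lie_closed :: "'a graded_algebra \<Rightarrow> bool" where
  "lie_closed L \<longleftrightarrow> (\<forall>x\<in>carrier L. \<forall>y\<in>carrier L. x \<oplus>\<^bsub>L\<^esub> y \<in> carrier L \<and> x \<otimes>\<^bsub>L\<^esub> y \<in> carrier L) \<and>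
     (\<forall>x\<in>carrier L. \<forall>c. c \<odot>\<^bsub>L\<^esub> x \<in> carrier L)"

lemma enveloping_relators_carrier:
  "lie_closed L \<Longrightarrow> enveloping_relators L \<subseteq> carrier (free_assoc_algebra L)"
  unfolding enveloping_relators_def lie_closed_def
  by (auto intro!: free_assoc_diff free_assoc_add free_assoc_mult free_assoc_smult letter_carrier)

lemma ideal_enveloping: "lie_closed L \<Longrightarrow> ideal (enveloping_ideal L) (free_assoc_algebra L)"
  unfolding enveloping_ideal_def
  by (intro ring.genideal_ideal ring_free_assoc enveloping_relators_carrier)

lemma enveloping_relators_ideal: "lie_closed L \<Longrightarrow> enveloping_relators L \<subseteq> enveloping_ideal L"
  unfolding enveloping_ideal_def
  by (intro ring.genideal_self ring_free_assoc enveloping_relators_carrier)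

lemma typed_algebra_free_assoc:
  assumes "lie_closed L"
  shows "typed_algebra (free_assoc_algebra L) (enveloping_ideal L)"
proof -
  interpret ideal "enveloping_ideal L" "free_assoc_algebra L" by (rule ideal_enveloping[OF assms])
  show ?thesis
  proof
    fix x and c :: complex assume "x \<in> enveloping_ideal L"
    then show "c \<odot>\<^bsub>free_assoc_algebra L\<^esub> x \<in> enveloping_ideal L"
      using I_l_closed[OF _ free_assoc_constant] by (simp add: scale_eq_mult)
  next
    show "0 \<in> enveloping_ideal L" using additive_subgroup.zero_closed[OF is_additive_subgroup] by simp
  next
    fix x y assume "x \<in> enveloping_ideal L" "y \<in> enveloping_ideal L"
    then show "x + y \<in> enveloping_ideal L" using additive_subgroup.a_closed[OF is_additive_subgroup, of x y] by simp
  next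
    show "enveloping_ideal L \<subseteq> carrier (free_assoc_algebra L)" by (rule a_subset)
  next
    fix x a assume "x \<in> enveloping_ideal L" "a \<in> carrier (free_assoc_algebra L)"
    then show "x \<otimes>\<^bsub>free_assoc_algebra L\<^esub> a \<in> enveloping_ideal L"
      "a \<otimes>\<^bsub>free_assoc_algebra L\<^esub> x \<in> enveloping_ideal L"
      by (rule I_r_closed I_l_closed; assumption)+
  qed (simp_all add: free_assoc_zero free_assoc_add free_assoc_mult free_assoc_smult scale_minus
      scale_add algebra_simps)
qed

text \<open>Adding f to a basis of the subspace I keeps it independent, so a functional may be
  prescribed as 1 at f and 0 on I.\<close>

lemma separating_functional:
  fixes I :: "('x \<Rightarrow>\<^sub>0 complex) set"
  assumes I: "0 \<in> I" "\<And>x y. x \<in> I \<Longrightarrow> y \<in> I \<Longrightarrow> x + y \<in> I" "\<And>c x. x \<in> I \<Longrightarrow> Poly_Mapping.map ((*) c) x \<in> I"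
    and f: "f \<notin> I"
  obtains \<psi> where "\<And>x y. \<psi> (x + y) = \<psi> x + \<psi> y" "\<And>c x. \<psi> (Poly_Mapping.map ((*) c) x) = c * \<psi> x"
    "\<And>x. x \<in> I \<Longrightarrow> \<psi> x = 0" "\<psi> f \<noteq> (0::complex)"
proof -
  interpret vector_space_pair "\<lambda>c (x :: 'x \<Rightarrow>\<^sub>0 complex). Poly_Mapping.map ((*) c) x" "(*) :: complex \<Rightarrow> complex \<Rightarrow> complex"
    by unfold_locales (auto intro!: poly_mapping_eqI simp: lookup_add algebra_simps)
  obtain B where B: "B \<subseteq> I" "vs1.independent B" "I \<subseteq> vs1.span B"
    using vs1.maximal_independent_subset[of I] by blast
  have "vs1.subspace I" using I by (auto simp: vs1.subspace_def)
  then have "vs1.span B \<subseteq> I" using B(1) by (rule vs1.span_minimal[rotated])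
  then have fB: "f \<notin> vs1.span B" using f by blast
  then have "vs1.independent (insert f B)" using B(2) by (simp add: vs1.independent_insert)
  then obtain \<psi> where \<psi>: "Vector_Spaces.linear (\<lambda>c x. Poly_Mapping.map ((*) c) x) (*) \<psi>"
    "\<forall>x\<in>insert f B. \<psi> x = (if x = f then 1 else 0)"
    using linear_independent_extend[of "insert f B" "\<lambda>x. if x = f then 1 else 0"] by blast
  interpret \<psi>: Vector_Spaces.linear "\<lambda>c (x :: 'x \<Rightarrow>\<^sub>0 complex). Poly_Mapping.map ((*) c) x" "(*)" \<psi> by (rule \<psi>(1))
  have "\<psi> x = 0" if "x \<in> B" for x
    using \<psi>(2) that fB vs1.span_base[of x B] by (cases "x = f") auto
  then have "\<psi> x = 0" if "x \<in> I" for x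
    using \<psi>.eq_0_on_span[of B x] that B(3) by blast
  then show ?thesis using that[of \<psi>] \<psi>.add \<psi>.scale \<psi>(2) by auto
qed

lemma constant_commutes: "Poly_Mapping.single 0 c * f = f * Poly_Mapping.single 0 c" for f :: "'a free_assoc"
proof -
  have f: "f = (\<Sum>w\<in>Poly_Mapping.keys f. Poly_Mapping.single w (Poly_Mapping.lookup f w))"
    by (rule poly_mapping_eqI) (simp add: lookup_sum lookup_single when_def sum.delta in_keys_iff)
  show ?thesis
    by (subst (1 2) f) (simp add: sum_distrib_left sum_distrib_right mult_single mult.commute)
qed

lemma scale_mult_right: "x * Poly_Mapping.map ((*) c) y = Poly_Mapping.map ((*) c) (x * y)" for x y :: "'a free_assoc"
  unfolding scale_eq_mult mult.assoc[symmetric] constant_commutes[of c x] ..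

section \<open>Linear functionals and commutators\<close>

definition functional :: "'b graded_algebra \<Rightarrow> ('b \<Rightarrow> complex) \<Rightarrow> bool" where
  "functional A \<phi> \<longleftrightarrow>
     (\<forall>x\<in>carrier A. \<forall>y\<in>carrier A. \<phi> (x \<oplus>\<^bsub>A\<^esub> y) = \<phi> x + \<phi> y) \<and>
     (\<forall>c. \<forall>x\<in>carrier A. \<phi> (c \<odot>\<^bsub>A\<^esub> x) = c * \<phi> x)"

text \<open>By \<open>separated\<close>, an equation in A follows from equations between complex
  numbers. The other axioms make products with a fixed factor linear, so that they compose with
  functionals.\<close>

locale separated_algebra = abelian_group A for A :: "'b graded_algebra" +
  assumes mult_closed: "\<lbrakk>x \<in> carrier A; y \<in> carrier A\<rbrakk> \<Longrightarrow> x \<otimes>\<^bsub>A\<^esub> y \<in> carrier A"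
    and smult_closed: "x \<in> carrier A \<Longrightarrow> c \<odot>\<^bsub>A\<^esub> x \<in> carrier A"
    and distrib_left: "\<lbrakk>x \<in> carrier A; y \<in> carrier A; z \<in> carrier A\<rbrakk> \<Longrightarrow>
      z \<otimes>\<^bsub>A\<^esub> (x \<oplus>\<^bsub>A\<^esub> y) = z \<otimes>\<^bsub>A\<^esub> x \<oplus>\<^bsub>A\<^esub> z \<otimes>\<^bsub>A\<^esub> y"
    and distrib_right: "\<lbrakk>x \<in> carrier A; y \<in> carrier A; z \<in> carrier A\<rbrakk> \<Longrightarrow>
      (x \<oplus>\<^bsub>A\<^esub> y) \<otimes>\<^bsub>A\<^esub> z = x \<otimes>\<^bsub>A\<^esub> z \<oplus>\<^bsub>A\<^esub> y \<otimes>\<^bsub>A\<^esub> z"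
    and mult_smult_left: "\<lbrakk>x \<in> carrier A; y \<in> carrier A\<rbrakk> \<Longrightarrow> (c \<odot>\<^bsub>A\<^esub> x) \<otimes>\<^bsub>A\<^esub> y = c \<odot>\<^bsub>A\<^esub> (x \<otimes>\<^bsub>A\<^esub> y)"
    and mult_smult_right: "\<lbrakk>x \<in> carrier A; y \<in> carrier A\<rbrakk> \<Longrightarrow> x \<otimes>\<^bsub>A\<^esub> (c \<odot>\<^bsub>A\<^esub> y) = c \<odot>\<^bsub>A\<^esub> (x \<otimes>\<^bsub>A\<^esub> y)"
    and homog_carrier: "homog A k \<subseteq> carrier A"
    and separated: "\<lbrakk>x \<in> carrier A; \<And>\<phi>. functional A \<phi> \<Longrightarrow> \<phi> x = 0\<rbrakk> \<Longrightarrow> x = \<zero>\<^bsub>A\<^esub>"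
begin

lemma functional_add: "\<lbrakk>functional A \<phi>; x \<in> carrier A; y \<in> carrier A\<rbrakk> \<Longrightarrow> \<phi> (x \<oplus>\<^bsub>A\<^esub> y) = \<phi> x + \<phi> y"
  by (simp add: functional_def)

lemma functional_smult: "\<lbrakk>functional A \<phi>; x \<in> carrier A\<rbrakk> \<Longrightarrow> \<phi> (c \<odot>\<^bsub>A\<^esub> x) = c * \<phi> x"
  by (simp add: functional_def)

lemma functional_zero: "functional A \<phi> \<Longrightarrow> \<phi> \<zero>\<^bsub>A\<^esub> = 0"
  using functional_add[of \<phi> "\<zero>\<^bsub>A\<^esub>" "\<zero>\<^bsub>A\<^esub>"] by simp

lemma functional_minus:
  assumes "functional A \<phi>" "x \<in> carrier A" "y \<in> carrier A"
  shows "\<phi> (x \<ominus>\<^bsub>A\<^esub> y) = \<phi> x - \<phi> y"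
proof -
  have "\<phi> (x \<ominus>\<^bsub>A\<^esub> y) + \<phi> y = \<phi> ((x \<ominus>\<^bsub>A\<^esub> y) \<oplus>\<^bsub>A\<^esub> y)" using assms by (simp add: functional_add)
  also have "(x \<ominus>\<^bsub>A\<^esub> y) \<oplus>\<^bsub>A\<^esub> y = x" using assms by (simp add: a_minus_def a_assoc l_neg)
  finally show ?thesis by (simp add: algebra_simps)
qed

lemma functional_finsum:
  assumes "functional A \<phi>" "finite S" "\<And>s. s \<in> S \<Longrightarrow> f s \<in> carrier A"
  shows "\<phi> (finsum A f S) = (\<Sum>s\<in>S. \<phi> (f s))"
  using assms(2,3)
  by (induction S) (simp_all add: functional_zero[OF assms(1)] functional_add[OF assms(1)] Pi_iff)

text \<open>With one argument fixed this is again a \<open>functional\<close> in the other, which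
  carries it through finite sums in the algebra.\<close>

definition comm :: "('b \<Rightarrow> complex) \<Rightarrow> 'b \<Rightarrow> 'b \<Rightarrow> complex" where
  "comm \<phi> x y = \<phi> (x \<otimes>\<^bsub>A\<^esub> y \<ominus>\<^bsub>A\<^esub> y \<otimes>\<^bsub>A\<^esub> x)"

lemma comm_eq: "\<lbrakk>functional A \<phi>; x \<in> carrier A; y \<in> carrier A\<rbrakk> \<Longrightarrow> comm \<phi> x y = \<phi> (x \<otimes>\<^bsub>A\<^esub> y) - \<phi> (y \<otimes>\<^bsub>A\<^esub> x)"
  by (simp add: comm_def functional_minus mult_closed)

lemma comm_swap: "\<lbrakk>functional A \<phi>; x \<in> carrier A; y \<in> carrier A\<rbrakk> \<Longrightarrow> comm \<phi> x y = - comm \<phi> y x"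
  by (simp add: comm_eq)

lemma functional_comm_left: "functional A \<phi> \<Longrightarrow> y \<in> carrier A \<Longrightarrow> functional A (\<lambda>x. comm \<phi> x y)"
  unfolding functional_def[of A "\<lambda>x. comm \<phi> x y"]
  by (simp add: comm_eq distrib_left distrib_right mult_smult_left mult_smult_right functional_add
      functional_smult mult_closed smult_closed right_diff_distrib)

lemma functional_comm_right: "functional A \<phi> \<Longrightarrow> x \<in> carrier A \<Longrightarrow> functional A (comm \<phi> x)"
  unfolding functional_def[of A "comm \<phi> x"]
  by (simp add: comm_eq distrib_left distrib_right mult_smult_left mult_smult_right functional_add
      functional_smult mult_closed smult_closed right_diff_distrib)

end

lemma separated_enveloping:
  assumes "lie_closed L"
  shows "separated_algebra (enveloping_algebra L)"
proof -
  interpret T: typed_algebra "free_assoc_algebra L" "enveloping_ideal L"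
    by (rule typed_algebra_free_assoc[OF assms])
  interpret Q: abelian_group "enveloping_algebra L"
    unfolding enveloping_algebra_def by (rule T.abelian_group_Q)
  note Q_simps = enveloping_algebra_def T.carrier_Q
  show ?thesis
  proof
    fix x y assume "x \<in> carrier (enveloping_algebra L)" "y \<in> carrier (enveloping_algebra L)"
    then obtain a b where ab: "a \<in> carrier (free_assoc_algebra L)" "b \<in> carrier (free_assoc_algebra L)"
      "x = T.coset a" "y = T.coset b" by (auto simp: Q_simps)
    then show "x \<otimes>\<^bsub>enveloping_algebra L\<^esub> y \<in> carrier (enveloping_algebra L)"
      using free_assoc_mult by (auto simp: Q_simps T.mult_Q)
    fix c
    show "c \<odot>\<^bsub>enveloping_algebra L\<^esub> x \<in> carrier (enveloping_algebra L)"
      using ab free_assoc_smult by (auto simp: Q_simps T.smult_Q)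
    show "(c \<odot>\<^bsub>enveloping_algebra L\<^esub> x) \<otimes>\<^bsub>enveloping_algebra L\<^esub> y =
        c \<odot>\<^bsub>enveloping_algebra L\<^esub> (x \<otimes>\<^bsub>enveloping_algebra L\<^esub> y)"
      using ab free_assoc_smult[OF ab(1), of c]
      by (simp add: enveloping_algebra_def T.smult_Q T.mult_Q scale_eq_mult mult.assoc)
    show "x \<otimes>\<^bsub>enveloping_algebra L\<^esub> (c \<odot>\<^bsub>enveloping_algebra L\<^esub> y) =
        c \<odot>\<^bsub>enveloping_algebra L\<^esub> (x \<otimes>\<^bsub>enveloping_algebra L\<^esub> y)"
      using ab free_assoc_smult[OF ab(2), of c]
      by (simp add: enveloping_algebra_def T.smult_Q T.mult_Q scale_mult_right)
    fix z assume "z \<in> carrier (enveloping_algebra L)"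
    then obtain d where d: "d \<in> carrier (free_assoc_algebra L)" "z = T.coset d" by (auto simp: Q_simps)
    show "z \<otimes>\<^bsub>enveloping_algebra L\<^esub> (x \<oplus>\<^bsub>enveloping_algebra L\<^esub> y) =
       z \<otimes>\<^bsub>enveloping_algebra L\<^esub> x \<oplus>\<^bsub>enveloping_algebra L\<^esub> z \<otimes>\<^bsub>enveloping_algebra L\<^esub> y"
      "(x \<oplus>\<^bsub>enveloping_algebra L\<^esub> y) \<otimes>\<^bsub>enveloping_algebra L\<^esub> z =
       x \<otimes>\<^bsub>enveloping_algebra L\<^esub> z \<oplus>\<^bsub>enveloping_algebra L\<^esub> y \<otimes>\<^bsub>enveloping_algebra L\<^esub> z"
      using ab d free_assoc_add[OF ab(1,2)]
      by (simp_all add: enveloping_algebra_def T.add_Q T.mult_Q distrib_left distrib_right)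
  next
    fix k show "homog (enveloping_algebra L) k \<subseteq> carrier (enveloping_algebra L)"
      unfolding enveloping_algebra_def T.homog_Q T.carrier_Q
      by (intro image_mono) (auto simp: free_assoc_algebra_def)
  next
    fix x assume x: "x \<in> carrier (enveloping_algebra L)"
      and all: "\<And>\<phi>. functional (enveloping_algebra L) \<phi> \<Longrightarrow> \<phi> x = 0"
    obtain a where a: "a \<in> carrier (free_assoc_algebra L)" "x = T.coset a" using x by (auto simp: Q_simps)
    have "a \<in> enveloping_ideal L"
    proof (rule ccontr)
      assume "a \<notin> enveloping_ideal L"
      then obtain \<psi> where \<psi>: "\<And>x y. \<psi> (x + y) = \<psi> x + \<psi> y"
        "\<And>c x. \<psi> (Poly_Mapping.map ((*) c) x) = c * \<psi> x" "\<And>x. x \<in> enveloping_ideal L \<Longrightarrow> \<psi> x = 0"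
        "\<psi> a \<noteq> (0::complex)"
        using separating_functional[of "enveloping_ideal L" a] T.I_zero T.I_add T.I_smult
        by (metis free_assoc_simps(5))
      \<comment> \<open>A functional on cosets, evaluated at an arbitrary representative. The choice
        is harmless because \<psi> vanishes on the ideal.\<close>
      define \<phi> where "\<phi> = (\<lambda>Y. \<psi> (SOME y. y \<in> Y))"
      have \<phi>: "\<phi> (T.coset f) = \<psi> f" for f
      proof -
        have "(SOME y. y \<in> T.coset f) \<in> T.coset f" using T.coset_self by (rule someI)
        then have "\<psi> ((SOME y. y \<in> T.coset f) - f) = 0" using \<psi>(3) by (simp add: T.mem_coset)
        then show ?thesis using \<psi>(1)[of "(SOME y. y \<in> T.coset f) - f" f] by (simp add: \<phi>_def)
      qed
      have "functional (enveloping_algebra L) \<phi>"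
        unfolding functional_def by (auto simp: Q_simps T.add_Q T.smult_Q \<phi> \<psi>(1,2))
      from all[OF this] show False using \<psi>(4) by (simp add: a \<phi>)
    qed
    then show "x = \<zero>\<^bsub>enveloping_algebra L\<^esub>" by (simp add: a T.zero_Q enveloping_algebra_def T.coset_eq_iff)
  qed
qed

section \<open>Presented Lie algebras\<close>

locale presented_lie =
  fixes X :: "'x set" and R :: "'x magma_alg set"
  assumes relators: "R \<subseteq> carrier (free_magma_algebra X)"
begin

abbreviation M where "M \<equiv> free_magma_algebra X"
abbreviation L where "L \<equiv> presented_lie_algebra X R"
abbreviation U where "U \<equiv> enveloping_algebra L"

sublocale N: typed_algebra M "lie_presentation_ideal X R"
  by (rule typed_algebra_free_magma[OF relators])

lemma carrier_L: "carrier L = N.coset ` carrier M"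
  unfolding presented_lie_algebra_def by (rule N.carrier_Q)

lemma lie_closed_L: "lie_closed L"
  unfolding lie_closed_def carrier_L
  by (auto simp: presented_lie_algebra_def N.add_Q N.mult_Q N.smult_Q free_magma_bracket free_magma_add
      free_magma_smult intro!: imageI)

sublocale E: typed_algebra "free_assoc_algebra L" "enveloping_ideal L"
  by (rule typed_algebra_free_assoc[OF lie_closed_L])

sublocale U: separated_algebra U
  by (rule separated_enveloping[OF lie_closed_L])

text \<open>The composite of the quotient map onto the presented Lie algebra with the canonical map
  into its enveloping algebra. It is linear on the carrier, sends brackets to commutators and kills
  the relators.\<close>

definition \<rho> :: "'x magma_alg \<Rightarrow> 'x magma_alg set free_assoc set" where
  "\<rho> f = E.coset (letter (N.coset f))"

lemma enveloping_relators_simps: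
  "\<lbrakk>x \<in> carrier L; y \<in> carrier L\<rbrakk> \<Longrightarrow> letter (x \<oplus>\<^bsub>L\<^esub> y) - (letter x + letter y) \<in> enveloping_ideal L"
  "x \<in> carrier L \<Longrightarrow> letter (c \<odot>\<^bsub>L\<^esub> x) - Poly_Mapping.map ((*) c) (letter x) \<in> enveloping_ideal L"
  "\<lbrakk>x \<in> carrier L; y \<in> carrier L\<rbrakk> \<Longrightarrow>
     letter (x \<otimes>\<^bsub>L\<^esub> y) - (letter x * letter y - letter y * letter x) \<in> enveloping_ideal L"
  by (rule subsetD[OF enveloping_relators_ideal[OF lie_closed_L]], unfold enveloping_relators_def, blast)+

lemma letter_coset_carrier: "f \<in> carrier M \<Longrightarrow> letter (N.coset f) \<in> carrier (free_assoc_algebra L)"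
  by (intro letter_carrier) (simp add: carrier_L)

lemma \<rho>_closed: "f \<in> carrier M \<Longrightarrow> \<rho> f \<in> carrier U"
  by (simp add: \<rho>_def enveloping_algebra_def E.carrier_Q letter_coset_carrier)

lemma \<rho>_add: "\<lbrakk>f \<in> carrier M; g \<in> carrier M\<rbrakk> \<Longrightarrow> \<rho> (f + g) = \<rho> f \<oplus>\<^bsub>U\<^esub> \<rho> g"
  using enveloping_relators_simps(1)[of "N.coset f" "N.coset g"]
  by (simp add: \<rho>_def enveloping_algebra_def E.add_Q E.coset_eq_iff carrier_L)
     (simp add: presented_lie_algebra_def N.add_Q)

lemma \<rho>_smult: "f \<in> carrier M \<Longrightarrow> \<rho> (Poly_Mapping.map ((*) c) f) = c \<odot>\<^bsub>U\<^esub> \<rho> f"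
  using enveloping_relators_simps(2)[of "N.coset f" c]
  by (simp add: \<rho>_def enveloping_algebra_def E.smult_Q E.coset_eq_iff carrier_L)
     (simp add: presented_lie_algebra_def N.smult_Q)

lemma \<rho>_bracket:
  "\<lbrakk>f \<in> carrier M; g \<in> carrier M\<rbrakk> \<Longrightarrow> \<rho> (free_bracket f g) = \<rho> f \<otimes>\<^bsub>U\<^esub> \<rho> g \<ominus>\<^bsub>U\<^esub> \<rho> g \<otimes>\<^bsub>U\<^esub> \<rho> f"
  using enveloping_relators_simps(3)[of "N.coset f" "N.coset g"]
  by (simp add: \<rho>_def enveloping_algebra_def E.mult_Q E.minus_Q E.coset_eq_iff carrier_L letter_coset_carrier free_assoc_mult)
     (simp add: presented_lie_algebra_def N.mult_Q)

lemma \<rho>_relator: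
  assumes "r \<in> R"
  shows "\<rho> r = \<zero>\<^bsub>U\<^esub>"
proof -
  have "r \<in> lie_presentation_ideal X R"
    using assms unfolding lie_presentation_ideal_def by (intro bracket_ideal.base) simp
  then have "N.coset r = N.coset 0" by (simp add: N.coset_eq_iff)
  \<comment> \<open>Writing 0 as a multiple by the scalar 0 reduces the vanishing of \<rho> at 0 to
    \<open>\<rho>_smult\<close>.\<close>
  moreover have "Poly_Mapping.map ((*) 0) 0 = (0 :: 'x magma_alg)" by (rule poly_mapping_eqI) simp
  ultimately have "\<rho> r = \<rho> (Poly_Mapping.map ((*) 0) 0)" by (simp add: \<rho>_def)
  also have "\<dots> = 0 \<odot>\<^bsub>U\<^esub> \<rho> 0" by (rule \<rho>_smult[OF free_magma_zero])
  also have "\<dots> = \<zero>\<^bsub>U\<^esub>"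
    using \<rho>_closed[OF free_magma_zero]
    by (intro U.separated U.smult_closed) (simp_all add: U.functional_smult)
  finally show ?thesis .
qed

lemma functional_\<rho>_add:
  "\<lbrakk>functional U F; f \<in> carrier M; g \<in> carrier M\<rbrakk> \<Longrightarrow> F (\<rho> (f + g)) = F (\<rho> f) + F (\<rho> g)"
  by (simp add: \<rho>_add U.functional_add \<rho>_closed)

lemma functional_\<rho>_diff:
  assumes "functional U F" "f \<in> carrier M" "g \<in> carrier M"
  shows "F (\<rho> (f - g)) = F (\<rho> f) - F (\<rho> g)"
  using functional_\<rho>_add[OF assms(1) free_magma_diff[OF assms(2,3)] assms(3)] by simp

lemma functional_\<rho>_sum:
  assumes "functional U F" "finite S" "\<And>s. s \<in> S \<Longrightarrow> f s \<in> carrier M"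
  shows "F (\<rho> (sum f S)) = (\<Sum>s\<in>S. F (\<rho> (f s)))"
  using assms(2,3)
proof (induction S)
  case empty
  show ?case using functional_\<rho>_add[OF assms(1) free_magma_zero free_magma_zero] by simp
qed (simp add: functional_\<rho>_add[OF assms(1)] free_magma_sum)

lemma comm_\<rho>_relator:
  assumes "functional U \<phi>" "free_bracket f g \<in> R" "f \<in> carrier M" "g \<in> carrier M"
  shows "U.comm \<phi> (\<rho> f) (\<rho> g) = 0"
  using \<rho>_bracket[OF assms(3,4)] \<rho>_relator[OF assms(2)] U.functional_zero[OF assms(1)]
  by (simp add: U.comm_def)

end

section \<open>Commutation of the coefficients on the affine chart\<close>

context finite_psu2
begin

lemma X2_carrier: "i \<noteq> j \<Longrightarrow> g \<in> G \<Longrightarrow> X2 i j g \<in> carrier (free_magma_algebra (pn_generators G))"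
  unfolding X2_def by (intro free_magma_single) (auto simp: pn_generators_def)

lemma X1_carrier: "p \<in> special_points G \<Longrightarrow> X1 i p \<in> carrier (free_magma_algebra (pn_generators G))"
  unfolding X1_def by (intro free_magma_single) (auto simp: pn_generators_def)

lemma pn_relators_carrier:
  "pn_relators G \<subseteq> carrier (free_magma_algebra (pn_generators G :: 'n::finite pgen set))"
  unfolding pn_relators_def
  by (intro Un_least; clarify; intro free_magma_diff free_magma_add free_magma_sum free_magma_bracket
      X2_carrier X1_carrier; auto simp: act_special stab_eq)

end

lemma pn_relatorsI:
  fixes i j k l :: "'n::finite"
  shows "\<lbrakk>i \<noteq> j; g \<in> G\<rbrakk> \<Longrightarrow> X2 i j g - X2 j i (inv\<^bsub>PSU2\<^esub> g) \<in> pn_relators G"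
    and "(\<Sum>q\<in>special_points G. X1 i q) + (\<Sum>m\<in>UNIV - {i}. \<Sum>g\<in>G. X2 i m g) \<in> pn_relators G"
    and "\<lbrakk>distinct [i, j, k, l]; g \<in> G; h \<in> G\<rbrakk> \<Longrightarrow> free_bracket (X2 i j g) (X2 k l h) \<in> pn_relators G"
    and "\<lbrakk>distinct [i, j, k]; g \<in> G; h \<in> G\<rbrakk> \<Longrightarrow>
     free_bracket (X2 i j g) (X2 k j (h \<otimes>\<^bsub>PSU2\<^esub> g) + X2 k i h) \<in> pn_relators G"
    and "\<lbrakk>distinct [i, j, k]; p \<in> special_points G; g \<in> G\<rbrakk> \<Longrightarrow> free_bracket (X1 i p) (X2 j k g) \<in> pn_relators G"
    and "\<lbrakk>i \<noteq> j; p \<in> special_points G; q \<in> special_points G - orb G p\<rbrakk> \<Longrightarrow>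
     free_bracket (X1 i p) (X1 j q) \<in> pn_relators G"
    and "\<lbrakk>i \<noteq> j; g \<in> G; p \<in> special_points G\<rbrakk> \<Longrightarrow> free_bracket (X2 i j g)
     (X1 j p + X1 i (act g p) + (\<Sum>h\<in>stab G p. X2 i j (g \<otimes>\<^bsub>PSU2\<^esub> h))) \<in> pn_relators G"
    and "\<lbrakk>i \<noteq> j; g \<in> G; p \<in> special_points G\<rbrakk> \<Longrightarrow> free_bracket (X1 j p)
     (X1 i (act g p) + (\<Sum>h\<in>stab G p. X2 i j (g \<otimes>\<^bsub>PSU2\<^esub> h))) \<in> pn_relators G"
proof -
  show "\<lbrakk>i \<noteq> j; g \<in> G\<rbrakk> \<Longrightarrow> X2 i j g - X2 j i (inv\<^bsub>PSU2\<^esub> g) \<in> pn_relators G"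
    \<comment> \<open>The union nests to the left: a family is reached by dropping the later ones
      with \<open>UnI1\<close> and, except for the first family, a final
      \<open>UnI2\<close>.\<close>
    unfolding pn_relators_def by (rule UnI1, rule UnI1, rule UnI1, rule UnI1, rule UnI1, rule UnI1, rule UnI1, intro CollectI exI conjI, rule refl) (assumption | rule TrueI)+
  show "(\<Sum>q\<in>special_points G. X1 i q) + (\<Sum>m\<in>UNIV - {i}. \<Sum>g\<in>G. X2 i m g) \<in> pn_relators G"
    unfolding pn_relators_def by (rule UnI1, rule UnI1, rule UnI1, rule UnI1, rule UnI1, rule UnI1, rule UnI2, intro CollectI exI conjI, rule refl) (assumption | rule TrueI)+
  show "\<lbrakk>distinct [i, j, k, l]; g \<in> G; h \<in> G\<rbrakk> \<Longrightarrow> free_bracket (X2 i j g) (X2 k l h) \<in> pn_relators G"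
    unfolding pn_relators_def by (rule UnI1, rule UnI1, rule UnI1, rule UnI1, rule UnI1, rule UnI2, intro CollectI exI conjI, rule refl) (assumption | rule TrueI)+
  show "\<lbrakk>distinct [i, j, k]; g \<in> G; h \<in> G\<rbrakk> \<Longrightarrow>
     free_bracket (X2 i j g) (X2 k j (h \<otimes>\<^bsub>PSU2\<^esub> g) + X2 k i h) \<in> pn_relators G"
    unfolding pn_relators_def by (rule UnI1, rule UnI1, rule UnI1, rule UnI1, rule UnI2, intro CollectI exI conjI, rule refl) (assumption | rule TrueI)+
  show "\<lbrakk>distinct [i, j, k]; p \<in> special_points G; g \<in> G\<rbrakk> \<Longrightarrow> free_bracket (X1 i p) (X2 j k g) \<in> pn_relators G"
    unfolding pn_relators_def by (rule UnI1, rule UnI1, rule UnI1, rule UnI2, intro CollectI exI conjI, rule refl) (assumption | rule TrueI)+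
  show "\<lbrakk>i \<noteq> j; p \<in> special_points G; q \<in> special_points G - orb G p\<rbrakk> \<Longrightarrow>
     free_bracket (X1 i p) (X1 j q) \<in> pn_relators G"
    unfolding pn_relators_def by (rule UnI1, rule UnI1, rule UnI2, intro CollectI exI conjI, rule refl) (assumption | rule TrueI)+
  show "\<lbrakk>i \<noteq> j; g \<in> G; p \<in> special_points G\<rbrakk> \<Longrightarrow> free_bracket (X2 i j g)
     (X1 j p + X1 i (act g p) + (\<Sum>h\<in>stab G p. X2 i j (g \<otimes>\<^bsub>PSU2\<^esub> h))) \<in> pn_relators G"
    unfolding pn_relators_def by (rule UnI1, rule UnI2, intro CollectI exI conjI, rule refl) (assumption | rule TrueI)+
  show "\<lbrakk>i \<noteq> j; g \<in> G; p \<in> special_points G\<rbrakk> \<Longrightarrow> free_bracket (X1 j p)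
     (X1 i (act g p) + (\<Sum>h\<in>stab G p. X2 i j (g \<otimes>\<^bsub>PSU2\<^esub> h))) \<in> pn_relators G"
    unfolding pn_relators_def by (rule UnI2, intro CollectI exI conjI, rule refl) (assumption | rule TrueI)+
qed

text \<open>The dummy argument carries the index type, which does not occur in the type of
  G.\<close>

locale pn_algebra = finite_psu2 G for G :: "psu2 set" +
  fixes n :: "'n::finite itself"
begin

sublocale presented_lie "pn_generators G :: 'n pgen set" "pn_relators G"
  by unfold_locales (rule pn_relators_carrier)

lemma Upn_eq: "Upn G = U"
  by (simp add: Upn_def pn_def)

lemma Ugen_eq: "Ugen G x = \<rho> (Poly_Mapping.single (Letter x) 1)"
  by (simp add: Ugen_def enveloping_map_def presented_lie_generator_def \<rho>_def pn_def N.coset_def E.coset_def)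

lemma Ugen_X2: "Ugen G (Xij i j g) = \<rho> (X2 i j g)" and Ugen_X1: "Ugen G (Xi i p) = \<rho> (X1 i p)"
  by (simp_all add: Ugen_eq X2_def X1_def)

lemma Ugen_closed: "x \<in> pn_generators G \<Longrightarrow> Ugen G x \<in> carrier U"
  unfolding Ugen_eq by (intro \<rho>_closed free_magma_single) auto

text \<open>The value 0 off the generators makes the pairing alternating for all arguments, as
  \<open>pn_pairing\<close> demands, even where \<open>Ugen\<close> might leave the carrier.\<close>

definition pairing :: "('n upn \<Rightarrow> complex) \<Rightarrow> 'n pgen \<Rightarrow> 'n pgen \<Rightarrow> complex" where
  "pairing \<phi> x y = (if x \<in> pn_generators G \<and> y \<in> pn_generators G then U.comm \<phi> (Ugen G x) (Ugen G y) else 0)"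

lemma pairing_simps:
  "\<lbrakk>i \<noteq> j; g \<in> G; k \<noteq> l; h \<in> G\<rbrakk> \<Longrightarrow> pairing \<phi> (Xij i j g) (Xij k l h) = U.comm \<phi> (\<rho> (X2 i j g)) (\<rho> (X2 k l h))"
  "\<lbrakk>i \<noteq> j; g \<in> G; p \<in> special_points G\<rbrakk> \<Longrightarrow> pairing \<phi> (Xij i j g) (Xi k p) = U.comm \<phi> (\<rho> (X2 i j g)) (\<rho> (X1 k p))"
  "\<lbrakk>i \<noteq> j; g \<in> G; p \<in> special_points G\<rbrakk> \<Longrightarrow> pairing \<phi> (Xi k p) (Xij i j g) = U.comm \<phi> (\<rho> (X1 k p)) (\<rho> (X2 i j g))"
  "\<lbrakk>q \<in> special_points G; p \<in> special_points G\<rbrakk> \<Longrightarrow> pairing \<phi> (Xi k p) (Xi l q) = U.comm \<phi> (\<rho> (X1 k p)) (\<rho> (X1 l q))"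
  by (simp_all add: pairing_def Xij_generator Xi_generator Ugen_X1 Ugen_X2)

lemma pn_pairing_pairing:
  assumes \<phi>: "functional U \<phi>"
  shows "pn_pairing G (pairing \<phi>)"
proof
  fix x y
  show "pairing \<phi> x y = - pairing \<phi> y x"
    using U.comm_swap[OF \<phi>, of "Ugen G x" "Ugen G y"] by (auto simp: pairing_def Ugen_closed)
next
  fix i j :: 'n and g and y :: "'n pgen" assume h: "i \<noteq> j" "g \<in> G" "y \<in> pn_generators G"
  have F: "functional U (\<lambda>x. U.comm \<phi> x (Ugen G y))"
    by (rule U.functional_comm_left[OF \<phi> Ugen_closed[OF h(3)]])
  have "X2 i j g - X2 j i (inv\<^bsub>PSU2\<^esub> g) \<in> pn_relators G" using h(1,2) by (rule pn_relatorsI(1))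
  from \<rho>_relator[OF this] have "U.comm \<phi> (\<rho> (X2 i j g - X2 j i (inv\<^bsub>PSU2\<^esub> g))) (Ugen G y) = 0"
    using U.functional_zero[OF F] by simp
  then show "pairing \<phi> (Xij i j g) y = pairing \<phi> (Xij j i (inv\<^bsub>PSU2\<^esub> g)) y"
    using functional_\<rho>_diff[OF F X2_carrier X2_carrier, of i j g j i "inv\<^bsub>PSU2\<^esub> g"] h
    by (simp add: pairing_def Xij_generator Ugen_X2)
next
  fix y :: "'n pgen" and i :: 'n assume h: "y \<in> pn_generators G"
  have F: "functional U (\<lambda>x. U.comm \<phi> x (Ugen G y))"
    by (rule U.functional_comm_left[OF \<phi> Ugen_closed[OF h]])
  have m: "\<And>m g. m \<noteq> i \<Longrightarrow> g \<in> G \<Longrightarrow> X2 i m g \<in> carrier M" by (rule X2_carrier) auto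
  have "(\<Sum>q\<in>special_points G. X1 i q) + (\<Sum>m\<in>UNIV - {i}. \<Sum>g\<in>G. X2 i m g) \<in> pn_relators G"
    by (rule pn_relatorsI(2))
  from \<rho>_relator[OF this] have "U.comm \<phi> (\<rho> ((\<Sum>q\<in>special_points G. X1 i q) + (\<Sum>m\<in>UNIV - {i}. \<Sum>g\<in>G. X2 i m g))) (Ugen G y) = 0"
    using U.functional_zero[OF F] by simp
  moreover have "U.comm \<phi> (\<rho> ((\<Sum>q\<in>special_points G. X1 i q) + (\<Sum>m\<in>UNIV - {i}. \<Sum>g\<in>G. X2 i m g))) (Ugen G y) =
      (\<Sum>q\<in>special_points G. U.comm \<phi> (\<rho> (X1 i q)) (Ugen G y)) +
      (\<Sum>m\<in>UNIV - {i}. \<Sum>g\<in>G. U.comm \<phi> (\<rho> (X2 i m g)) (Ugen G y))"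
  proof -
    have c2: "(\<Sum>g\<in>G. X2 i m g) \<in> carrier M" if "m \<in> UNIV - {i}" for m
      using that by (intro free_magma_sum m) auto
    have "U.comm \<phi> (\<rho> (\<Sum>g\<in>G. X2 i m g)) (Ugen G y) = (\<Sum>g\<in>G. U.comm \<phi> (\<rho> (X2 i m g)) (Ugen G y))"
      if "m \<in> UNIV - {i}" for m
      using that by (intro functional_\<rho>_sum[OF F finite_G] m) auto
    then have "U.comm \<phi> (\<rho> (\<Sum>m\<in>UNIV - {i}. \<Sum>g\<in>G. X2 i m g)) (Ugen G y) =
        (\<Sum>m\<in>UNIV - {i}. \<Sum>g\<in>G. U.comm \<phi> (\<rho> (X2 i m g)) (Ugen G y))"
      using functional_\<rho>_sum[OF F, of "UNIV - {i}" "\<lambda>m. \<Sum>g\<in>G. X2 i m g"] c2 by simp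
    moreover have "U.comm \<phi> (\<rho> (\<Sum>q\<in>special_points G. X1 i q)) (Ugen G y) =
        (\<Sum>q\<in>special_points G. U.comm \<phi> (\<rho> (X1 i q)) (Ugen G y))"
      by (intro functional_\<rho>_sum[OF F finite_special] X1_carrier)
    moreover have d1: "(\<Sum>q\<in>special_points G. X1 i q) \<in> carrier M" by (intro free_magma_sum X1_carrier)
    moreover have d2: "(\<Sum>m\<in>UNIV - {i}. \<Sum>g\<in>G. X2 i m g) \<in> carrier M" by (intro free_magma_sum[OF c2])
    ultimately show ?thesis using functional_\<rho>_add[OF F d1 d2] by simp
  qed
  ultimately show "(\<Sum>q\<in>special_points G. pairing \<phi> (Xi i q) y) + (\<Sum>m\<in>UNIV - {i}. \<Sum>g\<in>G. pairing \<phi> (Xij i m g) y) = 0"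
    using h by (simp add: pairing_def Xij_generator Xi_generator Ugen_X2 Ugen_X1)
next
  fix i j k l :: 'n and g h assume d: "distinct [i, j, k, l]" "g \<in> G" "h \<in> G"
  then have "free_bracket (X2 i j g) (X2 k l h) \<in> pn_relators G" by (rule pn_relatorsI(3))
  then show "pairing \<phi> (Xij i j g) (Xij k l h) = 0"
    using d comm_\<rho>_relator[OF \<phi>, of "X2 i j g" "X2 k l h"] by (simp add: pairing_simps X2_carrier)
next
  fix i j k :: 'n and g h assume d: "distinct [i, j, k]" "g \<in> G" "h \<in> G"
  then have r: "free_bracket (X2 i j g) (X2 k j (h \<otimes>\<^bsub>PSU2\<^esub> g) + X2 k i h) \<in> pn_relators G"
    by (rule pn_relatorsI(4))
  have c: "X2 i j g \<in> carrier M" "X2 k j (h \<otimes>\<^bsub>PSU2\<^esub> g) \<in> carrier M" "X2 k i h \<in> carrier M"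
    using d by (auto intro!: X2_carrier)
  show "pairing \<phi> (Xij i j g) (Xij k j (h \<otimes>\<^bsub>PSU2\<^esub> g)) + pairing \<phi> (Xij i j g) (Xij k i h) = 0"
    using d c comm_\<rho>_relator[OF \<phi> r c(1) free_magma_add[OF c(2,3)]]
      functional_\<rho>_add[OF U.functional_comm_right[OF \<phi> \<rho>_closed[OF c(1)]] c(2,3)]
    by (auto simp: pairing_simps)
next
  fix i j k :: 'n and p g assume d: "distinct [i, j, k]" "p \<in> special_points G" "g \<in> G"
  then have "free_bracket (X1 i p) (X2 j k g) \<in> pn_relators G" by (rule pn_relatorsI(5))
  then show "pairing \<phi> (Xi i p) (Xij j k g) = 0"
    using d comm_\<rho>_relator[OF \<phi>, of "X1 i p" "X2 j k g"] by (simp add: pairing_simps X2_carrier X1_carrier)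
next
  fix i j :: 'n and p q assume d: "i \<noteq> j" "p \<in> special_points G" "q \<in> special_points G" "q \<notin> orb G p"
  then have "free_bracket (X1 i p) (X1 j q) \<in> pn_relators G" by (intro pn_relatorsI(6)) auto
  then show "pairing \<phi> (Xi i p) (Xi j q) = 0"
    using d comm_\<rho>_relator[OF \<phi>, of "X1 i p" "X1 j q"] by (simp add: pairing_simps X1_carrier)
next
  fix i j :: 'n and g p assume d: "i \<noteq> j" "g \<in> G" "p \<in> special_points G"
  have fs: "finite (stab G p)" using finite_G by (simp add: stab_eq)
  have sg: "\<And>h. h \<in> stab G p \<Longrightarrow> g \<otimes>\<^bsub>PSU2\<^esub> h \<in> G" using d by (simp add: stab_eq)
  have c: "X2 i j g \<in> carrier M" "X1 j p \<in> carrier M" "X1 i (act g p) \<in> carrier M"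
    "\<And>h. h \<in> stab G p \<Longrightarrow> X2 i j (g \<otimes>\<^bsub>PSU2\<^esub> h) \<in> carrier M"
    using d sg by (auto intro!: X2_carrier X1_carrier act_special)
  have cs: "(\<Sum>h\<in>stab G p. X2 i j (g \<otimes>\<^bsub>PSU2\<^esub> h)) \<in> carrier M" by (intro free_magma_sum c)
  have "free_bracket (X2 i j g) (X1 j p + X1 i (act g p) + (\<Sum>h\<in>stab G p. X2 i j (g \<otimes>\<^bsub>PSU2\<^esub> h))) \<in> pn_relators G"
    using d by (rule pn_relatorsI(7))
  from comm_\<rho>_relator[OF \<phi> this c(1) free_magma_add[OF free_magma_add[OF c(2,3)] cs]]
  have "U.comm \<phi> (\<rho> (X2 i j g)) (\<rho> (X1 j p)) + U.comm \<phi> (\<rho> (X2 i j g)) (\<rho> (X1 i (act g p))) +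
     (\<Sum>h\<in>stab G p. U.comm \<phi> (\<rho> (X2 i j g)) (\<rho> (X2 i j (g \<otimes>\<^bsub>PSU2\<^esub> h)))) = 0"
    using functional_\<rho>_add[OF U.functional_comm_right[OF \<phi> \<rho>_closed[OF c(1)]]] c cs free_magma_add[OF c(2,3)]
      functional_\<rho>_sum[OF U.functional_comm_right[OF \<phi> \<rho>_closed[OF c(1)]] fs, of "\<lambda>h. X2 i j (g \<otimes>\<^bsub>PSU2\<^esub> h)"]
    by simp
  then show "pairing \<phi> (Xij i j g) (Xi j p) + pairing \<phi> (Xij i j g) (Xi i (act g p)) +
      (\<Sum>h\<in>stab G p. pairing \<phi> (Xij i j g) (Xij i j (g \<otimes>\<^bsub>PSU2\<^esub> h))) = 0"
    using d sg by (simp add: pairing_simps act_special)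
  have "free_bracket (X1 j p) (X1 i (act g p) + (\<Sum>h\<in>stab G p. X2 i j (g \<otimes>\<^bsub>PSU2\<^esub> h))) \<in> pn_relators G"
    using d by (rule pn_relatorsI(8))
  from comm_\<rho>_relator[OF \<phi> this c(2) free_magma_add[OF c(3) cs]]
  have "U.comm \<phi> (\<rho> (X1 j p)) (\<rho> (X1 i (act g p))) +
     (\<Sum>h\<in>stab G p. U.comm \<phi> (\<rho> (X1 j p)) (\<rho> (X2 i j (g \<otimes>\<^bsub>PSU2\<^esub> h)))) = 0"
    using functional_\<rho>_add[OF U.functional_comm_right[OF \<phi> \<rho>_closed[OF c(2)]]] c cs
      functional_\<rho>_sum[OF U.functional_comm_right[OF \<phi> \<rho>_closed[OF c(2)]] fs, of "\<lambda>h. X2 i j (g \<otimes>\<^bsub>PSU2\<^esub> h)"]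
    by simp
  then show "pairing \<phi> (Xi j p) (Xi i (act g p)) +
      (\<Sum>h\<in>stab G p. pairing \<phi> (Xi j p) (Xij i j (g \<otimes>\<^bsub>PSU2\<^esub> h))) = 0"
    using d sg by (simp add: pairing_simps act_special)
qed

lemma affine_coeff_closed: "affine_coeff G z i \<in> carrier U"
  unfolding affine_coeff_def Upn_eq
  by (intro U.a_closed U.finsum_closed Pi_I U.smult_closed Ugen_closed Xij_generator Xi_generator) auto

lemma functional_affine_coeff:
  assumes F: "functional U F"
  shows "F (affine_coeff G z i) = (\<Sum>p\<in>special_points G. dlog (z $ i) p * F (Ugen G (Xi i p))) +
     (\<Sum>j\<in>UNIV - {i}. \<Sum>g\<in>G. dlog (z $ i) (act g (Fin (z $ j))) * F (Ugen G (Xij i j g)))"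
proof -
  have c: "\<And>p. p \<in> special_points G \<Longrightarrow> dlog (z $ i) p \<odot>\<^bsub>U\<^esub> Ugen G (Xi i p) \<in> carrier U"
    "\<And>j g. j \<in> UNIV - {i} \<Longrightarrow> g \<in> G \<Longrightarrow> dlog (z $ i) (act g (Fin (z $ j))) \<odot>\<^bsub>U\<^esub> Ugen G (Xij i j g) \<in> carrier U"
    by (auto intro!: U.smult_closed Ugen_closed Xij_generator Xi_generator)
  have c3: "(\<Oplus>\<^bsub>U\<^esub>g\<in>G. dlog (z $ i) (act g (Fin (z $ j))) \<odot>\<^bsub>U\<^esub> Ugen G (Xij i j g)) \<in> carrier U"
    if "j \<in> UNIV - {i}" for j using c(2)[OF that] by (intro U.finsum_closed Pi_I)
  have s: "F (\<Oplus>\<^bsub>U\<^esub>p\<in>special_points G. dlog (z $ i) p \<odot>\<^bsub>U\<^esub> Ugen G (Xi i p)) =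
      (\<Sum>p\<in>special_points G. F (dlog (z $ i) p \<odot>\<^bsub>U\<^esub> Ugen G (Xi i p)))"
    by (rule U.functional_finsum[OF F finite_special c(1)])
  have s2: "F (\<Oplus>\<^bsub>U\<^esub>j\<in>UNIV - {i}. \<Oplus>\<^bsub>U\<^esub>g\<in>G. dlog (z $ i) (act g (Fin (z $ j))) \<odot>\<^bsub>U\<^esub> Ugen G (Xij i j g)) =
     (\<Sum>j\<in>UNIV - {i}. F (\<Oplus>\<^bsub>U\<^esub>g\<in>G. dlog (z $ i) (act g (Fin (z $ j))) \<odot>\<^bsub>U\<^esub> Ugen G (Xij i j g)))"
    by (rule U.functional_finsum[OF F _ c3]) simp
  have "F (affine_coeff G z i) = (\<Sum>p\<in>special_points G. F (dlog (z $ i) p \<odot>\<^bsub>U\<^esub> Ugen G (Xi i p))) +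
     (\<Sum>j\<in>UNIV - {i}. F (\<Oplus>\<^bsub>U\<^esub>g\<in>G. dlog (z $ i) (act g (Fin (z $ j))) \<odot>\<^bsub>U\<^esub> Ugen G (Xij i j g)))"
    unfolding affine_coeff_def Upn_eq s[symmetric] s2[symmetric]
    by (intro U.functional_add[OF F] U.finsum_closed Pi_I c c3)
  also have "(\<Sum>j\<in>UNIV - {i}. F (\<Oplus>\<^bsub>U\<^esub>g\<in>G. dlog (z $ i) (act g (Fin (z $ j))) \<odot>\<^bsub>U\<^esub> Ugen G (Xij i j g))) =
     (\<Sum>j\<in>UNIV - {i}. \<Sum>g\<in>G. F (dlog (z $ i) (act g (Fin (z $ j))) \<odot>\<^bsub>U\<^esub> Ugen G (Xij i j g)))"
    using c by (intro sum.cong refl U.functional_finsum[OF F finite_G])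
  finally show ?thesis by (simp add: U.functional_smult[OF F] Ugen_closed Xij_generator Xi_generator)
qed

lemma affine_coeff_commute:
  assumes \<phi>: "functional U \<phi>" and z: "(\<lambda>k. Fin (z $ k)) \<in> Cf G"
  shows "U.comm \<phi> (affine_coeff G z i) (affine_coeff G z j) = 0"
proof (cases "i = j")
  case True
  then show ?thesis using affine_coeff_closed[of z j] by (simp add: U.comm_eq[OF \<phi>])
next
  case False
  interpret P: pn_pairing G "pairing \<phi>" by (rule pn_pairing_pairing[OF \<phi>])
  have 1: "U.comm \<phi> (affine_coeff G z i) (Ugen G y) = P.lin z i y" if "y \<in> pn_generators G" for y
    unfolding functional_affine_coeff[OF U.functional_comm_left[OF \<phi> Ugen_closed[OF that]]] P.lin_def
    using that by (simp add: pairing_def Xij_generator Xi_generator)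
  show ?thesis
    unfolding functional_affine_coeff[OF U.functional_comm_right[OF \<phi> affine_coeff_closed]]
    using P.pairing_vanishes[OF z False] by (simp add: 1 Xij_generator Xi_generator)
qed

end

section \<open>Holomorphic functions on open subsets of \<open>\<complex>\<^sup>n\<close>\<close>

lemma norm_axis_complex: "norm (axis i s :: complex^'n::finite) = norm s"
proof -
  have "(norm ((axis i s :: complex^'n) $ k))\<^sup>2 = (if k = i then (norm s)\<^sup>2 else 0)" for k
    by (simp add: axis_def)
  then show ?thesis by (simp add: norm_vec_def L2_set_def)
qed

lemma axis_has_derivative: "((\<lambda>s. w + axis i s) has_derivative axis i) (at (s::complex))"
  for w :: "complex^'n::finite"
proof -
  have "bounded_linear (axis i :: complex \<Rightarrow> complex^'n)"
  proof (rule bounded_linear_intro[where K=1])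
    show "axis i (x + y) = (axis i x + axis i y :: complex^'n)"
      "axis i (r *\<^sub>R x) = r *\<^sub>R (axis i x :: complex^'n)" for x y r
      by (simp_all add: vec_eq_iff axis_def)
  qed (simp add: norm_axis_complex)
  then show ?thesis by (auto intro!: derivative_eq_intros bounded_linear_imp_has_derivative)
qed

abbreviation shift :: "'n \<Rightarrow> complex^'n \<Rightarrow> complex \<Rightarrow> complex^'n::finite" where
  "shift i w t \<equiv> \<chi> j. if j = i then t else w $ j"

lemma shift_eq: "shift i w t = w + axis i (t - w $ i)"
  by (simp add: vec_eq_iff axis_def)

lemma shift_self [simp]: "shift i w (w $ i) = w"
  by (simp add: vec_eq_iff)

lemma shift_continuous: "continuous_on UNIV (shift i w)"
proof (rule continuous_on_vec_lambda)
  fix j show "continuous_on UNIV (\<lambda>t. if j = i then t else w $ j)"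
    by (cases "j = i") (simp_all add: continuous_on_id continuous_on_const)
qed

lemma holomorphic_axis_derivative:
  fixes f :: "complex^'n::finite \<Rightarrow> complex"
  assumes "(f has_derivative (\<lambda>v. \<Sum>k\<in>UNIV. a $ k * v $ k)) (at (w + axis i s))"
  shows "((\<lambda>s. f (w + axis i s)) has_field_derivative a $ i) (at s)"
proof -
  have "((\<lambda>s. f (w + axis i s)) has_derivative (\<lambda>v. \<Sum>k\<in>UNIV. a $ k * axis i v $ k)) (at s)"
    using has_derivative_compose[OF axis_has_derivative assms] .
  moreover have "(\<lambda>v. \<Sum>k\<in>UNIV. a $ k * axis i v $ k) = (*) (a $ i)"
    by (simp add: axis_def if_distrib sum.delta cong: if_cong)
  ultimately show ?thesis by (simp add: has_field_derivative_def)
qed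

text \<open>The second form keeps the variable s near 0 while w moves, so the restrictions of f to
  parallel lines become functions on one common disc.\<close>

lemma partial_deriv_has_derivative:
  fixes f :: "complex^'n::finite \<Rightarrow> complex"
  assumes "holomorphic_several f D" "w \<in> D"
  shows "((\<lambda>t. f (shift i w t)) has_field_derivative partial_deriv i f w) (at (w $ i))"
    and "((\<lambda>s. f (w + axis i s)) has_field_derivative partial_deriv i f w) (at 0)"
proof -
  obtain a :: "complex^'n" where a: "(f has_derivative (\<lambda>v. \<Sum>k\<in>UNIV. a $ k * v $ k)) (at w)"
    using assms by (auto simp: holomorphic_several_def)
  have 0: "axis i 0 = (0 :: complex^'n)" by (simp add: vec_eq_iff axis_def)
  have d: "((\<lambda>s. f (w + axis i s)) has_field_derivative a $ i) (at 0)"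
    using a by (intro holomorphic_axis_derivative) (simp add: 0)
  have "((\<lambda>t. t - w $ i) has_field_derivative 1) (at (w $ i))"
    by (auto intro!: derivative_eq_intros)
  from DERIV_chain2[OF _ this, of "\<lambda>s. f (w + axis i s)" "a $ i"] d
  have *: "((\<lambda>t. f (shift i w t)) has_field_derivative a $ i) (at (w $ i))" by (simp add: shift_eq)
  then have "partial_deriv i f w = a $ i" unfolding partial_deriv_def by (rule DERIV_imp_deriv)
  then show "((\<lambda>t. f (shift i w t)) has_field_derivative partial_deriv i f w) (at (w $ i))"
    "((\<lambda>s. f (w + axis i s)) has_field_derivative partial_deriv i f w) (at 0)"
    using * d by simp_all
qed

lemma holomorphic_several_continuous:
  "holomorphic_several f D \<Longrightarrow> continuous_on D f"
  by (intro continuous_at_imp_continuous_on ballI)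
     (auto simp: holomorphic_several_def dest!: bspec has_derivative_continuous)

text \<open>On a common disc the restrictions of f to the lines through w' converge uniformly as w'
  tends to w. For holomorphic functions of one variable the derivatives at 0 then converge
  too.\<close>

lemma partial_deriv_continuous:
  fixes f :: "complex^'n::finite \<Rightarrow> complex"
  assumes f: "holomorphic_several f D" and D: "open D"
  shows "continuous_on D (partial_deriv i f)"
proof (rule continuous_at_imp_continuous_on, rule ballI)
  fix w assume w: "w \<in> D"
  obtain r where r: "r > 0" "cball w r \<subseteq> D" using D w open_contains_cball by blast
  \<comment> \<open>Half the radius leaves room for moving both w' and s inside the compact ball on
    which f is uniformly continuous.\<close>
  define A where "A = ball (0::complex) (r / 2)"
  have near: "w' + axis i s \<in> cball w r" if "w' \<in> ball w (r / 2)" "s \<in> A" for w' s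
  proof -
    have "dist w (w' + axis i s) \<le> dist w w' + norm s"
      using dist_triangle[of w "w' + axis i s" w'] by (simp add: dist_norm norm_axis_complex)
    then show ?thesis using that by (simp add: A_def)
  qed
  have uc: "uniformly_continuous_on (cball w r) f"
    using holomorphic_several_continuous[OF f] r(2) compact_cball
    by (intro compact_uniformly_continuous) (auto intro: continuous_on_subset)
  have "uniform_limit A (\<lambda>w' s. f (w' + axis i s)) (\<lambda>s. f (w + axis i s)) (nhds w)"
    unfolding uniform_limit_iff
  proof (intro allI impI)
    fix e :: real assume "e > 0"
    then obtain d where d: "d > 0" "\<And>x y. x \<in> cball w r \<Longrightarrow> y \<in> cball w r \<Longrightarrow> dist y x < d \<Longrightarrow> dist (f y) (f x) < e"
      using uc unfolding uniformly_continuous_on_def by metis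
    have "\<forall>\<^sub>F w' in nhds w. w' \<in> ball w (min d (r / 2))"
      using d(1) r(1) by (intro eventually_nhds_in_open) auto
    then show "\<forall>\<^sub>F w' in nhds w. \<forall>s\<in>A. dist (f (w' + axis i s)) (f (w + axis i s)) < e"
    proof eventually_elim
      case (elim w')
      then show ?case using r(1) by (auto intro!: d(2) near simp: dist_commute)
    qed
  qed
  moreover have "\<forall>\<^sub>F w' in nhds w. (\<lambda>s. f (w' + axis i s)) holomorphic_on A"
  proof -
    have "\<forall>\<^sub>F w' in nhds w. w' \<in> ball w (r / 2)" using r(1) by (intro eventually_nhds_in_open) auto
    then show ?thesis
    proof eventually_elim
      case (elim w')
      show ?case
      proof (rule holomorphic_onI)
        fix s assume "s \<in> A"
        then have "w' + axis i s \<in> D" using near[OF elim] r(2) by blast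
        then obtain a :: "complex^'n" where
          "(f has_derivative (\<lambda>v. \<Sum>k\<in>UNIV. a $ k * v $ k)) (at (w' + axis i s))"
          using f by (auto simp: holomorphic_several_def)
        from holomorphic_axis_derivative[OF this]
        show "(\<lambda>s. f (w' + axis i s)) field_differentiable at s within A"
          using field_differentiable_at_within field_differentiable_def by blast
      qed
    qed
  qed
  ultimately have "((\<lambda>w'. (deriv ^^ 1) (\<lambda>s. f (w' + axis i s)) 0) \<longlongrightarrow> (deriv ^^ 1) (\<lambda>s. f (w + axis i s)) 0) (nhds w)"
    by (rule higher_deriv_complex_uniform_limit) (use r(1) in \<open>auto simp: A_def\<close>)
  then have lim: "((\<lambda>w'. deriv (\<lambda>s. f (w' + axis i s)) 0) \<longlongrightarrow> deriv (\<lambda>s. f (w + axis i s)) 0) (nhds w)" by simp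
  have pd: "deriv (\<lambda>s. f (w' + axis i s)) 0 = partial_deriv i f w'" if "w' \<in> D" for w'
    by (rule DERIV_imp_deriv[OF partial_deriv_has_derivative(2)[OF f that]])
  have "((\<lambda>w'. partial_deriv i f w') \<longlongrightarrow> partial_deriv i f w) (nhds w)"
  proof (rule Lim_transform_eventually)
    show "\<forall>\<^sub>F w' in nhds w. deriv (\<lambda>s. f (w' + axis i s)) 0 = partial_deriv i f w'"
      using eventually_nhds_in_open[OF D w] by eventually_elim (rule pd)
  qed (use lim pd[OF w] in simp)
  then show "isCont (partial_deriv i f) w"
    unfolding isCont_def by (rule filterlim_mono[OF _ order_refl at_within_le_nhds])
qed

text \<open>The points all of whose coordinates are nonzero are dense.\<close>

lemma vanishes_if_vanishes_generically:
  fixes h :: "complex^'n::finite \<Rightarrow> complex"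
  assumes D: "open D" and h: "continuous_on D h"
    and 0: "\<And>w. w \<in> D \<Longrightarrow> (\<And>k. w $ k \<noteq> 0) \<Longrightarrow> h w = 0"
    and w: "w \<in> D"
  shows "h w = 0"
proof -
  \<comment> \<open>Approach w in the diagonal direction: coordinate k of \<open>l t\<close>
    vanishes only at t = - w $ k, and a small punctured neighbourhood of 0 avoids these finitely
    many values.\<close>
  define l where "l = (\<lambda>t::complex. w + (\<chi> k. t))"
  have l0: "l 0 = w" by (simp add: l_def vec_eq_iff)
  have "continuous_on UNIV (\<lambda>t::complex. (\<chi> k. t) :: complex^'n)"
    by (intro continuous_intros)
  then have cl: "isCont l 0" unfolding l_def
    by (intro continuous_intros) (simp add: continuous_on_eq_continuous_at)
  have lim: "(l \<longlongrightarrow> w) (at 0)" using cl by (simp add: isCont_def l0)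
  have "isCont h w" using h D w by (simp add: continuous_on_eq_continuous_at)
  then have h1: "((\<lambda>t. h (l t)) \<longlongrightarrow> h w) (at 0)"
    using lim by (rule isCont_tendsto_compose)
  have "\<forall>\<^sub>F t in at 0. l t \<in> D" using topological_tendstoD[OF lim D w] .
  moreover have "\<forall>\<^sub>F t in at 0. \<forall>k\<in>UNIV. t \<noteq> - w $ k"
    by (intro eventually_ball_finite ballI eventually_neq_at_within) simp
  ultimately have "\<forall>\<^sub>F t in at 0. h (l t) = 0"
  proof eventually_elim
    case (elim t)
    show ?case
    proof (rule 0[OF elim(1)])
      fix k show "l t $ k \<noteq> 0" using elim(2) by (simp add: l_def) (metis UNIV_I add.commute add_eq_0_iff)
    qed
  qed
  then have "((\<lambda>t. h (l t)) \<longlongrightarrow> 0) (at 0)" by (rule tendsto_eventually)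
  with h1 show ?thesis by (rule tendsto_unique[rotated]) simp
qed

section \<open>Forms on open submanifolds\<close>

lemma Omega1_zero: "(\<lambda>x. 0) \<in> Omega1 X"
  unfolding Omega1_def holomorphic_several_def
  by (auto intro!: exI[of _ 0])

lemma holomorphic_several_lin:
  fixes f g :: "complex^'n::finite \<Rightarrow> complex"
  assumes "holomorphic_several f D" "holomorphic_several g D"
  shows "holomorphic_several (\<lambda>w. c * f w + g w) D"
  unfolding holomorphic_several_def
proof
  fix w assume "w \<in> D"
  then obtain a b :: "complex^'n" where
    a: "(f has_derivative (\<lambda>v. \<Sum>i\<in>UNIV. a $ i * v $ i)) (at w)" and
    b: "(g has_derivative (\<lambda>v. \<Sum>i\<in>UNIV. b $ i * v $ i)) (at w)"
    using assms unfolding holomorphic_several_def by meson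
  have "((\<lambda>w. c * f w + g w) has_derivative (\<lambda>v. \<Sum>i\<in>UNIV. (c *s a + b) $ i * v $ i)) (at w)"
    by (rule has_derivative_eq_rhs[OF has_derivative_add[OF has_derivative_mult_right[OF a] b]])
       (simp add: sum_distrib_left sum.distrib algebra_simps fun_eq_iff)
  then show "\<exists>a::complex^'n. ((\<lambda>w. c * f w + g w) has_derivative (\<lambda>v. \<Sum>i\<in>UNIV. a $ i * v $ i)) (at w)" by blast
qed

lemma Omega1_lin:
  assumes "\<alpha> \<in> Omega1 X" "\<beta> \<in> Omega1 X"
  shows "(\<lambda>x. c * \<alpha> x + \<beta> x) \<in> Omega1 X"
proof -
  have "\<forall>S T. \<forall>w\<in>chart_dom X S. \<forall>w'. chart_inv S w = chart_inv T w' \<longrightarrow>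
      (\<forall>i. c * \<alpha> (S, w, i) + \<beta> (S, w, i) =
        (c * \<alpha> (T, w', i) + \<beta> (T, w', i)) * (if i \<in> S \<longleftrightarrow> i \<in> T then 1 else - 1 / (w $ i)\<^sup>2))"
  proof (intro allI ballI impI)
    fix S T w w' i assume *: "w \<in> chart_dom X S" "chart_inv S w = chart_inv T w'"
    then have a: "\<alpha> (S, w, i) = \<alpha> (T, w', i) * (if i \<in> S \<longleftrightarrow> i \<in> T then 1 else - 1 / (w $ i)\<^sup>2)"
      and b: "\<beta> (S, w, i) = \<beta> (T, w', i) * (if i \<in> S \<longleftrightarrow> i \<in> T then 1 else - 1 / (w $ i)\<^sup>2)"
      using assms unfolding Omega1_def by blast+
    show "c * \<alpha> (S, w, i) + \<beta> (S, w, i) =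
        (c * \<alpha> (T, w', i) + \<beta> (T, w', i)) * (if i \<in> S \<longleftrightarrow> i \<in> T then 1 else - 1 / (w $ i)\<^sup>2)"
      unfolding a b by (simp only: distrib_right mult.assoc)
  qed
  then show ?thesis
    using assms unfolding Omega1_def by (simp add: holomorphic_several_lin)
qed

lemma Omega1_holomorphic: "\<alpha> \<in> Omega1 X \<Longrightarrow> holomorphic_several (\<lambda>w. \<alpha> (S, w, i)) (chart_dom X S)"
  by (simp add: Omega1_def)

lemma Omega1_outside: "\<alpha> \<in> Omega1 X \<Longrightarrow> w \<notin> chart_dom X S \<Longrightarrow> \<alpha> (S, w, i) = 0"
  by (simp add: Omega1_def)

lemma Omega1_sum:
  assumes "\<And>s. s \<in> I \<Longrightarrow> \<alpha> s \<in> Omega1 X"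
  shows "(\<lambda>x. \<Sum>s\<in>I. c s * \<alpha> s x) \<in> Omega1 X"
  using assms
  by (induction I rule: infinite_finite_induct) (simp_all add: Omega1_zero Omega1_lin)

lemma partial_deriv_lin:
  assumes "holomorphic_several f D" "holomorphic_several g D" "w \<in> D"
  shows "partial_deriv i (\<lambda>u. c * f u + g u) w = c * partial_deriv i f w + partial_deriv i g w"
proof -
  have "((\<lambda>t. c * f (shift i w t) + g (shift i w t)) has_field_derivative
      c * partial_deriv i f w + partial_deriv i g w) (at (w $ i))"
    by (intro DERIV_add DERIV_cmult partial_deriv_has_derivative assms)
       (use assms partial_deriv_has_derivative in blast)+
  then show ?thesis unfolding partial_deriv_def[of i "\<lambda>u. c * f u + g u"] by (rule DERIV_imp_deriv)
qed

lemma ext_d_lin: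
  assumes "\<alpha> \<in> Omega1 X" "\<beta> \<in> Omega1 X"
  shows "ext_d X (\<lambda>x. c * \<alpha> x + \<beta> x) y = c * ext_d X \<alpha> y + ext_d X \<beta> y"
  using partial_deriv_lin[OF Omega1_holomorphic[OF assms(1)] Omega1_holomorphic[OF assms(2)]]
  by (cases y) (simp add: ext_d_def algebra_simps)

lemma ext_d_zero: "ext_d X (\<lambda>x. 0) y = 0"
  by (cases y) (simp add: ext_d_def partial_deriv_def)

lemma ext_d_sum:
  assumes "\<And>s. s \<in> I \<Longrightarrow> \<alpha> s \<in> Omega1 X"
  shows "ext_d X (\<lambda>x. \<Sum>s\<in>I. c s * \<alpha> s x) y = (\<Sum>s\<in>I. c s * ext_d X (\<alpha> s) y)"
  using assms
  by (induction I rule: infinite_finite_induct) (simp_all add: ext_d_zero ext_d_lin Omega1_sum)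

section \<open>Change from an arbitrary chart to the affine chart\<close>

definition swap_coords :: "'n set \<Rightarrow> complex^'n \<Rightarrow> complex^'n::finite" where
  "swap_coords S w = (\<chi> k. if k \<in> S then 1 / w $ k else w $ k)"

text \<open>The change of charts acts on each coordinate separately, so its Jacobian matrix is
  diagonal; this is the i-th entry.\<close>

definition jacobian :: "'n set \<Rightarrow> 'n \<Rightarrow> complex \<Rightarrow> complex" where
  "jacobian S i t = (if i \<in> S then - 1 / t\<^sup>2 else 1)"

lemma chart_inv_swap_coords:
  "(\<And>k. w $ k \<noteq> 0) \<Longrightarrow> chart_inv S w = chart_inv {} (swap_coords S w)"
  by (auto simp: chart_inv_def swap_coords_def)

lemma swap_coords_chart_dom:
  "(\<And>k. w $ k \<noteq> 0) \<Longrightarrow> w \<in> chart_dom X S \<Longrightarrow> swap_coords S w \<in> chart_dom X {}"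
  by (simp add: chart_dom_def chart_inv_swap_coords[symmetric])

lemma Omega1_swap_coords:
  assumes \<alpha>: "\<alpha> \<in> Omega1 X" and w: "w \<in> chart_dom X S" and nz: "\<And>k. w $ k \<noteq> 0"
  shows "\<alpha> (S, w, i) = \<alpha> ({}, swap_coords S w, i) * jacobian S i (w $ i)"
proof -
  have "\<forall>i. \<alpha> (S, w, i) = \<alpha> ({}, swap_coords S w, i) * (if i \<in> S \<longleftrightarrow> i \<in> {} then 1 else - 1 / (w $ i)\<^sup>2)"
    using \<alpha> w chart_inv_swap_coords[of w S, OF nz] unfolding Omega1_def by blast
  then show ?thesis by (simp add: jacobian_def)
qed

text \<open>The affine chart covers the points with nonzero coordinates of every other chart, so
  continuity leaves a form no freedom outside of it.\<close>

lemma Omega1_eq_zero: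
  assumes X: "open_submanifold X" and \<alpha>: "\<alpha> \<in> Omega1 X"
    and 0: "\<And>z i. z \<in> chart_dom X {} \<Longrightarrow> \<alpha> ({}, z, i) = 0"
  shows "\<alpha> x = 0"
proof -
  obtain S w i where x: "x = (S, w, i)" by (cases x)
  show ?thesis
  proof (cases "w \<in> chart_dom X S")
    case True
    show ?thesis unfolding x
    proof (rule vanishes_if_vanishes_generically[where D="chart_dom X S" and h="\<lambda>w. \<alpha> (S, w, i)"])
      show "open (chart_dom X S)" using X by (simp add: open_submanifold_def)
      show "continuous_on (chart_dom X S) (\<lambda>w. \<alpha> (S, w, i))"
        by (rule holomorphic_several_continuous[OF Omega1_holomorphic[OF \<alpha>]])
      fix w assume w: "w \<in> chart_dom X S" "\<And>k. w $ k \<noteq> 0"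
      then show "\<alpha> (S, w, i) = 0"
        using Omega1_swap_coords[OF \<alpha> w] 0[OF swap_coords_chart_dom[OF w(2,1)]] by simp
    qed (rule True)
  qed (simp add: x Omega1_outside[OF \<alpha>])
qed

text \<open>This is d commuting with pullback. Since i and j differ, the factor
  \<open>jacobian S j\<close> is constant along coordinate i and contributes no derivative.\<close>

lemma ext_d_swap_coords:
  assumes X: "open_submanifold X" and \<alpha>: "\<alpha> \<in> Omega1 X"
    and w: "w \<in> chart_dom X S" and nz: "\<And>k. w $ k \<noteq> 0" and ij: "i \<noteq> j"
  shows "partial_deriv i (\<lambda>u. \<alpha> (S, u, j)) w =
    partial_deriv i (\<lambda>u. \<alpha> ({}, u, j)) (swap_coords S w) * jacobian S i (w $ i) * jacobian S j (w $ j)"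
proof -
  define \<iota> where "\<iota> = (\<lambda>t::complex. if i \<in> S then 1 / t else t)"
  define z where "z = swap_coords S w"
  have z: "z \<in> chart_dom X {}" using swap_coords_chart_dom[OF nz w] by (simp add: z_def)
  have zi: "z $ i = \<iota> (w $ i)" by (simp add: z_def swap_coords_def \<iota>_def)
  have \<iota>: "(\<iota> has_field_derivative jacobian S i (w $ i)) (at (w $ i))"
    using nz[of i] by (auto simp: \<iota>_def jacobian_def power2_eq_square intro!: derivative_eq_intros)
  have sw: "swap_coords S (shift i w t) = shift i z (\<iota> t)" for t
    by (simp add: vec_eq_iff swap_coords_def z_def \<iota>_def)
  have "((\<lambda>t. \<alpha> ({}, shift i z (\<iota> t), j)) has_field_derivative
      partial_deriv i (\<lambda>u. \<alpha> ({}, u, j)) z * jacobian S i (w $ i)) (at (w $ i))"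
    using DERIV_chain2[OF _ \<iota>] partial_deriv_has_derivative(1)[OF Omega1_holomorphic[OF \<alpha>] z, of i j]
    by (simp add: zi)
  then have d: "((\<lambda>t. \<alpha> ({}, shift i z (\<iota> t), j) * jacobian S j (w $ j)) has_field_derivative
      partial_deriv i (\<lambda>u. \<alpha> ({}, u, j)) z * jacobian S i (w $ i) * jacobian S j (w $ j)) (at (w $ i))"
    by (rule DERIV_cmult_right)
  \<comment> \<open>The transformation rule is available where the shifted point stays in the domain
    and t is nonzero; this is a neighbourhood of w $ i, which suffices for the derivative.\<close>
  have "open (shift i w -` chart_dom X S \<inter> - {0})"
    using X shift_continuous[of i w] by (intro open_Int open_vimage) (auto simp: open_submanifold_def)
  moreover have "w $ i \<in> shift i w -` chart_dom X S \<inter> - {0}" using w nz by simp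
  ultimately have "\<forall>\<^sub>F t in nhds (w $ i). t \<in> shift i w -` chart_dom X S \<inter> - {0}"
    by (rule eventually_nhds_in_open)
  then have "\<forall>\<^sub>F t in nhds (w $ i). \<alpha> (S, shift i w t, j) = \<alpha> ({}, shift i z (\<iota> t), j) * jacobian S j (w $ j)"
  proof eventually_elim
    case (elim t)
    have "shift i w t \<in> chart_dom X S" "\<And>k. shift i w t $ k \<noteq> 0" using elim nz by auto
    from Omega1_swap_coords[OF \<alpha> this, of j] show ?case using ij by (simp add: sw)
  qed
  from DERIV_cong_ev[OF refl this refl, THEN iffD2, OF d]
  show ?thesis unfolding partial_deriv_def[of i "\<lambda>u. \<alpha> (S, u, j)"] z_def[symmetric] by (rule DERIV_imp_deriv)
qed

lemma ext_d_eq_zero: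
  assumes X: "open_submanifold X" and \<alpha>: "\<alpha> \<in> Omega1 X"
    and 0: "\<And>z i j. z \<in> chart_dom X {} \<Longrightarrow> i \<noteq> j \<Longrightarrow>
      partial_deriv i (\<lambda>u. \<alpha> ({}, u, j)) z = partial_deriv j (\<lambda>u. \<alpha> ({}, u, i)) z"
  shows "ext_d X \<alpha> y = 0"
proof -
  obtain S w i j where y: "y = (S, w, i, j)" by (cases y)
  show ?thesis
  proof (cases "w \<in> chart_dom X S \<and> i \<noteq> j")
    case True
    then have ij: "i \<noteq> j" by simp
    have "partial_deriv i (\<lambda>u. \<alpha> (S, u, j)) w - partial_deriv j (\<lambda>u. \<alpha> (S, u, i)) w = 0"
    proof (rule vanishes_if_vanishes_generically[where D="chart_dom X S" and
          h="\<lambda>w. partial_deriv i (\<lambda>u. \<alpha> (S, u, j)) w - partial_deriv j (\<lambda>u. \<alpha> (S, u, i)) w"])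
      show op: "open (chart_dom X S)" using X by (simp add: open_submanifold_def)
      show "continuous_on (chart_dom X S)
          (\<lambda>w. partial_deriv i (\<lambda>u. \<alpha> (S, u, j)) w - partial_deriv j (\<lambda>u. \<alpha> (S, u, i)) w)"
        by (intro continuous_on_diff partial_deriv_continuous Omega1_holomorphic \<alpha> op)
      fix w assume w: "w \<in> chart_dom X S" "\<And>k. w $ k \<noteq> 0"
      show "partial_deriv i (\<lambda>u. \<alpha> (S, u, j)) w - partial_deriv j (\<lambda>u. \<alpha> (S, u, i)) w = 0"
        using ext_d_swap_coords[OF X \<alpha> w ij] ext_d_swap_coords[OF X \<alpha> w ij[symmetric]]
          0[OF swap_coords_chart_dom[OF w(2,1)] ij] by (simp add: mult_ac)
    qed (use True in simp)
    then show ?thesis by (simp add: y ext_d_def)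
  qed (auto simp: y ext_d_def)
qed

section \<open>Configurations\<close>

lemma chart_inv_proj:
  "chart_inv S w i = proj (if i \<in> S then 1 else w $ i) (if i \<in> S then w $ i else 1)"
  by (simp add: chart_inv_def proj_def)

context finite_psu2
begin

text \<open>In homogeneous coordinates each condition excludes the locus where two continuous
  functions agree, also at infinity, and finiteness of G and of the special points leaves finitely
  many conditions.\<close>

lemma open_submanifold_Cf: "open_submanifold (Cf G :: ('n::finite \<Rightarrow> CP1) set)"
  unfolding open_submanifold_def
proof
  fix S :: "'n set"
  define x where "x = (\<lambda>i (w::complex^'n). if i \<in> S then 1 else w $ i)"
  define y where "y = (\<lambda>i (w::complex^'n). if i \<in> S then w $ i else 1)"
  have nz: "x i w \<noteq> 0 \<or> y i w \<noteq> 0" for i w by (simp add: x_def y_def)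
  have c: "chart_inv S w i = proj (x i w) (y i w)" for w i by (simp add: chart_inv_proj x_def y_def)
  have cont: "continuous_on UNIV (x i)" "continuous_on UNIV (y i)" for i
    by (cases "i \<in> S"; simp add: x_def y_def continuous_on_component continuous_on_id)+
  have special: "proj (x i w) (y i w) = q \<longleftrightarrow> hx q * y i w = x i w * hy q" for q i w
    by (subst eq_commute) (rule eq_proj_iff[OF nz])
  have act: "proj (x i w) (y i w) = act g (proj (x j w) (y j w)) \<longleftrightarrow>
      x i w * (rep g $2$1 * x j w + rep g $2$2 * y j w) = (rep g $1$1 * x j w + rep g $1$2 * y j w) * y i w"
    if "g \<in> G" for i j w g
    unfolding act_rep[OF G_carrier[OF that]] homography_proj[OF nz]
    by (rule proj_eq_iff[OF nz matrix2_nonzero[OF SU2_entries(3)[OF rep(1)[OF G_carrier[OF that]]] nz]])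
  have A: "proj (x i w) (y i w) \<notin> special_points G \<longleftrightarrow> (\<forall>q\<in>special_points G. hx q * y i w \<noteq> x i w * hy q)" for i w
    unfolding special[symmetric] by blast
  have B: "(\<forall>g\<in>G. proj (x i w) (y i w) \<noteq> act g (proj (x j w) (y j w))) \<longleftrightarrow>
      (\<forall>g\<in>G. x i w * (rep g $2$1 * x j w + rep g $2$2 * y j w) \<noteq> (rep g $1$1 * x j w + rep g $1$2 * y j w) * y i w)"
    for i j w
    by (intro ball_cong refl) (simp only: act)
  have "chart_dom (Cf G) S =
    (\<Inter>i. \<Inter>q\<in>special_points G. {w. hx q * y i w \<noteq> x i w * hy q}) \<inter>
    (\<Inter>i. \<Inter>j\<in>{j. i \<noteq> j}. \<Inter>g\<in>G. {w. x i w * (rep g $2$1 * x j w + rep g $2$2 * y j w) \<noteq>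
        (rep g $1$1 * x j w + rep g $1$2 * y j w) * y i w})"
    unfolding chart_dom_def Cf_iff c A B by blast
  also have "open \<dots>"
    by (intro open_Int open_INT ballI finite_special finite_G finite open_Collect_neq
        continuous_intros cont)
  finally show "open (chart_dom (Cf G) S)" .
qed

section \<open>Closedness of the form on the affine chart\<close>

lemma dlog_act_has_derivative:
  assumes g: "g \<in> G" and u: "Fin u \<noteq> act g (Fin v)"
  shows "((\<lambda>t. dlog u (act g (Fin t))) has_field_derivative 1 / (mdenom (rep g) u v)\<^sup>2) (at v)"
proof -
  note gc = G_carrier[OF g]
  define a b c d where abcd: "a = rep g $1$1" "b = rep g $1$2" "c = rep g $2$1" "d = rep g $2$2"
  have D: "a * d - b * c = 1" using SU2_entries(3)[OF rep(1)[OF gc]] by (simp add: abcd)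
  have N: "mdenom (rep g) u t = u * (c * t + d) - (a * t + b)" for t by (simp add: mdenom_def abcd)
  have nz: "u * (c * v + d) - (a * v + b) \<noteq> 0"
    using mdenom_nonzero[OF rep(1)[OF gc] u[unfolded act_rep[OF gc]]] by (simp add: N)
  \<comment> \<open>The numerator in the quotient rule is the determinant. The derivative is
    therefore the reciprocal of a square, insensitive to the sign of \<open>rep g\<close>.\<close>
  have "c * (u * (c * v + d) - (a * v + b)) - (c * v + d) * (u * c - a) = a * d - b * c"
    by (simp add: algebra_simps)
  then have e: "c * (u * (c * v + d) - (a * v + b)) - (c * v + d) * (u * c - a) = 1" by (simp add: D)
  have "((\<lambda>t. (c * t + d) / (u * (c * t + d) - (a * t + b))) has_field_derivative
      (c * (u * (c * v + d) - (a * v + b)) - (c * v + d) * (u * c - a)) /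
      ((u * (c * v + d) - (a * v + b)) * (u * (c * v + d) - (a * v + b)))) (at v)"
    by (rule DERIV_divide[where f="\<lambda>t. c * t + d" and g="\<lambda>t. u * (c * t + d) - (a * t + b)"])
       (auto intro!: derivative_eq_intros simp: nz[simplified])
  then show ?thesis
    unfolding act_rep[OF gc] dlog_homography N abcd(3,4)[symmetric] e by (simp add: power2_eq_square)
qed

text \<open>The representative of the inverse is the adjugate only up to sign, and exchanging the
  variables brings another sign; the square removes both.\<close>

lemma mdenom_inv:
  assumes "g \<in> G"
  shows "(mdenom (rep (inv\<^bsub>PSU2\<^esub> g)) u v)\<^sup>2 = (mdenom (rep g) v u)\<^sup>2"
proof -
  note gc = G_carrier[OF assms]
  have "cls (rep (inv\<^bsub>PSU2\<^esub> g)) = cls (adj2 (rep g))"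
    using rep(2)[OF G_carrier[OF G_inv[OF assms]]] PSU2_inv[OF rep(1)[OF gc]] rep(2)[OF gc] by simp
  then consider "rep (inv\<^bsub>PSU2\<^esub> g) = adj2 (rep g)" | "rep (inv\<^bsub>PSU2\<^esub> g) = - adj2 (rep g)"
    using cls_eqD by blast
  then show ?thesis
    by cases (simp_all add: mdenom_def power2_eq_square algebra_simps)
qed

text \<open>The terms at special points depend on one variable each. In the mixed derivatives only
  the sums over G remain, and inversion in G exchanges them.\<close>

lemma affine_form_closed:
  fixes \<alpha> :: "'n::finite idx1 \<Rightarrow> complex"
  assumes \<alpha>: "\<And>z i. z \<in> chart_dom (Cf G) {} \<Longrightarrow> \<alpha> ({}, z, i) =
      (\<Sum>p\<in>special_points G. dlog (z $ i) p * a i p) +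
      (\<Sum>j\<in>UNIV - {i}. \<Sum>g\<in>G. dlog (z $ i) (act g (Fin (z $ j))) * c i j g)"
    and c: "\<And>i j g. i \<noteq> j \<Longrightarrow> g \<in> G \<Longrightarrow> c i j g = c j i (inv\<^bsub>PSU2\<^esub> g)"
    and z: "z \<in> chart_dom (Cf G) {}" and ij: "i \<noteq> j"
  shows "partial_deriv i (\<lambda>u. \<alpha> ({}, u, j)) z = partial_deriv j (\<lambda>u. \<alpha> ({}, u, i)) z"
proof -
  have op: "open (chart_dom (Cf G) {} :: (complex^'n) set)"
    using open_submanifold_Cf[where 'n='n] unfolding open_submanifold_def by blast
  have pd: "partial_deriv i (\<lambda>u. \<alpha> ({}, u, j)) z = (\<Sum>g\<in>G. c j i g / (mdenom (rep g) (z $ j) (z $ i))\<^sup>2)"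
    if ij: "i \<noteq> j" for i j
  proof -
    have ne: "Fin (z $ j) \<noteq> act g (Fin (z $ i))" if "g \<in> G" for g
      using z ij that by (auto simp: chart_dom_def Cf_iff chart_inv_def)
    define I where "I = UNIV - {j, i}"
    have I: "UNIV - {j} = insert i I" "i \<notin> I" using ij by (auto simp: I_def)
    \<comment> \<open>K gathers everything independent of z_i, so only the translates of z_i are
      differentiated.\<close>
    define K where "K = (\<Sum>p\<in>special_points G. dlog (z $ j) p * a j p) +
      (\<Sum>k\<in>I. \<Sum>g\<in>G. dlog (z $ j) (act g (Fin (z $ k))) * c j k g)"
    have "open (shift i z -` chart_dom (Cf G) {})" using op shift_continuous[of i z] by (intro open_vimage)
    then have "\<forall>\<^sub>F t in nhds (z $ i). t \<in> shift i z -` chart_dom (Cf G) {}"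
      using z by (intro eventually_nhds_in_open) auto
    then have ev: "\<forall>\<^sub>F t in nhds (z $ i). \<alpha> ({}, shift i z t, j) =
        K + (\<Sum>g\<in>G. dlog (z $ j) (act g (Fin t)) * c j i g)"
    proof eventually_elim
      case (elim t)
      have k: "shift i z t $ k = z $ k" if "k \<in> I" for k using that by (auto simp: I_def)
      have "(\<Sum>k\<in>I. \<Sum>g\<in>G. dlog (z $ j) (act g (Fin (shift i z t $ k))) * c j k g) =
          (\<Sum>k\<in>I. \<Sum>g\<in>G. dlog (z $ j) (act g (Fin (z $ k))) * c j k g)"
        by (intro sum.cong refl) (simp only: k)
      then show ?case
        using \<alpha>[of "shift i z t" j] elim ij unfolding I(1) by (simp add: I(2) K_def)
    qed
    have "((\<lambda>t. K + (\<Sum>g\<in>G. dlog (z $ j) (act g (Fin t)) * c j i g)) has_field_derivative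
        0 + (\<Sum>g\<in>G. 1 / (mdenom (rep g) (z $ j) (z $ i))\<^sup>2 * c j i g)) (at (z $ i))"
      by (intro DERIV_add DERIV_const DERIV_sum DERIV_cmult_right dlog_act_has_derivative ne)
    from DERIV_cong_ev[OF refl ev refl, THEN iffD2, OF this]
    show ?thesis unfolding partial_deriv_def by (simp add: DERIV_imp_deriv)
  qed
  have "(\<Sum>g\<in>G. c j i g / (mdenom (rep g) (z $ j) (z $ i))\<^sup>2) =
      (\<Sum>g\<in>G. c j i (inv\<^bsub>PSU2\<^esub> g) / (mdenom (rep (inv\<^bsub>PSU2\<^esub> g)) (z $ j) (z $ i))\<^sup>2)"
    by (rule sum_inv[symmetric])
  also have "\<dots> = (\<Sum>g\<in>G. c i j g / (mdenom (rep g) (z $ i) (z $ j))\<^sup>2)"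
    using ij by (intro sum.cong) (auto simp: mdenom_inv c[of i j])
  finally show ?thesis using ij by (simp add: pd)
qed

end

section \<open>The connection form\<close>

context pn_algebra
begin

lemma zero_mult [simp]:
  assumes "x \<in> carrier U"
  shows "\<zero>\<^bsub>U\<^esub> \<otimes>\<^bsub>U\<^esub> x = \<zero>\<^bsub>U\<^esub>" "x \<otimes>\<^bsub>U\<^esub> \<zero>\<^bsub>U\<^esub> = \<zero>\<^bsub>U\<^esub>"
proof -
  have "\<phi> (\<zero>\<^bsub>U\<^esub> \<otimes>\<^bsub>U\<^esub> x) = 0" "\<phi> (x \<otimes>\<^bsub>U\<^esub> \<zero>\<^bsub>U\<^esub>) = 0" if \<phi>: "functional U \<phi>" for \<phi>
  proof -
    have "functional U (\<lambda>y. \<phi> (y \<otimes>\<^bsub>U\<^esub> x))" "functional U (\<lambda>y. \<phi> (x \<otimes>\<^bsub>U\<^esub> y))"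
      unfolding functional_def using assms
      by (simp_all add: U.distrib_left U.distrib_right U.mult_smult_left U.mult_smult_right
          U.functional_add[OF \<phi>] U.functional_smult[OF \<phi>] U.mult_closed)
    then show "\<phi> (\<zero>\<^bsub>U\<^esub> \<otimes>\<^bsub>U\<^esub> x) = 0" "\<phi> (x \<otimes>\<^bsub>U\<^esub> \<zero>\<^bsub>U\<^esub>) = 0"
      by (auto dest: U.functional_zero)
  qed
  then show "\<zero>\<^bsub>U\<^esub> \<otimes>\<^bsub>U\<^esub> x = \<zero>\<^bsub>U\<^esub>" "x \<otimes>\<^bsub>U\<^esub> \<zero>\<^bsub>U\<^esub> = \<zero>\<^bsub>U\<^esub>"
    using assms by (auto intro!: U.separated U.mult_closed)
qed

section \<open>Forms with values in the enveloping algebra, tested by functionals\<close>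

lemma tensor_sum_closed:
  "(\<And>s. s < m \<Longrightarrow> a s \<in> homog U k) \<Longrightarrow> tensor_sum U m \<alpha> a x \<in> carrier U"
  unfolding tensor_sum_def using U.homog_carrier
  by (intro U.finsum_closed Pi_I U.smult_closed) blast

lemma functional_tensor_sum:
  assumes "functional U F" "\<And>s. s < m \<Longrightarrow> a s \<in> homog U k"
  shows "F (tensor_sum U m \<alpha> a x) = (\<Sum>s<m. F (a s) * \<alpha> s x)"
proof -
  have c: "a s \<in> carrier U" if "s < m" for s using assms(2)[OF that] U.homog_carrier by blast
  have "F (tensor_sum U m \<alpha> a x) = (\<Sum>s<m. F (\<alpha> s x \<odot>\<^bsub>U\<^esub> a s))"
    unfolding tensor_sum_def by (intro U.functional_finsum[OF assms(1)] U.smult_closed c) auto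
  also have "\<dots> = (\<Sum>s<m. F (a s) * \<alpha> s x)"
    by (intro sum.cong refl) (simp add: U.functional_smult[OF assms(1)] c)
  finally show ?thesis .
qed

lemma tensor_space_closed: "\<eta> \<in> tensor_space \<Omega> U k \<Longrightarrow> \<eta> x \<in> carrier U"
  unfolding tensor_space_def by (auto intro!: tensor_sum_closed)

lemma functional_Omega1:
  assumes "functional U F" "\<eta> \<in> tensor_space (Omega1 X) U k"
  shows "(\<lambda>x. F (\<eta> x)) \<in> Omega1 X"
proof -
  obtain m \<alpha> a where *: "\<eta> = tensor_sum U m \<alpha> a" "\<And>s. s < m \<Longrightarrow> \<alpha> s \<in> Omega1 X \<and> a s \<in> homog U k"
    using assms(2) by (auto simp: tensor_space_def)
  have "(\<lambda>x. F (\<eta> x)) = (\<lambda>x. \<Sum>s<m. F (a s) * \<alpha> s x)"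
    unfolding *(1) using *(2) by (intro ext functional_tensor_sum[OF assms(1), where k=k]) auto
  moreover have "(\<lambda>x. \<Sum>s<m. F (a s) * \<alpha> s x) \<in> Omega1 X"
    using *(2) by (intro Omega1_sum) auto
  ultimately show ?thesis by simp
qed

text \<open>\<open>tensor_map\<close> is a definite description over the decompositions of \<eta>.
  Functionals show that every decomposition yields 0, which provides existence and uniqueness at
  once.\<close>

lemma tensor_map_ext_d_eq_zero:
  assumes \<eta>: "\<eta> \<in> tensor_space (Omega1 X) U k"
    and 0: "\<And>F y. functional U F \<Longrightarrow> ext_d X (\<lambda>x. F (\<eta> x)) y = 0"
  shows "tensor_map (Omega1 X) U k (ext_d X) \<eta> = (\<lambda>y. \<zero>\<^bsub>U\<^esub>)"
proof -
  have eq: "tensor_sum U m (\<lambda>s. ext_d X (\<alpha> s)) a = (\<lambda>y. \<zero>\<^bsub>U\<^esub>)"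
    if *: "\<forall>s<m. \<alpha> s \<in> Omega1 X \<and> a s \<in> homog U k" and \<eta>: "\<eta> = tensor_sum U m \<alpha> a" for m \<alpha> a
  proof
    fix y
    show "tensor_sum U m (\<lambda>s. ext_d X (\<alpha> s)) a y = \<zero>\<^bsub>U\<^esub>"
    proof (rule U.separated)
      show "tensor_sum U m (\<lambda>s. ext_d X (\<alpha> s)) a y \<in> carrier U" using * by (auto intro!: tensor_sum_closed)
      fix F assume F: "functional U F"
      have "F (tensor_sum U m (\<lambda>s. ext_d X (\<alpha> s)) a y) = (\<Sum>s<m. F (a s) * ext_d X (\<alpha> s) y)"
        using * by (intro functional_tensor_sum[OF F]) auto
      also have "\<dots> = ext_d X (\<lambda>x. \<Sum>s<m. F (a s) * \<alpha> s x) y"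
        using * by (intro ext_d_sum[symmetric]) auto
      also have "(\<lambda>x. \<Sum>s<m. F (a s) * \<alpha> s x) = (\<lambda>x. F (\<eta> x))"
        unfolding \<eta> using * by (subst functional_tensor_sum[OF F]) auto
      finally show "F (tensor_sum U m (\<lambda>s. ext_d X (\<alpha> s)) a y) = 0" using 0[OF F] by simp
    qed
  qed
  obtain m \<alpha> a where *: "\<forall>s<m. \<alpha> s \<in> Omega1 X \<and> a s \<in> homog U k" "\<eta> = tensor_sum U m \<alpha> a"
    using \<eta> by (auto simp: tensor_space_def)
  show ?thesis
    unfolding tensor_map_def
  proof (rule the_equality)
    show "\<exists>m \<alpha> a. (\<forall>s<m. \<alpha> s \<in> Omega1 X \<and> a s \<in> homog U k) \<and> \<eta> = tensor_sum U m \<alpha> a \<and>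
        (\<lambda>y. \<zero>\<^bsub>U\<^esub>) = tensor_sum U m (\<lambda>s. ext_d X (\<alpha> s)) a"
      using * eq[OF *] by metis
  qed (use eq in blast)
qed

lemma affine_chart: "z \<in> chart_dom (Cf G) {} \<longleftrightarrow> (\<lambda>k. Fin (z $ k)) \<in> Cf G"
  by (simp add: chart_dom_def chart_inv_def)

section \<open>The two equations for the connection form\<close>

context
  fixes \<omega> :: "nat \<Rightarrow> 'n idx1 \<Rightarrow> 'n upn"
  assumes forms: "\<omega> \<in> completed_forms (Omega1 (Cf G)) U"
    and affine: "\<And>k z i. z \<in> chart_dom (Cf G) {} \<Longrightarrow>
           \<omega> k ({}, z, i) = (if k = 1 then affine_coeff G z i else \<zero>\<^bsub>U\<^esub>)"
begin

lemma \<omega>_space: "\<omega> k \<in> tensor_space (Omega1 (Cf G)) U k"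
  using forms by (simp add: completed_forms_def)

lemma \<omega>_closed: "\<omega> k x \<in> carrier U"
  by (rule tensor_space_closed[OF \<omega>_space])

lemma functional_\<omega>: "functional U F \<Longrightarrow> (\<lambda>x. F (\<omega> k x)) \<in> Omega1 (Cf G)"
  by (rule functional_Omega1[OF _ \<omega>_space])

lemma \<omega>_degree: "k \<noteq> 1 \<Longrightarrow> \<omega> k x = \<zero>\<^bsub>U\<^esub>"
proof (rule U.separated[OF \<omega>_closed])
  fix F assume F: "functional U F" and k: "k \<noteq> 1"
  show "F (\<omega> k x) = 0"
  proof (rule Omega1_eq_zero[OF open_submanifold_Cf functional_\<omega>[OF F]])
    fix z :: "complex^'n" and i :: 'n assume "z \<in> chart_dom (Cf G) {}"
    from affine[OF this, of k i] show "F (\<omega> k ({}, z, i)) = 0"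
      unfolding if_not_P[OF k] by (simp only: U.functional_zero[OF F])
  qed
qed

lemma d_\<omega>: "d_completed (Cf G) U \<omega> = zero_form U"
proof
  fix k
  have "ext_d (Cf G) (\<lambda>x. F (\<omega> k x)) y = 0" if F: "functional U F" for F y
  proof (cases "k = 1")
    case False
    then show ?thesis by (simp add: \<omega>_degree U.functional_zero[OF F] ext_d_zero)
  next
    case True
    show ?thesis
    proof (rule ext_d_eq_zero[OF open_submanifold_Cf functional_\<omega>[OF F]])
      fix z :: "complex^'n" and i j :: 'n assume z: "z \<in> chart_dom (Cf G) {}" and ij: "i \<noteq> j"
      show "partial_deriv i (\<lambda>u. F (\<omega> k ({}, u, j))) z = partial_deriv j (\<lambda>u. F (\<omega> k ({}, u, i))) z"
      proof (rule affine_form_closed[OF _ _ z ij, where \<alpha>="\<lambda>x. F (\<omega> k x)"])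
        fix z :: "complex^'n" and i :: 'n assume "z \<in> chart_dom (Cf G) {}"
        then show "F (\<omega> k ({}, z, i)) = (\<Sum>p\<in>special_points G. dlog (z $ i) p * F (Ugen G (Xi i p))) +
            (\<Sum>j\<in>UNIV - {i}. \<Sum>g\<in>G. dlog (z $ i) (act g (Fin (z $ j))) * F (Ugen G (Xij i j g)))"
          unfolding True affine[OF \<open>z \<in> chart_dom (Cf G) {}\<close>] by (simp add: functional_affine_coeff[OF F])
      next
        fix i j :: 'n and g assume "i \<noteq> j" "g \<in> G"
        then show "F (Ugen G (Xij i j g)) = F (Ugen G (Xij j i (inv\<^bsub>PSU2\<^esub> g)))"
          using functional_\<rho>_diff[OF F X2_carrier X2_carrier, of i j g j i "inv\<^bsub>PSU2\<^esub> g"]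
            \<rho>_relator[OF pn_relatorsI(1)[of i j g]] U.functional_zero[OF F]
          by (simp add: Ugen_X2)
      qed
    qed
  qed
  from tensor_map_ext_d_eq_zero[OF \<omega>_space this]
  show "d_completed (Cf G) U \<omega> k = zero_form U k" by (simp add: d_completed_def zero_form_def)
qed

lemma comm_\<omega>:
  assumes \<phi>: "functional U \<phi>"
  shows "U.comm \<phi> (\<omega> 1 (S, w, i)) (\<omega> 1 (S, w, j)) = 0"
proof -
  \<comment> \<open>The algebra carries no topology, so continuity is obtained from a decomposition
    of \<open>\<omega> 1\<close>: the functional of the commutator becomes a quadratic polynomial in
    finitely many scalar coefficients, with constants
    \<open>U.comm \<phi> (a s) (a t)\<close>.\<close>
  obtain m \<alpha> a where *: "\<omega> 1 = tensor_sum U m \<alpha> a"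
    "\<And>s. s < m \<Longrightarrow> \<alpha> s \<in> Omega1 (Cf G)" "\<And>s. s < m \<Longrightarrow> a s \<in> homog U 1"
    using \<omega>_space[of 1] by (auto simp: tensor_space_def)
  have c: "a s \<in> carrier U" if "s < m" for s using *(3)[OF that] U.homog_carrier by blast
  have e: "U.comm \<phi> (\<omega> 1 x) (\<omega> 1 y) = (\<Sum>s<m. \<Sum>t<m. U.comm \<phi> (a s) (a t) * \<alpha> t y * \<alpha> s x)" for x y
  proof -
    have "U.comm \<phi> (\<omega> 1 x) (\<omega> 1 y) = U.comm \<phi> (tensor_sum U m \<alpha> a x) (\<omega> 1 y)" by (simp only: *(1))
    also have "\<dots> = (\<Sum>s<m. U.comm \<phi> (a s) (\<omega> 1 y) * \<alpha> s x)"
      by (rule functional_tensor_sum[OF U.functional_comm_left[OF \<phi> \<omega>_closed] *(3)])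
    also have "\<dots> = (\<Sum>s<m. (\<Sum>t<m. U.comm \<phi> (a s) (a t) * \<alpha> t y) * \<alpha> s x)"
    proof (rule sum.cong[OF refl])
      fix s assume "s \<in> {..<m}"
      then have "functional U (U.comm \<phi> (a s))" using U.functional_comm_right[OF \<phi> c] by simp
      then have "U.comm \<phi> (a s) (tensor_sum U m \<alpha> a y) = (\<Sum>t<m. U.comm \<phi> (a s) (a t) * \<alpha> t y)"
        by (rule functional_tensor_sum[OF _ *(3)])
      then show "U.comm \<phi> (a s) (\<omega> 1 y) * \<alpha> s x = (\<Sum>t<m. U.comm \<phi> (a s) (a t) * \<alpha> t y) * \<alpha> s x"
        by (simp only: *(1))
    qed
    finally show ?thesis by (simp add: sum_distrib_right)
  qed
  define h where "h = (\<lambda>w. \<Sum>s<m. \<Sum>t<m. U.comm \<phi> (a s) (a t) * \<alpha> t (S, w, j) * \<alpha> s (S, w, i))"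
  have "h w = 0"
  proof (cases "w \<in> chart_dom (Cf G) S")
    case False
    then show ?thesis unfolding h_def using *(2) by (intro sum.neutral ballI) (simp add: Omega1_outside[OF _ False])
  next
    case True
    show ?thesis
    proof (rule vanishes_if_vanishes_generically[where D="chart_dom (Cf G) S" and h=h])
      show "open (chart_dom (Cf G) S)"
        using open_submanifold_Cf[where 'n='n] unfolding open_submanifold_def by blast
      show "continuous_on (chart_dom (Cf G) S) h"
        unfolding h_def using *(2)
        by (intro continuous_on_sum continuous_on_mult continuous_on_const
            holomorphic_several_continuous[OF Omega1_holomorphic]) auto
      fix w assume w: "w \<in> chart_dom (Cf G) S" "\<And>k. w $ k \<noteq> 0"
      define z where "z = swap_coords S w"
      have z: "z \<in> chart_dom (Cf G) {}" unfolding z_def by (rule swap_coords_chart_dom[OF w(2,1)])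
      have "h w = (\<Sum>s<m. \<Sum>t<m. (U.comm \<phi> (a s) (a t) * \<alpha> t ({}, z, j) * \<alpha> s ({}, z, i)) *
          (jacobian S i (w $ i) * jacobian S j (w $ j)))"
        unfolding h_def using *(2)
        by (intro sum.cong refl) (simp add: Omega1_swap_coords[OF _ w] z_def mult_ac)
      also have "\<dots> = U.comm \<phi> (\<omega> 1 ({}, z, i)) (\<omega> 1 ({}, z, j)) * (jacobian S i (w $ i) * jacobian S j (w $ j))"
        unfolding e sum_distrib_right ..
      also have "\<dots> = 0"
        using affine_coeff_commute[OF \<phi> z[unfolded affine_chart], of i j] unfolding affine[OF z] by simp
      finally show "h w = 0" .
    qed (rule True)
  qed
  then show ?thesis unfolding e h_def .
qed

lemma wedge_\<omega>: "wedge U \<omega> \<omega> = zero_form U"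
proof (rule ext, rule ext)
  fix k and x :: "'n idx2"
  obtain S w i j where x: "x = (S, w, i, j)" by (cases x)
  have zz: "\<zero>\<^bsub>U\<^esub> \<ominus>\<^bsub>U\<^esub> \<zero>\<^bsub>U\<^esub> = \<zero>\<^bsub>U\<^esub>" by (simp add: a_minus_def)
  have "\<omega> l (S, w, i) \<otimes>\<^bsub>U\<^esub> \<omega> (k - l) (S, w, j) \<ominus>\<^bsub>U\<^esub> \<omega> l (S, w, j) \<otimes>\<^bsub>U\<^esub> \<omega> (k - l) (S, w, i) = \<zero>\<^bsub>U\<^esub>" for l
  \<comment> \<open>Every term of the convolution but one has a factor in a degree other than 1,
    which is zero. The remaining one, with l = 1 and k = 2, is a commutator.\<close>
  proof (cases "l = 1 \<and> k - l = 1")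
    case True
    then have l: "l = 1" "k - 1 = 1" by auto
    show ?thesis
      unfolding l
    proof (rule U.separated)
      show "\<omega> 1 (S, w, i) \<otimes>\<^bsub>U\<^esub> \<omega> 1 (S, w, j) \<ominus>\<^bsub>U\<^esub> \<omega> 1 (S, w, j) \<otimes>\<^bsub>U\<^esub> \<omega> 1 (S, w, i) \<in> carrier U"
        by (intro U.minus_closed U.mult_closed \<omega>_closed)
      fix \<phi> assume "functional U \<phi>"
      from comm_\<omega>[OF this, of S w i j]
      show "\<phi> (\<omega> 1 (S, w, i) \<otimes>\<^bsub>U\<^esub> \<omega> 1 (S, w, j) \<ominus>\<^bsub>U\<^esub> \<omega> 1 (S, w, j) \<otimes>\<^bsub>U\<^esub> \<omega> 1 (S, w, i)) = 0"
        by (simp add: U.comm_def)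
    qed
  next
    case False
    then consider "l \<noteq> 1" | "k - l \<noteq> 1" by blast
    then show ?thesis
    proof cases
      case 1
      show ?thesis by (simp only: \<omega>_degree[OF 1] zero_mult[OF \<omega>_closed] zz)
    next
      case 2
      show ?thesis by (simp only: \<omega>_degree[OF 2] zero_mult[OF \<omega>_closed] zz)
    qed
  qed
  then show "wedge U \<omega> \<omega> k x = zero_form U k x" by (simp add: wedge_def zero_form_def x)
qed

lemma flat_connection:
  "formal_connection (Cf G) U \<omega> \<and> flat (Cf G) U \<omega> \<and> d_completed (Cf G) U \<omega> = wedge U \<omega> \<omega> \<and>
   wedge U \<omega> \<omega> = zero_form U"
proof -
  have "\<zero>\<^bsub>U\<^esub> \<ominus>\<^bsub>U\<^esub> \<zero>\<^bsub>U\<^esub> = \<zero>\<^bsub>U\<^esub>" by (simp add: a_minus_def)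
  then have "flat (Cf G) U \<omega>" by (simp add: flat_def d_\<omega> wedge_\<omega> diff_form_def zero_form_def)
  then show ?thesis using forms
    by (simp add: formal_connection_def open_submanifold_Cf \<omega>_degree d_\<omega> wedge_\<omega>)
qed

end

end

theorem proposition1p10:
  fixes G :: "psu2 set"
    and \<omega> :: "nat \<Rightarrow> ('n::finite) idx1 \<Rightarrow> 'n upn"
  assumes "subgroup G PSU2" and "finite G"
    and "\<omega> \<in> completed_forms (Omega1 (Cf G)) (Upn G)"
    and "\<And>k z i. z \<in> chart_dom (Cf G) {} \<Longrightarrow>
           \<omega> k ({}, z, i) = (if k = 1 then affine_coeff G z i else \<zero>\<^bsub>Upn G\<^esub>)"
  shows "formal_connection (Cf G) (Upn G) \<omega> \<and> flat (Cf G) (Upn G) \<omega> \<and>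
         d_completed (Cf G) (Upn G) \<omega> = wedge (Upn G) \<omega> \<omega> \<and>
         wedge (Upn G) \<omega> \<omega> = zero_form (Upn G)"
proof -
  interpret pn_algebra G "TYPE('n)" by (intro pn_algebra.intro finite_psu2.intro assms(1,2))
  show ?thesis using flat_connection[of \<omega>] assms(3,4) unfolding Upn_eq by blast
qed

end
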